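(* Let $d\geq 3$ and let $e_1,\dots,e_d$ be the canonical basis of $\mathbb{R}^d$. Set $\Theta(e_1,e_2)=\{\theta\in\mathbb{S}^{d-1} : \theta\perp e_1,\ \theta\perp e_2\}$. There exist a function $W:\mathbb{R}^d\times\mathbb{S}^{d-1}\to\mathbb{R}$ and a function $f\in C_0^\infty(\mathbb{R}^d)$ such that: (i) $W$ is real valued, $W\in L^\infty(\mathbb{R}^d\times\mathbb{S}^{d-1})$, and $W\geq c>0$ for some constant $c$; in fact $1/2\leq W\leq 1$ everywhere on $\mathbb{R}^d\times\mathbb{S}^{d-1}$; (ii) $W$ is $C^\infty$-smooth on $\mathbb{R}^d\times(\mathbb{S}^{d-1}\setminus\Theta(e_1,e_2))$; (iii) $f\not\equiv 0$; (iv) $R_Wf(s,\theta)=0$ for all $(s,\theta)\in\mathbb{R}\times\mathbb{S}^{d-1}$.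
   Context: For a weight $W=W(x,\theta)$ on $\mathbb{R}^d\times\mathbb{S}^{d-1}$ and a function $f$ on $\mathbb{R}^d$, the weighted Radon transform along hyperplanes is $R_Wf(s,\theta)=\int_{\{x\in\mathbb{R}^d:\ x\cdot\theta=s\}} W(x,\theta)f(x)\,dx$, $(s,\theta)\in\mathbb{R}\times\mathbb{S}^{d-1}$, where $dx$ denotes the $(d-1)$-dimensional Lebesgue (surface) measure on the hyperplane $\{x\cdot\theta=s\}$. $C_0^\infty(\mathbb{R}^d)$ denotes infinitely smooth compactly supported functions on $\mathbb{R}^d$. The set $\Theta(e_1,e_2)\simeq\mathbb{S}^{d-3}$ has zero measure on $\mathbb{S}^{d-1}$. *)

theory Defs
  imports "HOL-Analysis.Analysis"
begin

text \<open>C-infinity smoothness on a set S of a real-valued function on a Euclidean space: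
  there is a family D of functions, indexed by finite lists of basis directions
  (D [] = f on S, D (b # al) is the partial derivative of D al in direction b),
  all of which are continuous on S.  I.e. all iterated partial derivatives exist
  and are continuous on S.\<close>
definition smooth_on :: "'a::euclidean_space set \<Rightarrow> ('a \<Rightarrow> real) \<Rightarrow> bool" where
  "smooth_on S f \<longleftrightarrow>
     (\<exists>D :: 'a list \<Rightarrow> 'a \<Rightarrow> real.
        (\<forall>x\<in>S. D [] x = f x) \<and>
        (\<forall>al. continuous_on S (D al)) \<and>
        (\<forall>al. \<forall>b\<in>Basis. \<forall>x\<in>S.
           ((\<lambda>t. D al (x + t *\<^sub>R b)) has_real_derivative D (b # al) x) (at 0)))"

definition C0_infty :: "('a::euclidean_space \<Rightarrow> real) \<Rightarrow> bool" where
  "C0_infty f \<longleftrightarrow> smooth_on UNIV f \<and> (\<exists>K. compact K \<and> (\<forall>x. x \<notin> K \<longrightarrow> f x = 0))"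

definition Theta :: "'n::finite \<Rightarrow> 'n \<Rightarrow> (real^'n) set" where
  "Theta a b = {\<theta> \<in> sphere 0 1. \<theta> \<bullet> axis a 1 = 0 \<and> \<theta> \<bullet> axis b 1 = 0}"

definition coord_emb :: "'n::finite \<Rightarrow> ('n \<Rightarrow> real) \<Rightarrow> real^'n" where
  "coord_emb k g = (\<chi> i. if i = k then 0 else g i)"

definition hyp_frame :: "real^'n::finite \<Rightarrow> 'n \<times> (real^'n \<Rightarrow> real^'n)" where
  "hyp_frame \<theta> = (SOME (k, U). orthogonal_transformation U \<and> U (axis k 1) = \<theta>)"

text \<open>(d-1)-dimensional surface (Lebesgue) measure on the hyperplane {x. x \<bullet> theta = s},
  theta a unit vector: image of (d-1)-dimensional Lebesgue measure on the coordinate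
  hyperplane e_k^perp under the isometry z \<mapsto> s theta + U z.\<close>
definition hyperplane_measure :: "real \<Rightarrow> real^'n::finite \<Rightarrow> (real^'n) measure" where
  "hyperplane_measure s \<theta> =
     (case hyp_frame \<theta> of (k, U) \<Rightarrow>
        distr (PiM (UNIV - {k}) (\<lambda>_. lborel)) borel
              (\<lambda>g. s *\<^sub>R \<theta> + U (coord_emb k g)))"

definition weighted_radon ::
  "(real^'n::finite \<Rightarrow> real^'n \<Rightarrow> real) \<Rightarrow> (real^'n \<Rightarrow> real) \<Rightarrow> real \<Rightarrow> real^'n \<Rightarrow> real" where
  "weighted_radon W f s \<theta> = integral\<^sup>L (hyperplane_measure s \<theta>) (\<lambda>x. W x \<theta> * f x)"

end

theory Submission
  imports Defs
begin

text \<open>The weight and the function depend on \<open>x\<close> essentially through its first two coordinates, and on \<open>\<theta>\<close>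
  through the normalized projection \<open>n\<close> of \<open>\<theta>\<close> to the coordinate plane. Every hyperplane is foliated by
  lines parallel to that plane and orthogonal to \<open>n\<close>, so everything reduces to the weighted Radon
  transform in the plane, that is, to a version of Boman's example.

  There \<open>f0 = \<Sum> c J * F J\<close>, where \<open>F J\<close> lives on an annulus of width about \<open>4 ^ (- k)\<close> near the unit
  circle and oscillates so fast in the angular variable that its integrals along lines are
  negligible, while the integrals of \<open>(F J)\<^sup>2\<close> along lines crossing the annulus are at least a
  multiple of \<open>4 ^ (- k)\<close>. Subtracting from the constant weight suitable multiples of the \<open>F J\<close> makes all
  line integrals vanish, and the correction is small, smooth, and flat on the unit circle. Lines
  near the centre cross the annuli in the radial direction; they are corrected by one additional
  annulus carrying radial oscillations.\<close>

section \<open>Families of functions with moderate derivatives\<close>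

text \<open>The delicate place is the unit circle. Near its tangents the integrals of squares that
  one divides by are only of order \<open>4 ^ (- k)\<close>, and each derivative costs a power of
  the frequency, so the integrals of \<open>f0\<close> must be small beyond all powers. Three scales
  achieve this, each beyond every power of the preceding one: \<open>4 ^ k\<close> for the widths,
  2^(k^2) for the frequencies, 2^(k^3) for the reciprocal amplitudes. The last makes
  \<open>f0\<close> smooth. On the other hand the quotient of two neighbouring amplitudes (past
  \<open>c 0\<close>) is below a fixed power of the frequency, so dividing by \<open>c K\<close>
  with \<open>K \<le> J + 1\<close> is paid for by the oscillatory decay. This decay is lost on
  lines with \<bar>s\<bar> < 1/2. There only the additional annulus corrects; its amplitude is 1,
  and the small amplitudes of the other annuli take over. Smoothness of the sums is the other
  obstacle, since explicit derivative bounds for quotients of line integrals would be unwieldy.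
  Moderateness passes through all operations by induction on the order, and for moderate families a
  bound on the values is then enough.\<close>

text \<open>As in Colombeau's algebra, a family \<open>u i\<close> is called moderate if on each compact set it is bounded
  by \<open>C * w i ^ m\<close> with \<open>C\<close> and \<open>m\<close> independent of \<open>i\<close>. Different weights \<open>w\<close> on the index type serve
  different purposes: with \<open>w = 1\<close> on \<open>unit\<close> the notion reduces to continuity of a single function.\<close>

definition modb :: "('i \<Rightarrow> real) \<Rightarrow> 'a set \<Rightarrow> ('i \<Rightarrow> 'a \<Rightarrow> real) \<Rightarrow> bool" where
  "modb w K u \<longleftrightarrow> (\<exists>C\<ge>0. \<exists>m. \<forall>i. \<forall>x\<in>K. \<bar>u i x\<bar> \<le> C * w i ^ m)"

definition lmod :: "('i \<Rightarrow> real) \<Rightarrow> 'a::euclidean_space set \<Rightarrow> ('i \<Rightarrow> 'a \<Rightarrow> real) \<Rightarrow> bool" where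
  "lmod w S u \<longleftrightarrow> (\<forall>i. 1 \<le> w i) \<and> (\<forall>i. continuous_on S (u i)) \<and>
     (\<forall>K. compact K \<longrightarrow> K \<subseteq> S \<longrightarrow> modb w K u)"

definition pder ::
  "'a::euclidean_space set \<Rightarrow> 'a \<Rightarrow> ('i \<Rightarrow> 'a \<Rightarrow> real) \<Rightarrow> ('i \<Rightarrow> 'a \<Rightarrow> real) \<Rightarrow> bool" where
  "pder S b u v \<longleftrightarrow>
     (\<forall>i. \<forall>x\<in>S. ((\<lambda>t. u i (x + t *\<^sub>R b)) has_real_derivative v i x) (at 0))"

text \<open>Derivatives are required to exist as families instead of being computed by an operator,
  so closure under an operation is proved by exhibiting the derivative and applying the induction
  hypothesis to it.\<close>

primrec Cm :: "('i \<Rightarrow> real) \<Rightarrow> 'a::euclidean_space set \<Rightarrow> nat \<Rightarrow> ('i \<Rightarrow> 'a \<Rightarrow> real) \<Rightarrow> bool" where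
  "Cm w S 0 u = lmod w S u"
| "Cm w S (Suc n) u = (lmod w S u \<and> (\<forall>b\<in>Basis. \<exists>v. pder S b u v \<and> Cm w S n v))"

definition Cinf :: "('i \<Rightarrow> real) \<Rightarrow> 'a::euclidean_space set \<Rightarrow> ('i \<Rightarrow> 'a \<Rightarrow> real) \<Rightarrow> bool" where
  "Cinf w S u \<longleftrightarrow> (\<forall>n. Cm w S n u)"

abbreviation (input) smooth1 :: "'a::euclidean_space set \<Rightarrow> ('a \<Rightarrow> real) \<Rightarrow> bool" where
  "smooth1 S f \<equiv> Cinf (\<lambda>_::unit. 1) S (\<lambda>_. f)"

lemma Cm_lmod: "Cm w S n u \<Longrightarrow> lmod w S u"
  by (cases n) auto

lemma Cm_Suc: "Cm w S (Suc n) u \<Longrightarrow> Cm w S n u"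
proof (induction n arbitrary: u)
  case (Suc n)
  then show ?case unfolding Cm.simps(2)[of w S "Suc n"] Cm.simps(2)[of w S n] by blast
qed simp

lemma Cinf_Cm: "Cinf w S u \<Longrightarrow> Cm w S n u"
  by (simp add: Cinf_def)

lemma lmod_w: "lmod w S u \<Longrightarrow> 1 \<le> w i"
  by (simp add: lmod_def)

lemma Cinf_w: "Cinf w S u \<Longrightarrow> 1 \<le> w i"
  using Cinf_Cm[of w S u 0] by (simp add: lmod_def)

lemma lmod_cont: "lmod w S u \<Longrightarrow> continuous_on S (u i)"
  by (simp add: lmod_def)

lemma Cinf_cont: "Cinf w S u \<Longrightarrow> continuous_on S (u i)"
  using Cinf_Cm[of w S u 0] by (simp add: lmod_def)

lemma lmod_modb: "lmod w S u \<Longrightarrow> compact K \<Longrightarrow> K \<subseteq> S \<Longrightarrow> modb w K u"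
  by (simp add: lmod_def)

lemma pder_unique:
  assumes "pder S b u v" "pder S b u v'" "x \<in> S"
  shows "v i x = v' i x"
  using assms DERIV_unique unfolding pder_def by blast

lemma lmod_cong:
  assumes "lmod w S u" "\<And>i x. x \<in> S \<Longrightarrow> u i x = u' i x"
  shows "lmod w S u'"
proof -
  have "continuous_on S (u' i)" for i
    using assms continuous_on_cong[of S S "u i" "u' i"] unfolding lmod_def by auto
  moreover have "modb w K u'" if "compact K" "K \<subseteq> S" for K
    using lmod_modb[OF assms(1) that] assms(2) that unfolding modb_def by (metis subsetD)
  ultimately show ?thesis using assms(1) unfolding lmod_def by blast
qed

lemma eventually_line_in_open:
  fixes x b :: "'a::euclidean_space"
  assumes "open S" "x \<in> S"
  shows "eventually (\<lambda>t::real. x + t *\<^sub>R b \<in> S) (nhds 0)"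
proof -
  have "((\<lambda>t::real. x + t *\<^sub>R b) \<longlongrightarrow> x + 0 *\<^sub>R b) (nhds 0)"
    by (intro tendsto_intros filterlim_ident)
  then show ?thesis using assms topological_tendstoD by fastforce
qed

lemma pder_cong:
  assumes "open S" "pder S b u v" "\<And>i x. x \<in> S \<Longrightarrow> u i x = u' i x"
  shows "pder S b u' v"
  unfolding pder_def
proof (intro allI ballI)
  fix i x assume x: "x \<in> S"
  have "eventually (\<lambda>t. u i (x + t *\<^sub>R b) = u' i (x + t *\<^sub>R b)) (nhds 0)"
    using eventually_line_in_open[OF assms(1) x, of b] by eventually_elim (rule assms(3))
  from DERIV_cong_ev[OF refl this refl]
  show "((\<lambda>t. u' i (x + t *\<^sub>R b)) has_real_derivative v i x) (at 0)"
    using assms(2) x unfolding pder_def by blast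
qed

lemma Cm_cong:
  assumes "open S" "Cm w S n u" "\<And>i x. x \<in> S \<Longrightarrow> u i x = u' i x"
  shows "Cm w S n u'"
  using assms(2)
proof (cases n)
  case 0
  then show ?thesis using lmod_cong assms by fastforce
next
  case (Suc m)
  have "lmod w S u'" using lmod_cong[OF Cm_lmod[OF assms(2)] assms(3)] .
  moreover have "pder S b u' v" if "pder S b u v" for b v
    using pder_cong[OF assms(1) that assms(3)] .
  ultimately show ?thesis using assms(2) unfolding Suc Cm.simps by blast
qed

lemma Cinf_cong:
  "open S \<Longrightarrow> Cinf w S u \<Longrightarrow> (\<And>i x. x \<in> S \<Longrightarrow> u i x = u' i x) \<Longrightarrow> Cinf w S u'"
  unfolding Cinf_def using Cm_cong by blast

text \<open>The witnesses belonging to different orders \<open>n\<close> agree on \<open>S\<close>,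
  because a derivative along a line is unique; hence a single one has every order.\<close>

lemma Cinf_deriv:
  assumes "open S" "Cinf w S u" "b \<in> Basis"
  shows "\<exists>v. pder S b u v \<and> Cinf w S v"
proof -
  have *: "\<exists>v. pder S b u v \<and> Cm w S n v" for n
    using Cinf_Cm[OF assms(2), of "Suc n"] assms(3) by auto
  then obtain v where v: "pder S b u v" by blast
  have "Cm w S n v" for n
  proof -
    obtain v' where "pder S b u v'" "Cm w S n v'" using * by blast
    then show ?thesis by (intro Cm_cong[OF assms(1), of w n v' v] pder_unique[OF _ v])
  qed
  then show ?thesis using v unfolding Cinf_def by blast
qed

text \<open>\<open>pder\<close> differentiates at parameter 0 only, while the mean value theorem and
  the Leibniz rule need every parameter of the line.\<close>

lemma pder_at:
  assumes "pder S b u v" "x + s *\<^sub>R b \<in> S"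
  shows "((\<lambda>t. u i (x + t *\<^sub>R b)) has_real_derivative v i (x + s *\<^sub>R b)) (at s)"
proof -
  have "((\<lambda>t. u i ((x + s *\<^sub>R b) + t *\<^sub>R b)) has_real_derivative v i (x + s *\<^sub>R b)) (at 0)"
    using assms unfolding pder_def by blast
  then have "((\<lambda>t. u i (x + (t + s) *\<^sub>R b)) has_real_derivative v i (x + s *\<^sub>R b)) (at 0)"
    by (simp add: algebra_simps)
  then show ?thesis using DERIV_shift[of "\<lambda>t. u i (x + t *\<^sub>R b)" _ 0 s] by simp
qed

section \<open>Sums and products of moderate families\<close>

lemma modb_const:
  assumes "\<And>i. \<bar>a i\<bar> \<le> C * w i ^ m" "\<And>i. (1::real) \<le> w i"
  shows "modb w K (\<lambda>i x. a i)"
proof -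
  have "\<bar>a i\<bar> \<le> \<bar>C\<bar> * w i ^ m" for i
    using assms(1)[of i] mult_right_mono[of C "\<bar>C\<bar>" "w i ^ m"] assms(2)[of i]
    by (smt (verit) abs_ge_self zero_le_power)
  then show ?thesis unfolding modb_def by (intro exI[of _ "\<bar>C\<bar>"]) auto
qed

lemma modb_add:
  assumes "modb w K u" "modb w K v" "\<And>i. 1 \<le> w i"
  shows "modb w K (\<lambda>i x. u i x + v i x)"
proof -
  obtain C m where 1: "C \<ge> 0" "\<And>i x. x \<in> K \<Longrightarrow> \<bar>u i x\<bar> \<le> C * w i ^ m"
    using assms(1) unfolding modb_def by blast
  obtain D l where 2: "D \<ge> 0" "\<And>i x. x \<in> K \<Longrightarrow> \<bar>v i x\<bar> \<le> D * w i ^ l"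
    using assms(2) unfolding modb_def by blast
  have "\<bar>u i x + v i x\<bar> \<le> (C + D) * w i ^ (m + l)" if "x \<in> K" for i x
  proof -
    have "C * w i ^ m \<le> C * w i ^ (m + l)" "D * w i ^ l \<le> D * w i ^ (m + l)"
      using 1(1) 2(1) assms(3)[of i] by (auto intro!: mult_left_mono power_increasing)
    then show ?thesis using 1(2)[OF that, of i] 2(2)[OF that, of i]
      by (simp add: distrib_right)
  qed
  then show ?thesis unfolding modb_def using 1(1) 2(1) by (intro exI[of _ "C + D"]) auto
qed

lemma modb_mult:
  assumes "modb w K u" "modb w K v" "\<And>i. 1 \<le> w i"
  shows "modb w K (\<lambda>i x. u i x * v i x)"
proof -
  obtain C m where 1: "C \<ge> 0" "\<And>i x. x \<in> K \<Longrightarrow> \<bar>u i x\<bar> \<le> C * w i ^ m"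
    using assms(1) unfolding modb_def by blast
  obtain D l where 2: "D \<ge> 0" "\<And>i x. x \<in> K \<Longrightarrow> \<bar>v i x\<bar> \<le> D * w i ^ l"
    using assms(2) unfolding modb_def by blast
  have "\<bar>u i x * v i x\<bar> \<le> (C * D) * w i ^ (m + l)" if "x \<in> K" for i x
  proof -
    have "\<bar>u i x * v i x\<bar> \<le> (C * w i ^ m) * (D * w i ^ l)"
      unfolding abs_mult using 1 2 that assms(3)[of i]
      by (intro mult_mono) (auto intro!: mult_nonneg_nonneg zero_le_power dual_order.trans[OF assms(3)])
    then show ?thesis by (simp add: power_add ac_simps)
  qed
  then show ?thesis unfolding modb_def using 1(1) 2(1) by (intro exI[of _ "C * D"]) auto
qed

lemma lmod_const:
  assumes "\<And>i. \<bar>a i\<bar> \<le> C * w i ^ m" "\<And>i. 1 \<le> w i"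
  shows "lmod w S (\<lambda>i x. a i)"
  unfolding lmod_def using modb_const[OF assms] assms by auto

lemma lmod_add: "lmod w S u \<Longrightarrow> lmod w S v \<Longrightarrow> lmod w S (\<lambda>i x. u i x + v i x)"
  unfolding lmod_def by (auto intro!: continuous_intros modb_add)

lemma lmod_mult: "lmod w S u \<Longrightarrow> lmod w S v \<Longrightarrow> lmod w S (\<lambda>i x. u i x * v i x)"
  unfolding lmod_def by (auto intro!: continuous_intros modb_mult)

lemma Cm_const:
  assumes "\<And>i. \<bar>a i\<bar> \<le> C * w i ^ m" "\<And>i. 1 \<le> w i"
  shows "Cm w S n (\<lambda>i x. a i)"
proof -
  have z: "Cm w S n (\<lambda>i x. 0)" for n
  proof (induction n)
    case 0
    show ?case using lmod_const[of "\<lambda>_. 0" 0 w 0] assms(2) by simp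
  next
    case (Suc n)
    then show ?case using lmod_const[of "\<lambda>_. 0" 0 w 0] assms(2)
      by (auto simp: pder_def intro!: exI[of _ "\<lambda>i x. 0"])
  qed
  show ?thesis
    using z lmod_const[OF assms]
    by (cases n) (auto simp: pder_def intro!: exI[of _ "\<lambda>i x. 0"])
qed

lemma Cm_add: "Cm w S n u \<Longrightarrow> Cm w S n v \<Longrightarrow> Cm w S n (\<lambda>i x. u i x + v i x)"
proof (induction n arbitrary: u v)
  case 0
  then show ?case by (simp add: lmod_add)
next
  case (Suc n)
  have "\<exists>z. pder S b (\<lambda>i x. u i x + v i x) z \<and> Cm w S n z" if b: "b \<in> Basis" for b
  proof -
    obtain u' v' where *: "pder S b u u'" "Cm w S n u'" "pder S b v v'" "Cm w S n v'"
      using Suc.prems b unfolding Cm.simps by blast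
    then show ?thesis
      by (intro exI[of _ "\<lambda>i x. u' i x + v' i x"]) (auto intro: Suc.IH simp: pder_def intro!: DERIV_add)
  qed
  then show ?case using Suc.prems lmod_add by auto
qed

lemma Cm_mult: "Cm w S n u \<Longrightarrow> Cm w S n v \<Longrightarrow> Cm w S n (\<lambda>i x. u i x * v i x)"
proof (induction n arbitrary: u v)
  case 0
  then show ?case by (simp add: lmod_mult)
next
  case (Suc n)
  have "\<exists>z. pder S b (\<lambda>i x. u i x * v i x) z \<and> Cm w S n z" if b: "b \<in> Basis" for b
  proof -
    obtain u' v' where *: "pder S b u u'" "Cm w S n u'" "pder S b v v'" "Cm w S n v'"
      using Suc.prems b unfolding Cm.simps by blast
    have "pder S b (\<lambda>i x. u i x * v i x) (\<lambda>i x. u' i x * v i x + v' i x * u i x)"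
      unfolding pder_def
    proof (intro allI ballI)
      fix i x assume "x \<in> S"
      then have "((\<lambda>t. u i (x + t *\<^sub>R b)) has_real_derivative u' i x) (at 0)"
        "((\<lambda>t. v i (x + t *\<^sub>R b)) has_real_derivative v' i x) (at 0)"
        using * unfolding pder_def by auto
      from DERIV_mult[OF this]
      show "((\<lambda>t. u i (x + t *\<^sub>R b) * v i (x + t *\<^sub>R b)) has_real_derivative
          u' i x * v i x + v' i x * u i x) (at 0)" by simp
    qed
    moreover have "Cm w S n (\<lambda>i x. u' i x * v i x + v' i x * u i x)"
      by (intro Cm_add Suc.IH * Suc.prems[THEN Cm_Suc])
    ultimately show ?thesis by blast
  qed
  then show ?case using Suc.prems lmod_mult by auto
qed

lemma Cm_cmult:
  assumes "Cm w S n u" "\<And>i. \<bar>a i\<bar> \<le> C * w i ^ m"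
  shows "Cm w S n (\<lambda>i x. a i * u i x)"
  using Cm_mult[OF Cm_const[of a C w m S n] assms(1)] assms(2) lmod_w[OF Cm_lmod[OF assms(1)]] by blast

lemma Cm_scale: "Cm w S n u \<Longrightarrow> Cm w S n (\<lambda>i x. a * u i x)"
  using Cm_cmult[of w S n u "\<lambda>_. a" "\<bar>a\<bar>" 0] by simp

lemma Cm_minus: "Cm w S n u \<Longrightarrow> Cm w S n (\<lambda>i x. - u i x)"
  using Cm_scale[of w S n u "-1"] by simp

lemma Cm_diff: "Cm w S n u \<Longrightarrow> Cm w S n v \<Longrightarrow> Cm w S n (\<lambda>i x. u i x - v i x)"
  using Cm_add[OF _ Cm_minus] by fastforce

lemma Cinf_const:
  "(\<And>i. \<bar>a i\<bar> \<le> C * w i ^ m) \<Longrightarrow> (\<And>i. 1 \<le> w i) \<Longrightarrow> Cinf w S (\<lambda>i x. a i)"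
  unfolding Cinf_def using Cm_const by blast

lemma Cinf_const': "(\<And>i. 1 \<le> w i) \<Longrightarrow> Cinf w S (\<lambda>i x. a)"
  using Cinf_const[of "\<lambda>_. a" "\<bar>a\<bar>" w 0] by simp

lemma Cinf_add: "Cinf w S u \<Longrightarrow> Cinf w S v \<Longrightarrow> Cinf w S (\<lambda>i x. u i x + v i x)"
  and Cinf_mult: "Cinf w S u \<Longrightarrow> Cinf w S v \<Longrightarrow> Cinf w S (\<lambda>i x. u i x * v i x)"
  and Cinf_diff: "Cinf w S u \<Longrightarrow> Cinf w S v \<Longrightarrow> Cinf w S (\<lambda>i x. u i x - v i x)"
  and Cinf_scale: "Cinf w S u \<Longrightarrow> Cinf w S (\<lambda>i x. a * u i x)"
  unfolding Cinf_def by (auto intro: Cm_add Cm_mult Cm_diff Cm_scale)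

lemma Cinf_power: "Cinf w S u \<Longrightarrow> Cinf w S (\<lambda>i x. u i x ^ n)"
proof (induction n)
  case 0
  then show ?case using Cinf_const'[OF Cinf_w] by auto
next
  case (Suc n)
  then show ?case using Cinf_mult by auto
qed

lemma Cinf_cmult:
  "Cinf w S u \<Longrightarrow> (\<And>i. \<bar>a i\<bar> \<le> C * w i ^ m) \<Longrightarrow> Cinf w S (\<lambda>i x. a i * u i x)"
  unfolding Cinf_def using Cm_cmult by blast

text \<open>A case distinction on the index alone is a sum with coefficients 0 and 1, so it reduces
  to sums and products.\<close>

lemma Cinf_if:
  assumes "Cinf w S u" "Cinf w S v"
  shows "Cinf w S (\<lambda>i x. if P i then u i x else v i x)"
proof -
  have w: "1 \<le> w i" for i using Cinf_w[OF assms(1)] .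
  have "Cinf w S (\<lambda>i x. of_bool (P i))" "Cinf w S (\<lambda>i x. of_bool (\<not> P i))"
    by (rule Cinf_const[of _ 1 w 0]; simp add: w)+
  from Cinf_add[OF Cinf_mult[OF this(1) assms(1)] Cinf_mult[OF this(2) assms(2)]]
  have *: "Cinf w S (\<lambda>i x. of_bool (P i) * u i x + of_bool (\<not> P i) * v i x)" .
  have "(\<lambda>i x. of_bool (P i) * u i x + of_bool (\<not> P i) * v i x) = (\<lambda>i x. if P i then u i x else v i x)"
    by (intro ext) simp
  with * show ?thesis by (simp only:)
qed

section \<open>Change of index and of weight\<close>

lemma modb_reindex:
  assumes "modb w K u" "\<And>j. w (r j) \<le> C * w' j ^ m" "\<And>j. 1 \<le> w (r j)" "\<And>j. 1 \<le> w' j"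
  shows "modb w' K (\<lambda>j. u (r j))"
proof -
  obtain D l where 1: "D \<ge> 0" "\<And>i x. x \<in> K \<Longrightarrow> \<bar>u i x\<bar> \<le> D * w i ^ l"
    using assms(1) unfolding modb_def by blast
  have "\<bar>u (r j) x\<bar> \<le> D * \<bar>C\<bar> ^ l * w' j ^ (m * l)" if "x \<in> K" for j x
  proof -
    have "w (r j) \<le> \<bar>C\<bar> * w' j ^ m"
      using assms(2)[of j] assms(4)[of j] mult_right_mono[of C "\<bar>C\<bar>" "w' j ^ m"]
      by (smt (verit) abs_ge_self zero_le_power)
    then have "w (r j) ^ l \<le> (\<bar>C\<bar> * w' j ^ m) ^ l"
      using assms(3)[of j] by (intro power_mono) auto
    then have "D * w (r j) ^ l \<le> D * (\<bar>C\<bar> * w' j ^ m) ^ l"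
      using 1(1) by (rule mult_left_mono)
    also have "\<dots> = D * \<bar>C\<bar> ^ l * w' j ^ (m * l)"
      by (simp only: power_mult_distrib power_mult mult.assoc)
    finally have "D * w (r j) ^ l \<le> D * \<bar>C\<bar> ^ l * w' j ^ (m * l)" .
    then show ?thesis using 1(2)[OF that, of "r j"] by linarith
  qed
  then show ?thesis unfolding modb_def using 1(1)
    by (intro exI[of _ "D * \<bar>C\<bar> ^ l"]) (auto intro!: exI[of _ "m * l"])
qed

lemma lmod_reindex:
  assumes "lmod w S u" "\<And>j. w (r j) \<le> C * w' j ^ m" "\<And>j. 1 \<le> w' j"
  shows "lmod w' S (\<lambda>j. u (r j))"
  unfolding lmod_def
proof (intro conjI allI impI)
  fix K assume "compact K" "K \<subseteq> S"
  then have "modb w K u" using assms(1) lmod_modb by blast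
  then show "modb w' K (\<lambda>j. u (r j))"
    using assms(2) lmod_w[OF assms(1)] assms(3) by (rule modb_reindex[where r = r])
qed (fact assms(3), rule lmod_cont[OF assms(1)])

lemma Cm_reindex:
  assumes "\<And>j. w (r j) \<le> C * w' j ^ m" "\<And>j. 1 \<le> w' j"
  shows "Cm w S n u \<Longrightarrow> Cm w' S n (\<lambda>j. u (r j))"
proof (induction n arbitrary: u)
  case (Suc n)
  have 1: "lmod w' S (\<lambda>j. u (r j))"
    using Cm_lmod[OF Suc.prems] assms by (rule lmod_reindex[where r = r])
  have 2: "\<exists>v. pder S b (\<lambda>j. u (r j)) v \<and> Cm w' S n v" if "b \<in> Basis" for b
  proof -
    have "\<exists>v. pder S b u v \<and> Cm w S n v" using Suc.prems that by simp
    then obtain v where v: "pder S b u v" "Cm w S n v" by blast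
    have "pder S b (\<lambda>j. u (r j)) (\<lambda>j. v (r j))" using v(1) unfolding pder_def by simp
    with Suc.IH[OF v(2)] show ?thesis by blast
  qed
  show ?case unfolding Cm.simps by (intro conjI ballI 1 2)
next
  case 0
  then have "lmod w S u" by simp
  then have "lmod w' S (\<lambda>j. u (r j))"
    using assms by (rule lmod_reindex[where r = r])
  then show ?case by simp
qed

text \<open>Three uses in one: replacing the weight by a polynomially larger one, viewing a single
  function as a constant family, and extracting a single member of a family.\<close>

lemma Cinf_reindex:
  assumes "Cinf w S u" "\<And>j. w (r j) \<le> C * w' j ^ m" "\<And>j. 1 \<le> w' j"
  shows "Cinf w' S (\<lambda>j. u (r j))"
  unfolding Cinf_def
proof
  fix n
  show "Cm w' S n (\<lambda>j. u (r j))"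
    using assms(2,3) Cinf_Cm[OF assms(1)] by (rule Cm_reindex[where r = r])
qed

lemma Cinf_family:
  assumes "smooth1 S f" "\<And>j. 1 \<le> w j"
  shows "Cinf w S (\<lambda>j. f)"
  using assms(1) by (rule Cinf_reindex[where r = "\<lambda>_. ()" and C = 1 and m = 0]) (use assms in auto)

lemma Cinf_single:
  assumes "Cinf w S u"
  shows "smooth1 S (u i)"
  using assms by (rule Cinf_reindex[where r = "\<lambda>_. i" and C = "w i" and m = 0]) auto

section \<open>Single smooth functions\<close>

lemma modb_unit_continuous:
  assumes "compact K" "continuous_on K f"
  shows "modb (\<lambda>_::unit. 1) K (\<lambda>_. f)"
proof -
  have "bounded (f ` K)" using assms compact_continuous_image compact_imp_bounded by blast
  then obtain B where "B > 0" "\<forall>x\<in>K. \<bar>f x\<bar> \<le> B" unfolding bounded_pos by auto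
  then show ?thesis unfolding modb_def by (intro exI[of _ B]) auto
qed

lemma lmod_unit: "continuous_on S f \<Longrightarrow> lmod (\<lambda>_::unit. 1) S (\<lambda>_. f)"
  unfolding lmod_def by (auto intro: modb_unit_continuous continuous_on_subset)

lemma smooth1_linear:
  assumes "bounded_linear f"
  shows "smooth1 S f"
  unfolding Cinf_def
proof
  fix n
  have c: "lmod (\<lambda>_::unit. 1) S (\<lambda>_. f)"
    using assms by (intro lmod_unit linear_continuous_on)
  have "pder S b (\<lambda>_::unit. f) (\<lambda>_ _. f b)" for b
  proof -
    interpret bounded_linear f by fact
    show ?thesis unfolding pder_def by (auto simp: add scaleR intro!: derivative_eq_intros)
  qed
  moreover have "Cm (\<lambda>_::unit. 1) S m (\<lambda>_ _. f b)" for b m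
    by (rule Cm_const[of _ "\<bar>f b\<bar>" _ 0]) auto
  ultimately have "\<exists>v. pder S b (\<lambda>_::unit. f) v \<and> Cm (\<lambda>_. 1) S m v" for b m
    by blast
  with c show "Cm (\<lambda>_::unit. 1) S n (\<lambda>_. f)"
    by (cases n) simp_all
qed

lemma smooth_on_if_smooth1:
  assumes "open S" "smooth1 S f"
  shows "smooth_on S f"
proof -
  \<comment> \<open>The chosen derivative is again \<open>smooth1\<close>, so the choice can be
    iterated along a list.\<close>
  define nxt where "nxt b u = (SOME v. pder S b (\<lambda>_::unit. u) (\<lambda>_. v) \<and> smooth1 S v)" for b and u :: "'a \<Rightarrow> real"
  have nxt: "pder S b (\<lambda>_::unit. u) (\<lambda>_. nxt b u) \<and> smooth1 S (nxt b u)"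
    if u: "smooth1 S u" and b: "b \<in> Basis" for u b
  proof -
    obtain v where v: "pder S b (\<lambda>_::unit. u) v" "Cinf (\<lambda>_::unit. 1) S v"
      using Cinf_deriv[OF assms(1) u b] by blast
    have "v = (\<lambda>_. v ())" by (intro ext) simp
    then have "pder S b (\<lambda>_::unit. u) (\<lambda>_. v ()) \<and> smooth1 S (v ())" using v by simp
    then show ?thesis
      unfolding nxt_def
      by (rule someI[of "\<lambda>v. pder S b (\<lambda>_::unit. u) (\<lambda>_. v) \<and> smooth1 S v"])
  qed
  \<comment> \<open>Directions outside \<open>Basis\<close> are skipped: \<open>smooth_on\<close>
    asks for continuity of \<open>D al\<close> for all lists, not only for lists of basis
    vectors.\<close>
  define D where "D al = foldr (\<lambda>b u. if b \<in> Basis then nxt b u else u) al f" for al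
  have D: "smooth1 S (D al)" for al
    by (induction al) (auto simp: D_def assms(2) nxt)
  show ?thesis
    unfolding smooth_on_def
  proof (intro exI[of _ D] conjI ballI allI)
    show "D [] x = f x" for x by (simp add: D_def)
    show "continuous_on S (D al)" for al using Cinf_cont[OF D] .
    fix al and b :: 'a and x assume b: "b \<in> Basis" and x: "x \<in> S"
    have "D (b # al) = nxt b (D al)" using b by (simp add: D_def)
    then show "((\<lambda>t. D al (x + t *\<^sub>R b)) has_real_derivative D (b # al) x) (at 0)"
      using nxt[OF D b] x unfolding pder_def by auto
  qed
qed

section \<open>Composition with smooth maps\<close>

lemma has_derivative_of_partials:
  fixes f f1 f2 :: "real \<times> real \<Rightarrow> real"
  assumes "open T" "z \<in> T"
    and 1: "\<And>z. z \<in> T \<Longrightarrow> ((\<lambda>t. f (z + t *\<^sub>R (1, 0))) has_real_derivative f1 z) (at 0)"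
    and 2: "\<And>z. z \<in> T \<Longrightarrow> ((\<lambda>t. f (z + t *\<^sub>R (0, 1))) has_real_derivative f2 z) (at 0)"
    and c: "continuous_on T f2"
  shows "(f has_derivative (\<lambda>h. f1 z * fst h + f2 z * snd h)) (at z)"
proof -
  obtain x0 y0 where z: "z = (x0, y0)" by (cases z)
  obtain e where e: "e > 0" "ball z e \<subseteq> T" using assms(1,2) open_contains_ball by blast
  define X where "X = ball x0 (e/2)"
  define Y where "Y = ball y0 (e/2)"
  have XY: "(x, y) \<in> T" if "x \<in> X" "y \<in> Y" for x y
  proof -
    have "dist (x0, y0) (x, y) \<le> dist x0 x + dist y0 y"
      unfolding dist_Pair_Pair by (intro sqrt_sum_squares_le_sum) auto
    also have "\<dots> < e" using that unfolding X_def Y_def by auto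
    finally show ?thesis using e(2) z by auto
  qed
  have o: "x0 \<in> X" "y0 \<in> Y" "open X" "open Y" "convex Y" using e(1) by (auto simp: X_def Y_def)
  have fx: "((\<lambda>x. f (x, y0)) has_derivative (*) (f1 (x0, y0))) (at x0 within X)"
  proof -
    have "((\<lambda>t. f ((x0, y0) + t *\<^sub>R (1, 0))) has_real_derivative f1 (x0, y0)) (at 0)"
      using 1 assms(2) z by blast
    then have "((\<lambda>t. f (t + x0, y0)) has_real_derivative f1 (x0, y0)) (at 0)"
      by (simp add: add.commute)
    then have "((\<lambda>t. f (t, y0)) has_real_derivative f1 (x0, y0)) (at x0)"
      using DERIV_shift[of "\<lambda>t. f (t, y0)" _ 0 x0] by simp
    then show ?thesis by (simp add: has_field_derivative_def has_derivative_at_withinI)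
  qed
  have fy: "((\<lambda>y. f (x, y)) has_derivative blinfun_apply (f2 (x, y) *\<^sub>R id_blinfun)) (at y within Y)"
    if "x \<in> X" "y \<in> Y" for x y
  proof -
    have "((\<lambda>t. f ((x, y) + t *\<^sub>R (0, 1))) has_real_derivative f2 (x, y)) (at 0)"
      using 2 XY[OF that] by blast
    then have "((\<lambda>t. f (x, t + y)) has_real_derivative f2 (x, y)) (at 0)"
      by (simp add: add.commute)
    then have "((\<lambda>t. f (x, t)) has_real_derivative f2 (x, y)) (at y)"
      using DERIV_shift[of "\<lambda>t. f (x, t)" _ 0 y] by simp
    moreover have "blinfun_apply (f2 (x, y) *\<^sub>R id_blinfun) = (*) (f2 (x, y))"
      by (auto simp: scaleR_blinfun.rep_eq)
    ultimately show ?thesis by (simp add: has_field_derivative_def has_derivative_at_withinI)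
  qed
  have "continuous_on (X \<times> Y) (\<lambda>z. f2 z *\<^sub>R (id_blinfun :: real \<Rightarrow>\<^sub>L real))"
    using XY by (intro continuous_intros continuous_on_subset[OF c]) auto
  then have cy: "continuous (at (x0, y0) within X \<times> Y) (\<lambda>(x, y). f2 (x, y) *\<^sub>R (id_blinfun :: real \<Rightarrow>\<^sub>L real))"
    using o by (auto simp: continuous_on_eq_continuous_within split_def)
  have "((\<lambda>(x, y). f (x, y)) has_derivative
      (\<lambda>(tx, ty). f1 (x0, y0) * tx + blinfun_apply (f2 (x0, y0) *\<^sub>R id_blinfun) ty)) (at (x0, y0) within X \<times> Y)"
    by (rule has_derivative_partialsI[OF fx fy cy o(2) o(5)])
  moreover have "at (x0, y0) within X \<times> Y = at (x0, y0)"
    using o by (intro at_within_open open_Times) auto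
  ultimately show ?thesis by (simp add: z split_def scaleR_blinfun.rep_eq)
qed

text \<open>The inner map does not depend on the index, so it sends a compact set to one compact
  set, on which the outer family is uniformly moderate.\<close>

lemma lmod_compose2:
  fixes u :: "'i \<Rightarrow> real \<times> real \<Rightarrow> real" and S :: "'a::euclidean_space set"
  assumes "lmod w T u" "continuous_on S y1" "continuous_on S y2" "\<And>x. x \<in> S \<Longrightarrow> (y1 x, y2 x) \<in> T"
  shows "lmod w S (\<lambda>i x. u i (y1 x, y2 x))"
  unfolding lmod_def
proof (intro conjI allI impI)
  show "1 \<le> w i" for i using lmod_w[OF assms(1)] .
  have c: "continuous_on S (\<lambda>x. (y1 x, y2 x))" using assms(2,3) by (intro continuous_intros)
  show "continuous_on S (\<lambda>x. u i (y1 x, y2 x))" for i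
    using continuous_on_compose2[OF lmod_cont[OF assms(1), of i] c] assms(4) by auto
  fix K assume K: "compact K" "K \<subseteq> S"
  have "compact ((\<lambda>x. (y1 x, y2 x)) ` K)"
    using K c by (intro compact_continuous_image continuous_on_subset[OF c])
  moreover have "(\<lambda>x. (y1 x, y2 x)) ` K \<subseteq> T" using K assms(4) by auto
  ultimately have "modb w ((\<lambda>x. (y1 x, y2 x)) ` K) u" using lmod_modb[OF assms(1)] by blast
  then show "modb w K (\<lambda>i x. u i (y1 x, y2 x))" unfolding modb_def by simp
qed

lemma Cm_compose2:
  fixes u :: "'i \<Rightarrow> real \<times> real \<Rightarrow> real" and S :: "'a::euclidean_space set"
  assumes T: "open T" and y: "smooth1 S y1" "smooth1 S y2" and sub: "\<And>x. x \<in> S \<Longrightarrow> (y1 x, y2 x) \<in> T"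
    and S: "open S"
  shows "Cinf w T u \<Longrightarrow> Cm w S n (\<lambda>i x. u i (y1 x, y2 x))"
proof (induction n arbitrary: u)
  case 0
  then show ?case using lmod_compose2[OF Cm_lmod[OF Cinf_Cm] Cinf_cont[OF y(1)] Cinf_cont[OF y(2)] sub]
    by simp
next
  case (Suc n)
  have 1: "lmod w S (\<lambda>i x. u i (y1 x, y2 x))"
    using lmod_compose2[OF Cm_lmod[OF Cinf_Cm[OF Suc.prems]] Cinf_cont[OF y(1)] Cinf_cont[OF y(2)] sub]
    by simp
  have 2: "\<exists>z. pder S b (\<lambda>i x. u i (y1 x, y2 x)) z \<and> Cm w S n z" if b: "b \<in> Basis" for b
  proof -
    obtain v1 where v1: "pder T (1, 0) u v1" "Cinf w T v1"
      using Cinf_deriv[OF T Suc.prems, of "(1,0)"] by (auto simp: Basis_prod_def)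
    obtain v2 where v2: "pder T (0, 1) u v2" "Cinf w T v2"
      using Cinf_deriv[OF T Suc.prems, of "(0,1)"] by (auto simp: Basis_prod_def)
    obtain z1 where z1: "pder S b (\<lambda>_::unit. y1) z1" "Cinf (\<lambda>_. 1) S z1"
      using Cinf_deriv[OF S y(1) b] by blast
    obtain z2 where z2: "pder S b (\<lambda>_::unit. y2) z2" "Cinf (\<lambda>_. 1) S z2"
      using Cinf_deriv[OF S y(2) b] by blast
    have w: "1 \<le> w i" for i using Cinf_w[OF Suc.prems] .
    define Z where "Z = (\<lambda>i x. v1 i (y1 x, y2 x) * z1 () x + v2 i (y1 x, y2 x) * z2 () x)"
    have "Cm w S n (\<lambda>_. z1 ())" "Cm w S n (\<lambda>_. z2 ())"
      using Cinf_family[OF Cinf_single[OF z1(2), of "()"], of w, OF w] 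
        Cinf_family[OF Cinf_single[OF z2(2), of "()"], of w, OF w] by (simp_all add: Cinf_Cm)
    then have "Cm w S n Z" unfolding Z_def by (intro Cm_add Cm_mult Suc.IH v1 v2)
    moreover have "pder S b (\<lambda>i x. u i (y1 x, y2 x)) Z"
      unfolding pder_def
    proof (intro allI ballI)
      fix i x assume x: "x \<in> S"
      \<comment> \<open>The chain rule along a line needs the total derivative of the outer
        function; it comes from the two partial derivatives and the continuity of the
        second.\<close>
      have d: "(u i has_derivative (\<lambda>h. v1 i (y1 x, y2 x) * fst h + v2 i (y1 x, y2 x) * snd h)) (at (y1 x, y2 x))"
        using v1 v2 sub[OF x] unfolding pder_def
        by (intro has_derivative_of_partials[OF T]) (auto intro: Cinf_cont)
      have d1: "((\<lambda>t. y1 (x + t *\<^sub>R b)) has_real_derivative z1 () x) (at 0)"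
        and d2: "((\<lambda>t. y2 (x + t *\<^sub>R b)) has_real_derivative z2 () x) (at 0)"
        using z1(1) z2(1) x unfolding pder_def by auto
      have "((\<lambda>t. (y1 (x + t *\<^sub>R b), y2 (x + t *\<^sub>R b))) has_derivative (\<lambda>t. (z1 () x * t, z2 () x * t))) (at 0)"
        using d1 d2 unfolding has_field_derivative_def by (rule has_derivative_Pair)
      moreover have "(u i has_derivative (\<lambda>h. v1 i (y1 x, y2 x) * fst h + v2 i (y1 x, y2 x) * snd h))
          (at (y1 (x + 0 *\<^sub>R b), y2 (x + 0 *\<^sub>R b)))"
        using d by simp
      ultimately have "((\<lambda>t. u i (y1 (x + t *\<^sub>R b), y2 (x + t *\<^sub>R b))) has_derivative
          (\<lambda>h. v1 i (y1 x, y2 x) * fst h + v2 i (y1 x, y2 x) * snd h) \<circ> (\<lambda>t. (z1 () x * t, z2 () x * t))) (at 0)"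
        using diff_chain_at[of "\<lambda>t. (y1 (x + t *\<^sub>R b), y2 (x + t *\<^sub>R b))"] unfolding o_def by blast
      moreover have "(\<lambda>h. v1 i (y1 x, y2 x) * fst h + v2 i (y1 x, y2 x) * snd h) \<circ> (\<lambda>t. (z1 () x * t, z2 () x * t))
          = (\<lambda>t. Z i x * t)"
        by (intro ext) (simp add: Z_def algebra_simps)
      ultimately have "((\<lambda>t. u i (y1 (x + t *\<^sub>R b), y2 (x + t *\<^sub>R b))) has_derivative (\<lambda>t. Z i x * t)) (at 0)"
        by (simp only:)
      then show "((\<lambda>t. u i (y1 (x + t *\<^sub>R b), y2 (x + t *\<^sub>R b))) has_real_derivative Z i x) (at 0)"
        unfolding has_field_derivative_def .
    qed
    ultimately show ?thesis by blast
  qed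
  show ?case unfolding Cm.simps by (intro conjI ballI 1 2)
qed

lemma Cinf_compose2:
  fixes u :: "'i \<Rightarrow> real \<times> real \<Rightarrow> real" and S :: "'a::euclidean_space set"
  assumes "Cinf w T u" "open T" "open S" "smooth1 S y1" "smooth1 S y2" "\<And>x. x \<in> S \<Longrightarrow> (y1 x, y2 x) \<in> T"
  shows "Cinf w S (\<lambda>i x. u i (y1 x, y2 x))"
  unfolding Cinf_def using Cm_compose2[OF assms(2,4,5,6,3,1)] by blast

text \<open>The derivatives of the outer function have to be bounded globally, since the values of the inner
  family on a compact set are not bounded uniformly in the index.\<close>

lemma Cinf_compose_bounded:
  fixes e :: "nat \<Rightarrow> real \<Rightarrow> real" and u :: "'i \<Rightarrow> 'a::euclidean_space \<Rightarrow> real"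
  assumes e: "\<And>j x. (e j has_real_derivative e (Suc j) x) (at x)" "\<And>j x. \<bar>e j x\<bar> \<le> C j"
    and u: "Cinf w S u" and S: "open S"
  shows "Cinf w S (\<lambda>i x. e j (u i x))"
proof -
  have l: "lmod w S (\<lambda>i x. e j (u i x))" for j
    unfolding lmod_def
  proof (intro conjI allI impI)
    show w: "1 \<le> w i" for i using Cinf_w[OF u] .
    have "continuous_on UNIV (e j)" using e(1) by (auto intro!: continuous_at_imp_continuous_on DERIV_isCont)
    then show "continuous_on S (\<lambda>x. e j (u i x))" for i
      using continuous_on_compose2[OF _ Cinf_cont[OF u]] by blast
    have "C j \<ge> 0" using e(2)[of j 0] by linarith
    then show "modb w K (\<lambda>i x. e j (u i x))" for K
      unfolding modb_def using e(2)[of j] by (intro exI[of _ "C j"] conjI exI[of _ 0]) auto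
  qed
  have "Cm w S n (\<lambda>i x. e j (u i x))" for n j
  proof (induction n arbitrary: j)
    case 0
    then show ?case using l by simp
  next
    case (Suc n)
    have 2: "\<exists>z. pder S b (\<lambda>i x. e j (u i x)) z \<and> Cm w S n z" if b: "b \<in> Basis" for b
    proof -
      obtain v where v: "pder S b u v" "Cinf w S v" using Cinf_deriv[OF S u b] by blast
      have "Cm w S n (\<lambda>i x. e (Suc j) (u i x) * v i x)"
        by (intro Cm_mult Suc.IH Cinf_Cm[OF v(2)])
      moreover have "pder S b (\<lambda>i x. e j (u i x)) (\<lambda>i x. e (Suc j) (u i x) * v i x)"
        unfolding pder_def
      proof (intro allI ballI)
        fix i x assume x: "x \<in> S"
        have d: "((\<lambda>t. u i (x + t *\<^sub>R b)) has_real_derivative v i x) (at 0)"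
          using v(1) x unfolding pder_def by auto
        show "((\<lambda>t. e j (u i (x + t *\<^sub>R b))) has_real_derivative e (Suc j) (u i x) * v i x) (at 0)"
          using DERIV_chain2[of "e j", OF _ d] e(1) by simp
      qed
      ultimately show ?thesis by blast
    qed
    show ?case unfolding Cm.simps by (intro conjI ballI l 2)
  qed
  then show ?thesis unfolding Cinf_def by blast
qed

lemma Cinf_cos: "Cinf w S u \<Longrightarrow> open S \<Longrightarrow> Cinf w S (\<lambda>i x. cos (u i x))"
proof -
  assume u: "Cinf w S u" "open S"
  \<comment> \<open>All derivatives of the cosine are phase shifts of it, hence bounded by
    1.\<close>
  define e :: "nat \<Rightarrow> real \<Rightarrow> real" where "e j x = cos (x + of_nat j * (pi/2))" for j x
  have "(e j has_real_derivative e (Suc j) x) (at x)" for j x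
  proof -
    have "e (Suc j) x = - sin (x + of_nat j * (pi/2))"
      using minus_sin_cos_eq[of "x + of_nat j * (pi/2)"] by (simp add: e_def algebra_simps add_divide_distrib)
    then show ?thesis unfolding e_def by (auto intro!: derivative_eq_intros)
  qed
  then have "Cinf w S (\<lambda>i x. e 0 (u i x))"
    by (rule Cinf_compose_bounded[of e "\<lambda>_. 1"]) (use u in \<open>auto simp: e_def\<close>)
  then show ?thesis by (simp add: e_def)
qed

section \<open>Reciprocals and inverse square roots\<close>

lemma modb_inverse:
  assumes "\<And>i x. x \<in> K \<Longrightarrow> 1 \<le> C * w i ^ m * D i x" "\<And>i. 1 \<le> w i"
  shows "modb w K (\<lambda>i x. inverse (D i x :: real))"
proof -
  have "\<bar>inverse (D i x)\<bar> \<le> \<bar>C\<bar> * w i ^ m" if "x \<in> K" for i x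
  proof -
    have a: "1 \<le> C * w i ^ m * D i x" by (rule assms(1)[OF that])
    then have nz: "D i x \<noteq> 0" by auto
    have "1 \<le> \<bar>C * w i ^ m * D i x\<bar>" using a by linarith
    also have "\<dots> = \<bar>C\<bar> * w i ^ m * \<bar>D i x\<bar>"
      using assms(2)[of i] by (simp add: abs_mult)
    finally show ?thesis using nz by (simp add: field_simps)
  qed
  then show ?thesis unfolding modb_def by (intro exI[of _ "\<bar>C\<bar>"]) auto
qed

lemma lmod_inverse:
  assumes "lmod w S D" "\<And>i x. x \<in> S \<Longrightarrow> 1 \<le> C * w i ^ m * D i x"
  shows "lmod w S (\<lambda>i x. inverse (D i x))"
  unfolding lmod_def
proof (intro conjI allI impI)
  show "1 \<le> w i" for i using lmod_w[OF assms(1)] .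
  have "D i x \<noteq> 0" if "x \<in> S" for i x
    using assms(2)[OF that, of i] by auto
  then show "continuous_on S (\<lambda>x. inverse (D i x))" for i
    by (intro continuous_on_inverse lmod_cont[OF assms(1)]) auto
  show "modb w K (\<lambda>i x. inverse (D i x))" if "K \<subseteq> S" for K
  proof (rule modb_inverse)
    show "1 \<le> C * w i ^ m * D i x" if "x \<in> K" for i x
      using assms(2) that \<open>K \<subseteq> S\<close> by blast
  qed (rule lmod_w[OF assms(1)])
qed

text \<open>The hypothesis bounds \<open>D\<close> below by an inverse power of the weight, which
  makes the reciprocal moderate. The derivative of the reciprocal is a product of the reciprocal
  itself and the derivative of \<open>D\<close>, so the induction on the order closes.\<close>

lemma Cinf_inverse:
  assumes D: "Cinf w S D" "\<And>i x. x \<in> S \<Longrightarrow> 1 \<le> C * w i ^ m * D i x" and S: "open S"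
  shows "Cinf w S (\<lambda>i x. inverse (D i x))"
proof -
  have l: "lmod w S (\<lambda>i x. inverse (D i x))"
    using lmod_inverse[OF Cm_lmod[OF Cinf_Cm[OF D(1)]] D(2)] .
  have "Cm w S n (\<lambda>i x. inverse (D i x))" for n
  proof (induction n)
    case (Suc n)
    have 2: "\<exists>z. pder S b (\<lambda>i x. inverse (D i x)) z \<and> Cm w S n z" if b: "b \<in> Basis" for b
    proof -
      obtain v where v: "pder S b D v" "Cinf w S v" using Cinf_deriv[OF S D(1) b] by blast
      have "Cm w S n (\<lambda>i x. - (inverse (D i x) * v i x * inverse (D i x)))"
        by (intro Cm_mult Cm_minus Suc.IH Cinf_Cm[OF v(2)])
      moreover have "pder S b (\<lambda>i x. inverse (D i x)) (\<lambda>i x. - (inverse (D i x) * v i x * inverse (D i x)))"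
        unfolding pder_def
      proof (intro allI ballI)
        fix i x assume x: "x \<in> S"
        have d: "((\<lambda>t. D i (x + t *\<^sub>R b)) has_real_derivative v i x) (at 0)"
          using v(1) x unfolding pder_def by auto
        have "D i (x + 0 *\<^sub>R b) \<noteq> 0" using D(2)[OF x, of i] by auto
        from DERIV_inverse'[OF d this]
        show "((\<lambda>t. inverse (D i (x + t *\<^sub>R b))) has_real_derivative
          - (inverse (D i x) * v i x * inverse (D i x))) (at 0)" by simp
      qed
      ultimately show ?thesis by blast
    qed
    show ?case unfolding Cm.simps by (intro conjI ballI l 2)
  qed (simp add: l)
  then show ?thesis unfolding Cinf_def by blast
qed

lemma smooth1_inverse_sqrt:
  assumes D: "smooth1 S D" "\<And>x. x \<in> S \<Longrightarrow> 0 < D x" and S: "open S"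
  shows "smooth1 S (\<lambda>x. inverse (sqrt (D x)))"
proof -
  have l: "lmod (\<lambda>_::unit. 1) S (\<lambda>_ x. inverse (sqrt (D x)))"
    using Cinf_cont[OF D(1)] D(2)
    by (intro lmod_unit continuous_intros) (auto simp: less_imp_neq[symmetric])
  have "Cm (\<lambda>_::unit. 1) S n (\<lambda>_ x. inverse (sqrt (D x)))" for n
  proof (induction n)
    case (Suc n)
    have 2: "\<exists>z. pder S b (\<lambda>_::unit. \<lambda>x. inverse (sqrt (D x))) z \<and> Cm (\<lambda>_. 1) S n z" if b: "b \<in> Basis" for b
    proof -
      obtain v where v: "pder S b (\<lambda>_::unit. D) v" "Cinf (\<lambda>_. 1) S v" using Cinf_deriv[OF S D(1) b] by blast
      define Z where "Z = (\<lambda>i x. (-1/2) * (inverse (sqrt (D x)) * (inverse (sqrt (D x)) * (inverse (sqrt (D x)) * v i x))))"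
      have "Cm (\<lambda>_. 1) S n Z"
        unfolding Z_def by (intro Cm_mult Cm_scale Suc.IH Cinf_Cm[OF v(2)])
      moreover have "pder S b (\<lambda>_::unit. \<lambda>x. inverse (sqrt (D x))) Z"
        unfolding pder_def
      proof (intro allI ballI)
        fix i x assume x: "x \<in> S"
        have d: "((\<lambda>t. D (x + t *\<^sub>R b)) has_real_derivative v i x) (at 0)"
          using v(1) x unfolding pder_def by auto
        have "D (x + 0 *\<^sub>R b) > 0" using D(2)[OF x] by auto
        then show "((\<lambda>t. inverse (sqrt (D (x + t *\<^sub>R b)))) has_real_derivative Z i x) (at 0)"
          unfolding Z_def by (auto intro!: derivative_eq_intros d simp: field_simps power2_eq_square)
      qed
      ultimately show ?thesis by blast
    qed
    show ?case unfolding Cm.simps by (intro conjI ballI l 2)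
  qed (simp add: l)
  then show ?thesis unfolding Cinf_def by blast
qed

section \<open>Finite sums of growing length, negligible families and series\<close>

lemma Cinf_cumulative_sum:
  fixes u :: "'k \<Rightarrow> 'a::euclidean_space \<Rightarrow> real" and w' :: "'i \<Rightarrow> real"
  assumes u: "Cinf w S u" and w: "\<And>i k. k \<in> A i \<Longrightarrow> w k \<le> w' i" "\<And>i. 1 \<le> w' i"
    and a: "\<And>i. (\<Sum>k\<in>A i. \<bar>a i k\<bar>) \<le> C * w' i ^ m"
  shows "Cinf w' S (\<lambda>i x. \<Sum>k\<in>A i. a i k * u k x)"
proof -
  have l: "lmod w' S (\<lambda>i x. \<Sum>k\<in>A i. a i k * u k x)" if u: "lmod w S u" for u
    unfolding lmod_def
  proof (intro conjI allI impI)
    show "1 \<le> w' i" for i by fact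
    show "continuous_on S (\<lambda>x. \<Sum>k\<in>A i. a i k * u k x)" for i
      by (intro continuous_intros lmod_cont[OF u])
    fix K assume K: "compact K" "K \<subseteq> S"
    obtain B l where B: "B \<ge> 0" "\<And>k x. x \<in> K \<Longrightarrow> \<bar>u k x\<bar> \<le> B * w k ^ l"
      using lmod_modb[OF u K] unfolding modb_def by blast
    have "\<bar>\<Sum>k\<in>A i. a i k * u k x\<bar> \<le> B * \<bar>C\<bar> * w' i ^ (l + m)" if x: "x \<in> K" for i x
    proof -
      have "\<bar>\<Sum>k\<in>A i. a i k * u k x\<bar> \<le> (\<Sum>k\<in>A i. \<bar>a i k\<bar> * (B * w' i ^ l))"
      proof (rule order_trans[OF sum_abs sum_mono])
        fix k assume k: "k \<in> A i"
        have "w k ^ l \<le> w' i ^ l"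
          using w(1)[OF k] lmod_w[OF u, of k] by (intro power_mono) auto
        then have "\<bar>u k x\<bar> \<le> B * w' i ^ l"
          using B(2)[OF x, of k] mult_left_mono[OF _ B(1)] by (meson order_trans)
        then show "\<bar>a i k * u k x\<bar> \<le> \<bar>a i k\<bar> * (B * w' i ^ l)"
          unfolding abs_mult by (intro mult_left_mono) auto
      qed
      also have "\<dots> = (\<Sum>k\<in>A i. \<bar>a i k\<bar>) * (B * w' i ^ l)" by (simp add: sum_distrib_right)
      also have "\<dots> \<le> (\<bar>C\<bar> * w' i ^ m) * (B * w' i ^ l)"
      proof (rule mult_right_mono)
        have "C * w' i ^ m \<le> \<bar>C\<bar> * w' i ^ m"
          using w(2)[of i] by (intro mult_right_mono) auto
        then show "(\<Sum>k\<in>A i. \<bar>a i k\<bar>) \<le> \<bar>C\<bar> * w' i ^ m" using a[of i] by linarith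
        show "0 \<le> B * w' i ^ l" using B(1) w(2)[of i] by simp
      qed
      finally show ?thesis by (simp add: power_add mult.commute mult.left_commute)
    qed
    then show "modb w' K (\<lambda>i x. \<Sum>k\<in>A i. a i k * u k x)"
      unfolding modb_def using B(1) by (intro exI[of _ "B * \<bar>C\<bar>"] conjI exI[of _ "l + m"]) auto
  qed
  have *: "Cm w S n u \<Longrightarrow> Cm w' S n (\<lambda>i x. \<Sum>k\<in>A i. a i k * u k x)" for n u
  proof (induction n arbitrary: u)
    case (Suc n)
    have 2: "\<exists>z. pder S b (\<lambda>i x. \<Sum>k\<in>A i. a i k * u k x) z \<and> Cm w' S n z" if b: "b \<in> Basis" for b
    proof -
      have "\<exists>v. pder S b u v \<and> Cm w S n v" using Suc.prems b by simp
      then obtain v where v: "pder S b u v" "Cm w S n v" by blast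
      have "pder S b (\<lambda>i x. \<Sum>k\<in>A i. a i k * u k x) (\<lambda>i x. \<Sum>k\<in>A i. a i k * v k x)"
        unfolding pder_def
      proof (intro allI ballI)
        fix i x assume "x \<in> S"
        then have "((\<lambda>t. u k (x + t *\<^sub>R b)) has_real_derivative v k x) (at 0)" for k
          using v(1) unfolding pder_def by blast
        then show "((\<lambda>t. \<Sum>k\<in>A i. a i k * u k (x + t *\<^sub>R b)) has_real_derivative
            (\<Sum>k\<in>A i. a i k * v k x)) (at 0)"
          by (intro DERIV_sum DERIV_cmult)
      qed
      with Suc.IH[OF v(2)] show ?thesis by blast
    qed
    show ?case unfolding Cm.simps by (intro conjI ballI l 2 Cm_lmod[OF Suc.prems])
  qed (simp add: l)
  show ?thesis using u unfolding Cinf_def by (intro allI *) blast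
qed

text \<open>Colombeau's negligible families, with the condition imposed on the values only;
  \<open>lneg_deriv\<close> transfers it to the derivatives.\<close>

definition lneg :: "('i \<Rightarrow> real) \<Rightarrow> 'a::euclidean_space set \<Rightarrow> ('i \<Rightarrow> 'a \<Rightarrow> real) \<Rightarrow> bool" where
  "lneg w S u \<longleftrightarrow> (\<forall>K. compact K \<longrightarrow> K \<subseteq> S \<longrightarrow> (\<forall>M. \<exists>C. \<forall>i. \<forall>x\<in>K. \<bar>u i x\<bar> * w i ^ M \<le> C))"

lemma lnegE:
  assumes "lneg w S u" "compact K" "K \<subseteq> S"
  obtains C where "C \<ge> 0" "\<And>i x. x \<in> K \<Longrightarrow> \<bar>u i x\<bar> * w i ^ M \<le> C"
proof -
  obtain C where C: "\<And>i x. x \<in> K \<Longrightarrow> \<bar>u i x\<bar> * w i ^ M \<le> C"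
    using assms(1)[unfolded lneg_def, rule_format, OF assms(2,3), of M] by blast
  have "\<bar>u i x\<bar> * w i ^ M \<le> \<bar>C\<bar>" if "x \<in> K" for i x
    using C[OF that, of i] by linarith
  then show thesis by (rule that[of "\<bar>C\<bar>", rotated]) auto
qed

text \<open>Landau's inequality: apply the mean value theorem to \<open>u\<close> over the distance \<open>h = \<delta> / w i ^ (M + l)\<close>
  and use the moderate bound \<open>B * w i ^ l\<close> on the second derivative. Hence a series of negligible
  terms is smooth as soon as its terms are moderate, without estimating their derivatives.\<close>

lemma lneg_deriv:
  assumes S: "open S" and u: "Cinf w S u" "lneg w S u" and b: "b \<in> Basis" and v: "pder S b u v"
  shows "lneg w S v"
  unfolding lneg_def
proof (intro allI impI)
  fix K M assume K: "compact K" "K \<subseteq> S"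
  obtain v' where v': "pder S b u v'" "Cinf w S v'" using Cinf_deriv[OF S u(1) b] by blast
  have vv: "v i x = v' i x" if "x \<in> S" for i x using pder_unique[OF v v'(1) that] .
  obtain z where z: "pder S b v' z" "Cinf w S z" using Cinf_deriv[OF S v'(2) b] by blast
  have w: "1 \<le> w i" for i using Cinf_w[OF u(1)] .
  obtain \<delta> where d: "\<delta> > 0" "(\<Union>x\<in>K. cball x \<delta>) \<subseteq> S"
    using compact_subset_open_imp_cball_epsilon_subset[OF K(1) S K(2)] by blast
  define K' where "K' = (\<lambda>(x, h). x + h *\<^sub>R b) ` (K \<times> {0..\<delta>})"
  have K': "compact K'" unfolding K'_def
    by (intro compact_continuous_image compact_Times K compact_Icc) (auto intro!: continuous_intros simp: split_def)
  have inK': "x + h *\<^sub>R b \<in> K'" if "x \<in> K" "0 \<le> h" "h \<le> \<delta>" for x h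
    unfolding K'_def by (rule image_eqI[of _ _ "(x, h)"]) (use that in auto)
  have K'S: "K' \<subseteq> S"
  proof
    fix y assume "y \<in> K'"
    then obtain x h where xh: "x \<in> K" "0 \<le> h" "h \<le> \<delta>" "y = x + h *\<^sub>R b" unfolding K'_def by auto
    then have "y \<in> cball x \<delta>" using b by (auto simp: dist_norm)
    then show "y \<in> S" using d(2) xh(1) by blast
  qed
  obtain B l where B: "B \<ge> 0" "\<And>i x. x \<in> K' \<Longrightarrow> \<bar>z i x\<bar> \<le> B * w i ^ l"
    using lmod_modb[OF Cm_lmod[OF Cinf_Cm[OF z(2)]] K' K'S] unfolding modb_def by blast
  \<comment> \<open>The exponent pays for the later division by \<open>h\<close>, which costs
    \<open>w i ^ (M + l)\<close>, and leaves the desired \<open>w i ^ M\<close>.\<close>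
  obtain C where C: "C \<ge> 0" "\<And>i x. x \<in> K' \<Longrightarrow> \<bar>u i x\<bar> * w i ^ (2 * M + l) \<le> C"
    using lnegE[OF u(2) K' K'S] by blast
  have "\<bar>v i x\<bar> * w i ^ M \<le> 2 * C / \<delta> + \<delta> * B" if x: "x \<in> K" for i x
  proof -
    define h where "h = \<delta> / w i ^ (M + l)"
    have wp: "1 \<le> w i ^ n" for n using w by simp
    then have wp0: "0 < w i ^ n" for n by (meson less_le_trans zero_less_one)
    have h: "0 < h" unfolding h_def using d(1) wp0 by (rule divide_pos_pos)
    have h\<delta>: "h \<le> \<delta>"
      unfolding h_def pos_divide_le_eq[OF wp0] using mult_left_mono[OF wp[of "M + l"], of \<delta>] d(1) by simp
    have inK: "x + s *\<^sub>R b \<in> K'" if "0 \<le> s" "s \<le> h" for s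
      using inK'[OF x that(1)] that(2) h\<delta> by simp
    have inS: "x + s *\<^sub>R b \<in> S" if "0 \<le> s" "s \<le> h" for s
      using inK[OF that] K'S by (rule rev_subsetD)
    have "\<exists>\<xi>. 0 < \<xi> \<and> \<xi> < h \<and> u i (x + h *\<^sub>R b) - u i (x + 0 *\<^sub>R b) = (h - 0) * v' i (x + \<xi> *\<^sub>R b)"
      by (rule MVT2[OF h, of "\<lambda>s. u i (x + s *\<^sub>R b)" "\<lambda>s. v' i (x + s *\<^sub>R b)"])
        (rule pder_at[OF v'(1)], rule inS, auto)
    then obtain \<xi> where xi: "0 < \<xi>" "\<xi> < h" "u i (x + h *\<^sub>R b) - u i x = h * v' i (x + \<xi> *\<^sub>R b)"
      by auto
    have "\<exists>\<zeta>. 0 < \<zeta> \<and> \<zeta> < \<xi> \<and> v' i (x + \<xi> *\<^sub>R b) - v' i (x + 0 *\<^sub>R b) = (\<xi> - 0) * z i (x + \<zeta> *\<^sub>R b)"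
      by (rule MVT2[OF xi(1), of "\<lambda>s. v' i (x + s *\<^sub>R b)" "\<lambda>s. z i (x + s *\<^sub>R b)"])
        (rule pder_at[OF z(1)], rule inS, use xi in auto)
    then obtain \<zeta> where zeta: "0 < \<zeta>" "\<zeta> < \<xi>" "v' i (x + \<xi> *\<^sub>R b) - v' i x = \<xi> * z i (x + \<zeta> *\<^sub>R b)"
      by auto
    have 1: "h * \<bar>v' i (x + \<xi> *\<^sub>R b)\<bar> * w i ^ (2 * M + l) \<le> 2 * C"
    proof -
      have "h * \<bar>v' i (x + \<xi> *\<^sub>R b)\<bar> = \<bar>u i (x + h *\<^sub>R b) - u i x\<bar>"
        using h by (simp add: xi(3) abs_mult)
      also have "\<dots> \<le> \<bar>u i (x + h *\<^sub>R b)\<bar> + \<bar>u i x\<bar>" by simp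
      finally have "h * \<bar>v' i (x + \<xi> *\<^sub>R b)\<bar> * w i ^ (2 * M + l) \<le>
          (\<bar>u i (x + h *\<^sub>R b)\<bar> + \<bar>u i x\<bar>) * w i ^ (2 * M + l)"
        using wp0[of "2 * M + l"] by (intro mult_right_mono) auto
      also have "\<dots> \<le> C + C" unfolding distrib_right
        using C(2)[OF inK[of h], of i] C(2)[OF inK[of 0], of i] h by simp
      finally show ?thesis by simp
    qed
    have "h * w i ^ (2 * M + l) = \<delta> * w i ^ M"
    proof -
      have "w i ^ (2 * M + l) = w i ^ (M + l) * w i ^ M" by (simp add: power_add mult_2)
      then show ?thesis using w[of i] by (simp add: h_def)
    qed
    moreover have "h * \<bar>v' i (x + \<xi> *\<^sub>R b)\<bar> * w i ^ (2 * M + l) =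
        h * w i ^ (2 * M + l) * \<bar>v' i (x + \<xi> *\<^sub>R b)\<bar>"
      by (simp only: mult_ac)
    ultimately have "\<bar>v' i (x + \<xi> *\<^sub>R b)\<bar> * w i ^ M * \<delta> \<le> 2 * C"
      using 1 by (simp only: mult_ac)
    then have 2: "\<bar>v' i (x + \<xi> *\<^sub>R b)\<bar> * w i ^ M \<le> 2 * C / \<delta>"
      by (simp only: pos_le_divide_eq[OF d(1)])
    have 3: "\<bar>v' i (x + \<xi> *\<^sub>R b) - v' i x\<bar> * w i ^ M \<le> \<delta> * B"
    proof -
      have "\<bar>z i (x + \<zeta> *\<^sub>R b)\<bar> \<le> B * w i ^ l"
        using B(2)[OF inK[of \<zeta>], of i] zeta(1,2) xi(1,2) by simp
      then have "\<bar>v' i (x + \<xi> *\<^sub>R b) - v' i x\<bar> \<le> h * (B * w i ^ l)"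
        unfolding zeta(3) abs_mult using xi(1,2) by (intro mult_mono) auto
      then have "\<bar>v' i (x + \<xi> *\<^sub>R b) - v' i x\<bar> * w i ^ M \<le> h * (B * w i ^ l) * w i ^ M"
        using wp0[of M] by (intro mult_right_mono) auto
      also have "\<dots> = \<delta> * B" using w[of i] by (simp add: h_def power_add)
      finally show ?thesis .
    qed
    have "\<bar>v' i x\<bar> * w i ^ M \<le> (\<bar>v' i (x + \<xi> *\<^sub>R b)\<bar> + \<bar>v' i (x + \<xi> *\<^sub>R b) - v' i x\<bar>) * w i ^ M"
      using wp0[of M] by (intro mult_right_mono) auto
    also have "\<dots> \<le> 2 * C / \<delta> + \<delta> * B" using 2 3 by (simp add: distrib_right)
    finally show ?thesis unfolding vv[OF subsetD[OF K(2) x]] .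
  qed
  then show "\<exists>C. \<forall>i. \<forall>x\<in>K. \<bar>v i x\<bar> * w i ^ M \<le> C"
    by (intro exI[of _ "2 * C / \<delta> + \<delta> * B"] allI ballI)
qed

lemma lneg_uniform:
  fixes u :: "nat \<Rightarrow> 'a::euclidean_space \<Rightarrow> real"
  assumes "lneg w S u" "compact K" "K \<subseteq> S" "summable (\<lambda>i. inverse (w i))" "\<And>i. 1 \<le> w i"
  shows "uniform_limit K (\<lambda>n x. \<Sum>i<n. u i x) (\<lambda>x. \<Sum>i. u i x) sequentially"
    and "x \<in> K \<Longrightarrow> summable (\<lambda>i. u i x)"
proof -
  obtain C where C: "C \<ge> 0" "\<And>i x. x \<in> K \<Longrightarrow> \<bar>u i x\<bar> * w i ^ 1 \<le> C"
    using lnegE[OF assms(1-3)] by blast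
  have b: "norm (u i x) \<le> C * inverse (w i)" if "x \<in> K" for i x
  proof -
    have "0 < w i" using assms(5)[of i] by linarith
    then show ?thesis using C(2)[OF that, of i] by (simp add: field_simps)
  qed
  have s: "summable (\<lambda>i. C * inverse (w i))" using assms(4) by (rule summable_mult)
  show "uniform_limit K (\<lambda>n x. \<Sum>i<n. u i x) (\<lambda>x. \<Sum>i. u i x) sequentially"
    by (rule Weierstrass_m_test[OF b s])
  show "summable (\<lambda>i. u i x)" if "x \<in> K"
    by (rule summable_comparison_test'[OF s b[OF that]])
qed

text \<open>Since the derivatives of the terms are again moderate and negligible, the induction on
  the order repeats the same argument for the differentiated series.\<close>

lemma smooth1_suminf:
  fixes u :: "nat \<Rightarrow> 'a::euclidean_space \<Rightarrow> real"
  assumes S: "open S" and w: "summable (\<lambda>i. inverse (w i))" "\<And>i. 1 \<le> w i"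
    and u: "Cinf w S u" "lneg w S u"
  shows "smooth1 S (\<lambda>x. \<Sum>i. u i x)"
proof -
  have cont: "continuous_on S (\<lambda>x. \<Sum>i. u i x)" if u: "Cinf w S u" "lneg w S u" for u
    unfolding continuous_on_eq_continuous_at[OF S]
  proof
    fix x assume "x \<in> S"
    then obtain e where e: "e > 0" "cball x e \<subseteq> S" using S open_contains_cball by blast
    have "continuous_on (cball x e) (\<lambda>x. \<Sum>i. u i x)"
    proof (rule uniform_limit_theorem[OF _ lneg_uniform(1)[OF u(2) compact_cball e(2) w]])
      show "\<forall>\<^sub>F n in sequentially. continuous_on (cball x e) (\<lambda>x. \<Sum>i<n. u i x)"
        by (intro always_eventually allI continuous_on_sum continuous_on_subset[OF Cinf_cont[OF u(1)] e(2)])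
    qed simp
    then show "isCont (\<lambda>x. \<Sum>i. u i x) x"
      using e(1) by (intro continuous_on_interior[of "cball x e"]) auto
  qed
  have "Cinf w S u \<Longrightarrow> lneg w S u \<Longrightarrow> Cm (\<lambda>_::unit. 1) S n (\<lambda>_ x. \<Sum>i. u i x)" for n u
  proof (induction n arbitrary: u)
    case 0
    then show ?case using lmod_unit[OF cont] by simp
  next
    case (Suc n)
    have 2: "\<exists>z. pder S b (\<lambda>_::unit. \<lambda>x. \<Sum>i. u i x) z \<and> Cm (\<lambda>_. 1) S n z" if b: "b \<in> Basis" for b
    proof -
      obtain v where v: "pder S b u v" "Cinf w S v" using Cinf_deriv[OF S Suc.prems(1) b] by blast
      have vn: "lneg w S v" by (rule lneg_deriv[OF S Suc.prems b v(1)])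
      have "pder S b (\<lambda>_::unit. \<lambda>x. \<Sum>i. u i x) (\<lambda>_ x. \<Sum>i. v i x)"
        unfolding pder_def
      proof (intro allI ballI)
        fix x assume x: "x \<in> S"
        then obtain e where e: "e > 0" "cball x e \<subseteq> S" using S open_contains_cball by blast
        have sub: "x + t *\<^sub>R b \<in> cball x e" if "t \<in> ball 0 e" for t :: real
          using that b by (auto simp: dist_norm)
        have "uniform_limit (ball 0 e) (\<lambda>n t. \<Sum>i<n. v i (x + t *\<^sub>R b)) (\<lambda>t. \<Sum>i. v i (x + t *\<^sub>R b)) sequentially"
          by (rule uniform_limit_compose'[OF lneg_uniform(1)[OF vn compact_cball e(2) w]])
            (use sub in blast)
        then have uc: "uniformly_convergent_on (ball 0 e) (\<lambda>n t. \<Sum>i<n. v i (x + t *\<^sub>R b))"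
          unfolding uniformly_convergent_on_def by blast
        have "((\<lambda>t. \<Sum>i. u i (x + t *\<^sub>R b)) has_field_derivative (\<Sum>i. v i (x + 0 *\<^sub>R b))) (at 0)"
        proof (rule has_field_derivative_series'(2)[OF convex_ball _ uc, where ?x0.0 = 0])
          show "((\<lambda>t. u i (x + t *\<^sub>R b)) has_real_derivative v i (x + t *\<^sub>R b)) (at t within ball 0 e)"
            if "t \<in> ball 0 e" for i t
            using pder_at[OF v(1), of x t i] sub[OF that] e(2) by (blast intro: has_field_derivative_at_within)
          show "summable (\<lambda>i. u i (x + 0 *\<^sub>R b))"
            using lneg_uniform(2)[OF Suc.prems(2) compact_cball e(2) w, of x] e(1) by simp
        qed (use e in auto)
        then show "((\<lambda>t. \<Sum>i. u i (x + t *\<^sub>R b)) has_real_derivative (\<Sum>i. v i x)) (at 0)" by simp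
      qed
      with Suc.IH[OF v(2) vn] show ?thesis by blast
    qed
    show ?case unfolding Cm.simps by (intro conjI ballI 2 lmod_unit cont Suc.prems)
  qed
  then show ?thesis using u unfolding Cinf_def by blast
qed

section \<open>Integrals depending on a parameter\<close>

lemma Cinf_integral:
  fixes U :: "'i \<Rightarrow> 'a::euclidean_space \<times> real \<Rightarrow> real"
  assumes S: "open S" and U: "Cinf w (S \<times> UNIV) U"
  shows "Cinf w S (\<lambda>i x. integral {a..b} (\<lambda>t. U i (x, t)))"
proof -
  have SU: "open (S \<times> (UNIV :: real set))" using S by (simp add: open_Times)
  have co: "continuous_on {a..b} (\<lambda>t. U i (x, t))" if "lmod w (S \<times> UNIV) U" "x \<in> S" for U i x
    using that(2) by (intro continuous_on_compose2[OF lmod_cont[OF that(1), of i]] continuous_intros) auto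
  have l: "lmod w S (\<lambda>i x. integral {a..b} (\<lambda>t. U i (x, t)))" if U: "lmod w (S \<times> UNIV) U" for U
    unfolding lmod_def
  proof (intro conjI allI impI)
    show "1 \<le> w i" for i using lmod_w[OF U] .
    have "continuous_on (S \<times> cbox a b) (\<lambda>(x, t). U i (x, t))" for i
      using continuous_on_subset[OF lmod_cont[OF U, of i], of "S \<times> cbox a b"] by auto
    from integral_continuous_on_param[OF this]
    show "continuous_on S (\<lambda>x. integral {a..b} (\<lambda>t. U i (x, t)))" for i by simp
    fix K assume K: "compact K" "K \<subseteq> S"
    have "modb w (K \<times> {a..b}) U"
      using K by (intro lmod_modb[OF U] compact_Times) auto
    then obtain C m where C: "C \<ge> 0" "\<And>i x. x \<in> K \<times> {a..b} \<Longrightarrow> \<bar>U i x\<bar> \<le> C * w i ^ m"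
      unfolding modb_def by blast
    have "\<bar>integral {a..b} (\<lambda>t. U i (x, t))\<bar> \<le> (C * \<bar>b - a\<bar>) * w i ^ m" if x: "x \<in> K" for i x
    proof (cases "a \<le> b")
      case True
      have "norm (integral {a..b} (\<lambda>t. U i (x, t))) \<le> C * w i ^ m * (b - a)"
        by (rule integral_bound[OF True co[OF U]]) (use x K C in auto)
      then show ?thesis using True by (simp add: mult.commute mult.left_commute)
    next
      case False
      then show ?thesis using C(1) lmod_w[OF U, of i] by simp
    qed
    then show "modb w K (\<lambda>i x. integral {a..b} (\<lambda>t. U i (x, t)))"
      unfolding modb_def using C(1) by (intro exI[of _ "C * \<bar>b - a\<bar>"] conjI exI[of _ m]) auto
  qed
  have "Cinf w (S \<times> UNIV) U \<Longrightarrow> Cm w S n (\<lambda>i x. integral {a..b} (\<lambda>t. U i (x, t)))" for n U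
  proof (induction n arbitrary: U)
    case 0
    then show ?case using l[OF Cm_lmod[OF Cinf_Cm]] by simp
  next
    case (Suc n)
    have 2: "\<exists>z. pder S c (\<lambda>i x. integral {a..b} (\<lambda>t. U i (x, t))) z \<and> Cm w S n z" if c: "c \<in> Basis" for c
    proof -
      have "(c, 0) \<in> Basis" using c by (auto simp: Basis_prod_def)
      then obtain V where V: "pder (S \<times> UNIV) (c, 0) U V" "Cinf w (S \<times> UNIV) V"
        using Cinf_deriv[OF SU Suc.prems] by blast
      have lU: "lmod w (S \<times> UNIV) U" "lmod w (S \<times> UNIV) V"
        using Cm_lmod[OF Cinf_Cm] Suc.prems V(2) by blast+
      have "pder S c (\<lambda>i x. integral {a..b} (\<lambda>t. U i (x, t))) (\<lambda>i x. integral {a..b} (\<lambda>t. V i (x, t)))"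
        unfolding pder_def
      proof (intro allI ballI)
        fix i x assume x: "x \<in> S"
        then obtain e where e: "e > 0" "cball x e \<subseteq> S" using S open_contains_cball by blast
        have sub: "x + h *\<^sub>R c \<in> S" if "h \<in> ball 0 e" for h :: real
        proof -
          have "x + h *\<^sub>R c \<in> cball x e" using that c by (auto simp: dist_norm)
          then show ?thesis using e(2) by blast
        qed
        have "((\<lambda>h::real. integral (cbox a b) (\<lambda>t. U i (x + h *\<^sub>R c, t))) has_field_derivative
          integral (cbox a b) (\<lambda>t. V i (x + 0 *\<^sub>R c, t))) (at 0 within ball 0 e)"
        proof (rule leibniz_rule_field_derivative[where f = "\<lambda>h t. U i (x + h *\<^sub>R c, t)"])
          fix h t :: real assume h: "h \<in> ball 0 e"
          have "(x, t) + h *\<^sub>R (c, 0) \<in> S \<times> UNIV" using sub[OF h] by simp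
          from pder_at[OF V(1) this, of i]
          show "((\<lambda>h. U i (x + h *\<^sub>R c, t)) has_real_derivative V i (x + h *\<^sub>R c, t)) (at h within ball 0 e)"
            by (simp add: has_field_derivative_at_within)
        next
          fix h :: real assume h: "h \<in> ball 0 e"
          show "(\<lambda>t. U i (x + h *\<^sub>R c, t)) integrable_on cbox a b"
            using integrable_continuous_interval[OF co[OF lU(1) sub[OF h]]] by simp
        next
          show "continuous_on (ball 0 e \<times> cbox a b) (\<lambda>(h, t). V i (x + h *\<^sub>R c, t))"
            unfolding split_def
            by (intro continuous_on_compose2[OF lmod_cont[OF lU(2)]] continuous_intros) (use sub in auto)
        qed (use e in auto)
        moreover have "at 0 within ball 0 e = at (0::real)" using e by (intro at_within_open) auto
        ultimately show "((\<lambda>h. integral {a..b} (\<lambda>t. U i (x + h *\<^sub>R c, t))) has_real_derivative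
          integral {a..b} (\<lambda>t. V i (x, t))) (at 0)" by simp
      qed
      with Suc.IH[OF V(2)] show ?thesis by blast
    qed
    show ?case unfolding Cm.simps by (intro conjI ballI 2 l Cm_lmod[OF Cinf_Cm[OF Suc.prems]])
  qed
  then show ?thesis using U unfolding Cinf_def by blast
qed

section \<open>A smooth step function\<close>

text \<open>The derivatives of exp(-1/x) are linear combinations of these functions, so carrying the
  exponent \<open>m\<close> along closes the class under differentiation.\<close>

definition flat :: "nat \<Rightarrow> real \<Rightarrow> real" where
  "flat m x = (if 0 < x then inverse x ^ m * exp (- inverse x) else 0)"

lemma power_le_fact_exp: "0 \<le> (y::real) \<Longrightarrow> y ^ m \<le> fact m * exp y"
proof (cases "y = 0")
  case False
  assume "0 \<le> y"
  then have y: "0 < y" using False by simp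
  have "sum (\<lambda>n. y^n /\<^sub>R fact n) {m} \<le> (\<Sum>n. y^n /\<^sub>R fact n)"
    using y by (intro sum_le_suminf summable_exp_generic) auto
  also have "\<dots> = exp y" by (simp add: exp_def)
  finally have "sum (\<lambda>n. y^n /\<^sub>R fact n) {m} \<le> exp y" .
  then show ?thesis by (simp add: field_simps)
qed (cases m; simp)

text \<open>Two powers of \<open>x\<close> are enough to survive the division in the difference
  quotient at 0, where the derivative is therefore 0.\<close>

lemma flat_bound: "\<bar>flat m x\<bar> \<le> fact (m + 2) * x\<^sup>2"
proof (cases "0 < x")
  case True
  define y where "y = inverse x"
  have y: "0 < y" using True by (simp add: y_def)
  have "y ^ (m + 2) * exp (- y) \<le> fact (m + 2)"
    using power_le_fact_exp[of y "m + 2"] y by (simp add: exp_minus field_simps)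
  then have "x\<^sup>2 * (y ^ (m + 2) * exp (- y)) \<le> x\<^sup>2 * fact (m + 2)"
    by (rule mult_left_mono) simp
  moreover have "\<bar>flat m x\<bar> = x\<^sup>2 * (y ^ (m + 2) * exp (- y))"
    using True by (simp add: flat_def y_def power_add field_simps power2_eq_square)
  ultimately show ?thesis by (simp only: mult.commute)
qed (simp add: flat_def)

lemma flat_deriv: "(flat m has_real_derivative flat (m + 2) x - of_nat m * flat (m + 1) x) (at x)"
proof -
  consider "x < 0" | "x = 0" | "0 < x" by linarith
  then show ?thesis
  proof cases
    case 1
    have "((\<lambda>_. 0) has_real_derivative flat (m + 2) x - of_nat m * flat (m + 1) x) (at x)"
      using 1 by (simp add: flat_def)
    then show ?thesis
      by (rule has_field_derivative_transform_within_open[of _ _ _ "{..<0}"]) (use 1 in \<open>auto simp: flat_def\<close>)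
  next
    case 2
    have "((\<lambda>h. flat m h / h) \<longlongrightarrow> 0) (at 0)"
    proof (rule Lim_null_comparison)
      have "norm (flat m h / h) \<le> fact (m + 2) * \<bar>h\<bar>" if "h \<noteq> 0" for h
      proof -
        have "norm (flat m h / h) \<le> fact (m + 2) * h\<^sup>2 / \<bar>h\<bar>"
          using flat_bound[of m h] that by (simp add: divide_right_mono)
        also have "h\<^sup>2 = \<bar>h\<bar> * \<bar>h\<bar>" by (simp add: power2_eq_square)
        also have "fact (m + 2) * (\<bar>h\<bar> * \<bar>h\<bar>) / \<bar>h\<bar> = fact (m + 2) * \<bar>h\<bar>"
          unfolding mult.assoc[symmetric] by (rule nonzero_mult_div_cancel_right) (use that in simp)
        finally show ?thesis .
      qed
      then show "\<forall>\<^sub>F h in at 0. norm (flat m h / h) \<le> fact (m + 2) * \<bar>h\<bar>"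
        by (auto simp: eventually_at_filter)
      show "((\<lambda>h. fact (m + 2) * \<bar>h\<bar>) \<longlongrightarrow> 0) (at (0::real))"
        by (intro tendsto_eq_intros) auto
    qed
    then show ?thesis using 2 by (simp add: has_field_derivative_iff flat_def[of _ 0])
  next
    case 3
    define r where "r = inverse x"
    have i: "(inverse has_real_derivative - (r * r)) (at x)"
      using DERIV_inverse[of x] 3 by (simp add: r_def)
    have "((\<lambda>y. inverse y ^ m * exp (- inverse y)) has_real_derivative
        (of_nat m * (- (r * r) * r ^ (m - Suc 0))) * exp (- r) + (exp (- r) * (r * r)) * r ^ m) (at x)"
      using DERIV_mult[OF DERIV_power[OF i, of m] DERIV_chain2[OF DERIV_exp DERIV_minus[OF i]]]
      by (simp add: r_def)
    moreover have "(of_nat m * (- (r * r) * r ^ (m - Suc 0))) * exp (- r) + (exp (- r) * (r * r)) * r ^ m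
        = flat (m + 2) x - of_nat m * flat (m + 1) x"
      using 3 by (cases m) (simp_all add: flat_def r_def[symmetric] algebra_simps)
    ultimately have "((\<lambda>y. inverse y ^ m * exp (- inverse y)) has_real_derivative
        flat (m + 2) x - of_nat m * flat (m + 1) x) (at x)" by (simp only:)
    then show ?thesis
      by (rule has_field_derivative_transform_within_open[of _ _ _ "{0<..}"]) (use 3 in \<open>auto simp: flat_def\<close>)
  qed
qed

lemma smooth1_flat: "smooth1 UNIV (\<lambda>x::real. flat m (s * x + c))"
proof -
  have d: "((\<lambda>x. flat m (s * x + c)) has_real_derivative
      s * (flat (m + 2) (s * x + c) - of_nat m * flat (m + 1) (s * x + c))) (at x)" for m x
  proof -
    have "((\<lambda>x. s * x + c) has_real_derivative s) (at x)" by (auto intro!: derivative_eq_intros)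
    from DERIV_chain2[OF flat_deriv this] show ?thesis by (simp only: mult.commute)
  qed
  have l: "lmod (\<lambda>_::unit. 1) UNIV (\<lambda>_ x. flat m (s * x + c))" for m
    by (intro lmod_unit continuous_at_imp_continuous_on ballI DERIV_isCont[OF d])
  have "Cm (\<lambda>_::unit. 1) UNIV n (\<lambda>_ x. flat m (s * x + c))" for n m
  proof (induction n arbitrary: m)
    case (Suc n)
    have 2: "\<exists>v. pder UNIV b (\<lambda>_::unit. \<lambda>x. flat m (s * x + c)) v \<and> Cm (\<lambda>_. 1) UNIV n v"
      if "b \<in> Basis" for b :: real
    proof -
      define v where "v = (\<lambda>(_::unit) x. s * (flat (m + 2) (s * x + c) - of_nat m * flat (m + 1) (s * x + c)))"
      have "Cm (\<lambda>_. 1) UNIV n v"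
        unfolding v_def by (intro Cm_scale Cm_diff Suc.IH)
      moreover have "pder UNIV b (\<lambda>_::unit. \<lambda>x. flat m (s * x + c)) v"
        unfolding pder_def
      proof (intro allI ballI)
        fix i x
        show "((\<lambda>t. flat m (s * (x + t *\<^sub>R b) + c)) has_real_derivative v i x) (at 0)"
          using DERIV_shift[of "\<lambda>x. flat m (s * x + c)" "v i x" 0 x] d[of m x] that
          by (simp add: v_def add.commute)
      qed
      ultimately show ?thesis by blast
    qed
    show ?case unfolding Cm.simps by (intro conjI ballI l 2)
  qed (simp add: l)
  then show ?thesis unfolding Cinf_def by blast
qed

definition step :: "real \<Rightarrow> real" where
  "step x = flat 0 x * inverse (flat 0 x + flat 0 (1 - x))"

lemma flat0_nonneg: "0 \<le> flat 0 x"
  by (simp add: flat_def)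

lemma flat0_mono: "x \<le> y \<Longrightarrow> flat 0 x \<le> flat 0 y"
  by (auto simp: flat_def intro!: le_imp_inverse_le)

text \<open>One of \<open>x\<close> and \<open>1 - x\<close> is at least 1/2. The uniform constant,
  beyond mere positivity, is the form that \<open>Cinf_inverse\<close> asks for.\<close>

lemma flat_sum_lower: "exp (-2) \<le> flat 0 x + flat 0 (1 - x)"
proof -
  have h: "flat 0 (1/2) = exp (-2)" by (simp add: flat_def)
  show ?thesis
  proof (cases "x \<ge> 1/2")
    case True
    then show ?thesis using flat0_mono[of "1/2" x] flat0_nonneg[of "1 - x"] h by linarith
  next
    case False
    then show ?thesis using flat0_mono[of "1/2" "1 - x"] flat0_nonneg[of x] h by linarith
  qed
qed

lemma flat_sum_pos: "0 < flat 0 x + flat 0 (1 - x)"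
  using flat_sum_lower[of x] exp_gt_zero[of "-2::real"] by linarith

lemma step_bounds: "0 \<le> step x" "step x \<le> 1"
  using flat_sum_pos[of x] flat0_nonneg[of x] flat0_nonneg[of "1 - x"]
  by (auto simp: step_def field_simps)

lemma step_0: "x \<le> 0 \<Longrightarrow> step x = 0"
  by (simp add: step_def flat_def)

lemma step_1: "1 \<le> x \<Longrightarrow> step x = 1"
  by (simp add: step_def flat_def)

lemma smooth1_step: "smooth1 UNIV step"
proof -
  have s: "smooth1 UNIV (\<lambda>x. flat 0 x)" "smooth1 UNIV (\<lambda>x. flat 0 (1 - x))"
    using smooth1_flat[of 0 1 0] smooth1_flat[of 0 "-1" 1] by simp_all
  have l: "1 \<le> exp 2 * 1 ^ 0 * (flat 0 x + flat 0 (1 - x))" for x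
    using mult_left_mono[OF flat_sum_lower[of x], of "exp 2"] by (simp add: exp_minus)
  have "smooth1 UNIV (\<lambda>x. inverse (flat 0 x + flat 0 (1 - x)))"
    by (rule Cinf_inverse[OF Cinf_add[OF s], of "exp 2" 0]) (use l in auto)
  from Cinf_mult[OF s(1) this] show ?thesis by (simp add: step_def[abs_def])
qed

text \<open>The derivatives vanish outside [0, 1] and are continuous, hence bounded on the whole
  line. These global bounds are what \<open>Cinf_compose_bounded\<close> requires.\<close>

lemma step_derivatives:
  "\<exists>(e :: nat \<Rightarrow> real \<Rightarrow> real) C. e 0 = step \<and>
     (\<forall>j x. (e j has_real_derivative e (Suc j) x) (at x)) \<and> (\<forall>j x. \<bar>e j x\<bar> \<le> C j)"
proof -
  have "smooth_on UNIV step" by (rule smooth_on_if_smooth1[OF open_UNIV smooth1_step])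
  then obtain D :: "real list \<Rightarrow> real \<Rightarrow> real" where D0: "\<And>x. D [] x = step x"
    and Dc: "\<And>al. continuous_on UNIV (D al)"
    and Dd: "\<And>al x. ((\<lambda>t. D al (x + t *\<^sub>R 1)) has_real_derivative D (1 # al) x) (at 0)"
    unfolding smooth_on_def by auto
  define e where "e j = D (replicate j 1)" for j
  have e0: "e 0 = step" using D0 by (auto simp: e_def)
  have ed: "(e j has_real_derivative e (Suc j) x) (at x)" for j x
    using Dd[of "replicate j 1" x] DERIV_shift[of "D (replicate j 1)" _ 0 x]
    by (simp add: e_def add.commute)
  \<comment> \<open>Only the proper derivatives vanish on both sides; \<open>step\<close> itself is
    1 to the right. Open half-lines are used so that local constancy determines the
    derivative.\<close>
  have z: "e (Suc j) x = 0" if "x < 0 \<or> 1 < x" for j x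
    using that
  proof (induction j arbitrary: x)
    case 0
    define c where "c = step x"
    have "\<forall>\<^sub>F y in nhds x. c = e 0 y"
    proof (cases "x < 0")
      case True
      then show ?thesis using eventually_nhds_in_open[of "{..<0}" x]
        by (auto elim!: eventually_mono simp: e0 c_def step_0)
    next
      case False
      then show ?thesis using eventually_nhds_in_open[of "{1<..}" x] 0
        by (auto elim!: eventually_mono simp: e0 c_def step_1)
    qed
    from DERIV_cong_ev[OF refl this refl, of "0"] have "(e 0 has_real_derivative 0) (at x)" by simp
    then show ?case using DERIV_unique ed[of 0 x] by blast
  next
    case (Suc j)
    have "\<forall>\<^sub>F y in nhds x. 0 = e (Suc j) y"
    proof (cases "x < 0")
      case True
      then show ?thesis using eventually_nhds_in_open[of "{..<0}" x]
        by (auto elim!: eventually_mono simp: Suc.IH)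
    next
      case False
      then show ?thesis using eventually_nhds_in_open[of "{1<..}" x] Suc.prems
        by (auto elim!: eventually_mono simp: Suc.IH)
    qed
    from DERIV_cong_ev[OF refl this refl, of "0"] have "(e (Suc j) has_real_derivative 0) (at x)" by simp
    then show ?case using DERIV_unique ed[of "Suc j" x] by blast
  qed
  have "\<exists>C. \<forall>x. \<bar>e j x\<bar> \<le> C" for j
  proof (cases j)
    case 0
    have "\<bar>step x\<bar> \<le> 1" for x using step_bounds[of x] by simp
    then show ?thesis unfolding 0 e0 by blast
  next
    case (Suc i)
    have "compact (e j ` {0..1})"
      using Dc unfolding e_def by (intro compact_continuous_image) (auto intro: continuous_on_subset)
    then have "bounded (e j ` {0..1})" by (rule compact_imp_bounded)
    then obtain B where B: "B > 0" "\<forall>y\<in>e j ` {0..1}. \<bar>y\<bar> \<le> B"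
      unfolding bounded_pos real_norm_def by blast
    have "\<bar>e j x\<bar> \<le> B" for x
    proof (cases "x < 0 \<or> 1 < x")
      case True
      then show ?thesis using z[OF True, of i] Suc B(1) by simp
    next
      case False
      then show ?thesis using B(2) by auto
    qed
    then show ?thesis by blast
  qed
  then have "\<forall>j. \<exists>C. \<forall>x. \<bar>e j x\<bar> \<le> C" by blast
  from choice[OF this] obtain C where "\<forall>j x. \<bar>e j x\<bar> \<le> C j" by blast
  with e0 ed show ?thesis by (intro exI[of _ e] exI[of _ C] conjI allI) auto
qed

lemma Cinf_step: "Cinf w S u \<Longrightarrow> open S \<Longrightarrow> Cinf w S (\<lambda>i x. step (u i x))"
proof -
  assume u: "Cinf w S u" "open S"
  from step_derivatives obtain e :: "nat \<Rightarrow> real \<Rightarrow> real" and C where e0: "e 0 = step"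
    and e1: "\<forall>j x. (e j has_real_derivative e (Suc j) x) (at x)" and e2: "\<forall>j x. \<bar>e j x\<bar> \<le> C j"
    by (elim exE conjE)
  have "Cinf w S (\<lambda>i x. e 0 (u i x))"
    by (rule Cinf_compose_bounded[where C = C, OF _ _ u]) (use e1 e2 in auto)
  then show ?thesis by (simp add: e0)
qed

section \<open>Restriction to smaller sets, and powers of a unit vector\<close>

lemma lmod_subset:
  assumes "lmod w S u" "T \<subseteq> S"
  shows "lmod w T u"
  unfolding lmod_def
proof (intro conjI allI impI)
  show "1 \<le> w i" for i by (rule lmod_w[OF assms(1)])
  show "continuous_on T (u i)" for i by (rule continuous_on_subset[OF lmod_cont[OF assms(1)] assms(2)])
  show "modb w K u" if "compact K" "K \<subseteq> T" for K
    by (rule lmod_modb[OF assms(1) that(1) order_trans[OF that(2) assms(2)]])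
qed

lemma Cm_subset: "T \<subseteq> S \<Longrightarrow> Cm w S n u \<Longrightarrow> Cm w T n u"
proof (induction n arbitrary: u)
  case 0
  then show ?case by (simp add: lmod_subset)
next
  case (Suc n)
  have l: "lmod w T u" by (rule lmod_subset[OF Cm_lmod[OF Suc.prems(2)] Suc.prems(1)])
  have 2: "\<exists>v. pder T b u v \<and> Cm w T n v" if "b \<in> Basis" for b
  proof -
    have "\<exists>v. pder S b u v \<and> Cm w S n v" using Suc.prems(2) that by simp
    then obtain v where v: "pder S b u v" "Cm w S n v" by blast
    have "pder T b u v" unfolding pder_def
    proof (intro allI ballI)
      fix i x assume "x \<in> T"
      then have "x \<in> S" by (rule subsetD[OF Suc.prems(1)])
      then show "((\<lambda>t. u i (x + t *\<^sub>R b)) has_real_derivative v i x) (at 0)"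
        using v(1) unfolding pder_def by simp
    qed
    with Suc.IH[OF Suc.prems(1) v(2)] show ?thesis by blast
  qed
  show ?case unfolding Cm.simps by (intro conjI ballI l 2)
qed

lemma Cinf_subset: "Cinf w S u \<Longrightarrow> T \<subseteq> S \<Longrightarrow> Cinf w T u"
  unfolding Cinf_def by (blast intro: Cm_subset[of T S])

lemma continuous_on_Complex:
  "continuous_on S f \<Longrightarrow> continuous_on S g \<Longrightarrow> continuous_on S (\<lambda>x. Complex (f x) (g x))"
  unfolding Complex_eq by (intro continuous_intros)

text \<open>Real and imaginary part are treated together, since the derivative of each involves
  both. Every differentiation lowers the exponent and releases a factor of at most
  \<open>N i\<close>, while the powers stay bounded by 1; hence the shift \<open>j\<close> in the
  induction.\<close>

lemma Cinf_Re_Im_power: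
  fixes N :: "'i \<Rightarrow> nat"
  assumes S: "open S" and e: "smooth1 S e1" "smooth1 S e2"
    and le: "\<And>x. x \<in> S \<Longrightarrow> cmod (Complex (e1 x) (e2 x)) \<le> 1"
    and w: "\<And>i. 1 \<le> w i" and N: "\<And>i. real (N i) \<le> w i ^ m"
  shows "Cinf w S (\<lambda>i x. Re (Complex (e1 x) (e2 x) ^ N i))"
proof -
  define Z where "Z x = Complex (e1 x) (e2 x)" for x
  define R where "R = (\<lambda>j i x. Re (Z x ^ (N i - j)))"
  define I where "I = (\<lambda>j i x. Im (Z x ^ (N i - j)))"
  have cZ: "continuous_on S Z" unfolding Z_def
    by (intro continuous_on_Complex Cinf_cont[OF e(1)] Cinf_cont[OF e(2)])
  have b: "cmod (Z x ^ M) \<le> 1" if "x \<in> S" for x M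
    using le[OF that] by (simp add: norm_power Z_def power_le_one)
  have l: "lmod w S (R j)" "lmod w S (I j)" for j
  proof -
    have "modb w K (R j)" "modb w K (I j)" if "K \<subseteq> S" for K
    proof -
      have "\<bar>R j i x\<bar> \<le> 1 * w i ^ 0" "\<bar>I j i x\<bar> \<le> 1 * w i ^ 0" if "x \<in> K" for i x
        using b[of x "N i - j"] that \<open>K \<subseteq> S\<close> abs_Re_le_cmod[of "Z x ^ (N i - j)"]
          abs_Im_le_cmod[of "Z x ^ (N i - j)"] unfolding R_def I_def by auto
      then show "modb w K (R j)" "modb w K (I j)"
        unfolding modb_def by (intro exI[of _ 1] conjI exI[of _ 0] allI ballI; simp)+
    qed
    moreover have "continuous_on S (R j i)" "continuous_on S (I j i)" for i
      unfolding R_def I_def by (intro continuous_intros cZ)+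
    ultimately show "lmod w S (R j)" "lmod w S (I j)"
      unfolding lmod_def using w by simp_all
  qed
  have "Cm w S n (R j) \<and> Cm w S n (I j)" for n j
  proof (induction n arbitrary: j)
    case 0
    then show ?case using l by simp
  next
    case (Suc n)
    have 2: "\<exists>v. pder S b (R j) v \<and> Cm w S n v" "\<exists>v. pder S b (I j) v \<and> Cm w S n v" if b: "b \<in> Basis" for b
    proof -
      obtain f1 where f1: "pder S b (\<lambda>_::unit. e1) f1" "Cinf (\<lambda>_. 1) S f1"
        using Cinf_deriv[OF S e(1) b] by blast
      obtain f2 where f2: "pder S b (\<lambda>_::unit. e2) f2" "Cinf (\<lambda>_. 1) S f2"
        using Cinf_deriv[OF S e(2) b] by blast
      have f: "Cm w S n (\<lambda>_. f1 ())" "Cm w S n (\<lambda>_. f2 ())"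
        by (rule Cinf_Cm[OF Cinf_family[OF Cinf_single[OF f1(2)] w]],
            rule Cinf_Cm[OF Cinf_family[OF Cinf_single[OF f2(2)] w]])
      \<comment> \<open>Truncated subtraction is harmless: when the exponent is exhausted, this
        factor is 0.\<close>
      define M where "M i = real (N i - j)" for i
      have M: "\<bar>M i\<bar> \<le> 1 * w i ^ m" for i
      proof -
        have "real (N i - j) \<le> real (N i)" by simp
        then show ?thesis using N[of i] unfolding M_def by simp
      qed
      define VR where "VR = (\<lambda>i x. M i * (R (Suc j) i x * f1 () x - I (Suc j) i x * f2 () x))"
      define VI where "VI = (\<lambda>i x. M i * (R (Suc j) i x * f2 () x + I (Suc j) i x * f1 () x))"
      have c: "Cm w S n VR" "Cm w S n VI" unfolding VR_def VI_def
        by (rule Cm_cmult[OF _ M], intro Cm_diff Cm_add Cm_mult f conjunct1[OF Suc.IH] conjunct2[OF Suc.IH])+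
      have p: "((\<lambda>t. R j i (x + t *\<^sub>R b)) has_real_derivative VR i x) (at 0)"
        "((\<lambda>t. I j i (x + t *\<^sub>R b)) has_real_derivative VI i x) (at 0)" if x: "x \<in> S" for i x
      proof -
        have "((\<lambda>t. e1 (x + t *\<^sub>R b)) has_real_derivative f1 () x) (at 0)"
          "((\<lambda>t. e2 (x + t *\<^sub>R b)) has_real_derivative f2 () x) (at 0)"
          using f1(1) f2(1) x unfolding pder_def by auto
        then have dZ: "((\<lambda>t. Z (x + t *\<^sub>R b)) has_vector_derivative Complex (f1 () x) (f2 () x)) (at 0)"
          unfolding Z_def Complex_eq
          by (intro has_vector_derivative_add has_vector_derivative_mult_right has_vector_derivative_of_real)
        have "((\<lambda>z. z ^ (N i - j)) has_field_derivative of_nat (N i - j) * Z x ^ (N i - j - 1)) (at (Z (x + 0 *\<^sub>R b)))"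
          by (auto intro!: derivative_eq_intros)
        from field_vector_diff_chain_at[OF dZ this]
        have d: "((\<lambda>t. Z (x + t *\<^sub>R b) ^ (N i - j)) has_vector_derivative
           Complex (f1 () x) (f2 () x) * (of_nat (N i - j) * Z x ^ (N i - j - 1))) (at 0)"
          by (simp add: o_def)
        have e: "N i - j - 1 = N i - Suc j" by simp
        show "((\<lambda>t. R j i (x + t *\<^sub>R b)) has_real_derivative VR i x) (at 0)"
          using bounded_linear.has_vector_derivative[OF bounded_linear_Re d]
          unfolding has_real_derivative_iff_has_vector_derivative R_def VR_def I_def M_def e
          by (simp add: algebra_simps)
        show "((\<lambda>t. I j i (x + t *\<^sub>R b)) has_real_derivative VI i x) (at 0)"
          using bounded_linear.has_vector_derivative[OF bounded_linear_Im d]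
          unfolding has_real_derivative_iff_has_vector_derivative R_def VI_def I_def M_def e
          by (simp add: algebra_simps)
      qed
      have "pder S b (R j) VR" "pder S b (I j) VI" unfolding pder_def using p by auto
      then show "\<exists>v. pder S b (R j) v \<and> Cm w S n v" "\<exists>v. pder S b (I j) v \<and> Cm w S n v"
        using c by blast+
    qed
    show ?case unfolding Cm.simps by (intro conjI ballI l 2)
  qed
  then have "Cinf w S (R 0)" unfolding Cinf_def by blast
  then show ?thesis by (simp add: R_def Z_def)
qed

section \<open>Oscillating functions on thin annuli\<close>

definition rsq :: "real \<times> real \<Rightarrow> real" where "rsq z = (fst z)\<^sup>2 + (snd z)\<^sup>2"

definition bump :: "real \<Rightarrow> real" where "bump x = step (4 * (x - 1)) * step (4 * (2 - x))"

text \<open>In terms of \<open>y = \<bar>z\<bar>\<^sup>2\<close>, the cutoff \<open>Phi k\<close> lives where \<open>1 - y\<close> is between \<open>4 ^ (- k)\<close> and \<open>2 * 4 ^ (- k)\<close>;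
  these annuli are disjoint and accumulate at the unit circle.\<close>

definition Phi :: "nat \<Rightarrow> real \<Rightarrow> real" where "Phi k y = bump ((1 - y) * 4 ^ k)"

text \<open>\<open>smax\<close> makes the unit vector \<open>z / \<bar>z\<bar>\<close> smooth at the origin without changing it for \<open>\<bar>z\<bar> \<ge> 1/2\<close>.\<close>

definition smax :: "real \<Rightarrow> real" where "smax y = y + (1 - step (8 * y - 1))"

definition E1 :: "real \<times> real \<Rightarrow> real" where "E1 z = fst z * inverse (sqrt (smax (rsq z)))"
definition E2 :: "real \<times> real \<Rightarrow> real" where "E2 z = snd z * inverse (sqrt (smax (rsq z)))"

text \<open>The frequency \<open>2 ^ k\<^sup>2\<close> outgrows every power of the scale \<open>4 ^ k\<close> of the annuli.\<close>

definition freq :: "nat \<Rightarrow> nat" where "freq k = 2 ^ (k ^ 2)"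

text \<open>For \<bar>z\<bar> \<ge> 1/2 the second factor is the cosine of \<open>freq k\<close>
  times the polar angle; the complex power avoids a branch of the angle.\<close>

definition ang :: "nat \<Rightarrow> real \<times> real \<Rightarrow> real" where
  "ang k z = Phi k (rsq z) * Re (Complex (E1 z) (E2 z) ^ freq k)"

text \<open>The phase is a multiple of \<bar>z\<bar>^2, so along a line at distance \<open>s\<close>
  it is a multiple of s^2 + t^2, and its only stationary point is t = 0.\<close>

definition star :: "nat \<Rightarrow> real \<Rightarrow> real \<times> real \<Rightarrow> real" where
  "star k N z = Phi k (rsq z) * cos (N * rsq z)"

lemma bump_bounds: "0 \<le> bump x" "bump x \<le> 1"
  unfolding bump_def using step_bounds by (auto intro: mult_le_one)

lemma bump_0: "x \<le> 1 \<or> 2 \<le> x \<Longrightarrow> bump x = 0"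
  unfolding bump_def by (auto simp: step_0)

lemma bump_1: "5/4 \<le> x \<Longrightarrow> x \<le> 7/4 \<Longrightarrow> bump x = 1"
  unfolding bump_def by (auto simp: step_1)

lemma Phi_bounds: "0 \<le> Phi k y" "Phi k y \<le> 1"
  unfolding Phi_def using bump_bounds by auto

lemma Phi_0: "(1 - y) * 4 ^ k \<le> 1 \<or> 2 \<le> (1 - y) * 4 ^ k \<Longrightarrow> Phi k y = 0"
  unfolding Phi_def using bump_0 by blast

lemma rsq_nonneg: "0 \<le> rsq z" by (simp add: rsq_def)

lemma smooth1_rsq: "smooth1 UNIV rsq"
  unfolding rsq_def[abs_def]
  by (intro Cinf_add Cinf_power smooth1_linear bounded_linear_fst bounded_linear_snd)

lemma Cinf_Phi:
  assumes "smooth1 S y" "open S"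
  shows "Cinf (\<lambda>k. 4 ^ k) S (\<lambda>k x. Phi k (y x))"
proof -
  have w: "(1::real) \<le> 4 ^ k" for k by simp
  note y = Cinf_family[OF assms(1), of "\<lambda>k. 4 ^ k", OF w]
  have "Cinf (\<lambda>k. 4 ^ k) S (\<lambda>k x. 4 ^ k * (1 - y x))"
    by (rule Cinf_cmult[of _ _ _ _ 1 1]) (auto intro!: Cinf_diff y Cinf_const' w)
  then have a: "Cinf (\<lambda>k. 4 ^ k) S (\<lambda>k x. (1 - y x) * 4 ^ k)" by (simp only: mult.commute)
  show ?thesis unfolding Phi_def bump_def
    by (intro Cinf_mult Cinf_step Cinf_scale Cinf_diff a Cinf_const' w assms(2))
qed

lemma smax_ge: "0 \<le> y \<Longrightarrow> y \<le> smax y" "0 \<le> y \<Longrightarrow> 1/8 \<le> smax y"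
proof -
  show "0 \<le> y \<Longrightarrow> y \<le> smax y" using step_bounds[of "8 * y - 1"] by (simp add: smax_def)
  show "1/8 \<le> smax y" if "0 \<le> y"
  proof (cases "y \<ge> 1/8")
    case True then show ?thesis using step_bounds[of "8 * y - 1"] by (simp add: smax_def)
  next
    case False then show ?thesis using that by (simp add: smax_def step_0)
  qed
qed

lemma smax_eq: "1/4 \<le> y \<Longrightarrow> smax y = y"
  by (simp add: smax_def step_1)

lemma smooth1_E: "smooth1 UNIV E1" "smooth1 UNIV E2"
proof -
  have "smooth1 UNIV (\<lambda>z. smax (rsq z))" unfolding smax_def
    by (intro Cinf_add Cinf_diff Cinf_step Cinf_scale smooth1_rsq Cinf_const' open_UNIV) simp_all
  moreover have "0 < smax (rsq z)" for z using smax_ge(2)[OF rsq_nonneg, of z] by linarith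
  ultimately have s: "smooth1 UNIV (\<lambda>z. inverse (sqrt (smax (rsq z))))"
    by (intro smooth1_inverse_sqrt) auto
  show "smooth1 UNIV E1" "smooth1 UNIV E2" unfolding E1_def[abs_def] E2_def[abs_def]
    by (intro Cinf_mult s smooth1_linear bounded_linear_fst bounded_linear_snd)+
qed

lemma cmod_E: "cmod (Complex (E1 z) (E2 z)) \<le> 1"
proof -
  have p: "0 < smax (rsq z)" using smax_ge(2)[OF rsq_nonneg, of z] by linarith
  have "(E1 z)\<^sup>2 + (E2 z)\<^sup>2 = rsq z / smax (rsq z)"
    using p by (simp add: E1_def E2_def power_mult_distrib rsq_def power_inverse field_simps)
  also have "\<dots> \<le> 1" using smax_ge(1)[OF rsq_nonneg, of z] p by simp
  finally show ?thesis by (simp add: cmod_def)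
qed

text \<open>The frequency as a real number. As a weight it makes both the scale \<open>4 ^ k\<close>
  of the cutoffs and the factors released by differentiating the oscillation moderate.\<close>

definition wt :: "nat \<Rightarrow> real" where "wt k = 2 ^ (k ^ 2)"

lemma wt_ge1: "1 \<le> wt k" by (simp add: wt_def)

lemma Cinf_ang: "Cinf wt UNIV ang"
proof -
  have f: "real (freq k) \<le> wt k ^ 1" for k by (simp add: freq_def wt_def)
  have "(4::real) ^ k \<le> 1 * wt k ^ 2" for k
  proof -
    have "(4::real) ^ k = 2 ^ (2 * k)" by (simp add: power_mult)
    also have "\<dots> \<le> 2 ^ (k ^ 2 * 2)" by (intro power_increasing) (auto simp: power2_eq_square)
    finally show ?thesis by (simp add: wt_def power_mult)
  qed
  with Cinf_Phi[OF smooth1_rsq open_UNIV]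
  have "Cinf wt UNIV (\<lambda>k z. Phi k (rsq z))"
    using wt_ge1 by (rule Cinf_reindex[where r = "\<lambda>k. k"])
  moreover have "Cinf wt UNIV (\<lambda>k z. Re (Complex (E1 z) (E2 z) ^ freq k))"
    by (rule Cinf_Re_Im_power[OF open_UNIV smooth1_E _ wt_ge1 f]) (rule cmod_E)
  ultimately show ?thesis unfolding ang_def[abs_def] by (rule Cinf_mult)
qed

lemma smooth1_star: "smooth1 UNIV (star k N)"
proof -
  have "smooth1 UNIV (\<lambda>z. Phi k (rsq z))"
    using Cinf_single[OF Cinf_Phi[OF smooth1_rsq open_UNIV]] .
  then show ?thesis unfolding star_def[abs_def]
    by (intro Cinf_mult Cinf_cos Cinf_scale smooth1_rsq open_UNIV)
qed

lemma ang_bound: "\<bar>ang k z\<bar> \<le> 1"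
proof -
  have "cmod (Complex (E1 z) (E2 z) ^ freq k) \<le> 1" using cmod_E by (simp add: norm_power power_le_one)
  then have "\<bar>Re (Complex (E1 z) (E2 z) ^ freq k)\<bar> \<le> 1" using abs_Re_le_cmod order_trans by blast
  then show ?thesis unfolding ang_def abs_mult using Phi_bounds[of k "rsq z"] by (intro mult_le_one) auto
qed

lemma star_bound: "\<bar>star k N z\<bar> \<le> 1"
  unfolding star_def abs_mult using Phi_bounds[of k "rsq z"] by (intro mult_le_one) auto

section \<open>Angular oscillations integrated along lines\<close>

definition uc :: "real \<Rightarrow> real \<Rightarrow> complex" where
  "uc s t = Complex s t * of_real (inverse (sqrt (s\<^sup>2 + t\<^sup>2)))"

lemma norm_uc: "s \<noteq> 0 \<Longrightarrow> cmod (uc s t) = 1"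
proof -
  assume s: "s \<noteq> 0"
  have "0 < s\<^sup>2 + t\<^sup>2" using s by (simp add: sum_power2_gt_zero_iff)
  then have "0 < sqrt (s\<^sup>2 + t\<^sup>2)" by (simp only: real_sqrt_gt_0_iff)
  moreover have "q * \<bar>inverse q\<bar> = 1" if "0 < q" for q :: real using that by simp
  ultimately show ?thesis unfolding uc_def norm_mult norm_of_real complex_norm by blast
qed

text \<open>The real factor s/(s^2 + t^2) is the derivative of the polar angle along the
  line.\<close>

lemma uc_deriv:
  assumes s: "s \<noteq> 0"
  shows "(uc s has_vector_derivative uc s t * (\<i> * of_real (s / (s\<^sup>2 + t\<^sup>2)))) (at t)"
proof -
  have p: "0 < s\<^sup>2 + t\<^sup>2" using s by (simp add: sum_power2_gt_zero_iff)
  define r where "r = inverse (sqrt (s\<^sup>2 + t\<^sup>2))"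
  have "inverse (sqrt q) * inverse (sqrt q) * q = 1" if "0 < q" for q
    using that by (simp flip: inverse_mult_distrib)
  from this[OF p] have r2: "r * r * (s\<^sup>2 + t\<^sup>2) = 1" by (simp only: r_def)
  have 1: "((\<lambda>t. inverse (sqrt (s\<^sup>2 + t\<^sup>2))) has_real_derivative - (t * r * r * r)) (at t)"
    using p by (auto intro!: derivative_eq_intros simp: r_def field_simps)
  have 2: "((\<lambda>t. Complex s t) has_vector_derivative \<i>) (at t)"
    unfolding Complex_eq by (auto intro!: derivative_eq_intros)
  have "(uc s has_vector_derivative
      Complex s t * of_real (- (t * r * r * r)) + \<i> * of_real r) (at t)"
    using has_vector_derivative_mult[OF 2 has_vector_derivative_of_real[OF 1]]
    unfolding uc_def[abs_def] r_def by simp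
  moreover have "Complex s t * of_real (- (t * r * r * r)) + \<i> * of_real r
      = uc s t * (\<i> * of_real (s / (s\<^sup>2 + t\<^sup>2)))"
  proof -
    have q: "s / (s\<^sup>2 + t\<^sup>2) = s * (r * r)"
    proof (subst nonzero_divide_eq_eq)
      show "s\<^sup>2 + t\<^sup>2 \<noteq> 0" using p by linarith
      show "s = s * (r * r) * (s\<^sup>2 + t\<^sup>2)" using r2 by (simp only: mult.assoc mult_1_right)
    qed
    have "r - t * t * (r * r * r) = r * (r * r * (s\<^sup>2 + t\<^sup>2)) - t * t * (r * r * r)" using r2 by simp
    also have "\<dots> = s * s * (r * r * r)" by (simp add: algebra_simps power2_eq_square)
    finally have "r - t * t * (r * r * r) = s * s * (r * r * r)" .
    then show ?thesis unfolding uc_def r_def[symmetric] q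
      by (simp add: complex_eq_iff algebra_simps)
  qed
  ultimately show ?thesis by simp
qed

lemma continuous_on_uc: "s \<noteq> 0 \<Longrightarrow> continuous_on A (uc s)"
  by (rule continuous_at_imp_continuous_on)
    (auto intro: has_vector_derivative_continuous uc_deriv)

text \<open>Integration by parts against powers of the unit vector along a line: since the polar angle
  is strictly monotone along a line that stays away from the origin, the integral decays faster
  than any power of the frequency.\<close>

lemma oscillatory_decay:
  fixes u :: "'k \<Rightarrow> real \<times> real \<Rightarrow> real"
  defines "S \<equiv> {p :: real \<times> real. 1/4 < \<bar>fst p\<bar>}"
  assumes u: "Cinf w S u" and supp: "\<And>k s t. 1/4 < \<bar>s\<bar> \<Longrightarrow> 1 < \<bar>t\<bar> \<Longrightarrow> u k (s, t) = 0"
  shows "\<exists>C\<ge>0. \<exists>m. \<forall>k N s. 1 \<le> N \<longrightarrow> 1/2 \<le> \<bar>s\<bar> \<longrightarrow> \<bar>s\<bar> \<le> 1 \<longrightarrow>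
    cmod (integral {-2..2} (\<lambda>t. of_real (u k (s, t)) * uc s t ^ N)) * real N ^ M \<le> C * w k ^ m"
  using u supp
proof (induction M arbitrary: u)
  case 0
  define K :: "(real \<times> real) set" where "K = ({-1..-1/2} \<union> {1/2..1}) \<times> {-2..2::real}"
  have K: "compact K" "K \<subseteq> S" unfolding K_def S_def by (auto intro!: compact_Times compact_Un)
  obtain C m where C: "C \<ge> 0" "\<And>k p. p \<in> K \<Longrightarrow> \<bar>u k p\<bar> \<le> C * w k ^ m"
    using lmod_modb[OF Cm_lmod[OF Cinf_Cm[OF 0(1)]] K] unfolding modb_def by blast
  have "cmod (integral {-2..2} (\<lambda>t. of_real (u k (s, t)) * uc s t ^ N)) \<le> 4 * C * w k ^ m"
    if s: "1/2 \<le> \<bar>s\<bar>" "\<bar>s\<bar> \<le> 1" for k N s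
  proof -
    have s0: "s \<noteq> 0" using s by auto
    have sK: "(s, t) \<in> K" if "t \<in> {-2..2}" for t using that s unfolding K_def by auto
    have c: "continuous_on {-2..2} (\<lambda>t. of_real (u k (s, t)) * uc s t ^ N)"
      by (intro continuous_intros continuous_on_uc[OF s0] continuous_on_compose2[OF Cinf_cont[OF 0(1), of k]])
        (use sK K in auto)
    have "cmod (integral {-2..2} (\<lambda>t. of_real (u k (s, t)) * uc s t ^ N)) \<le> C * w k ^ m * (2 - (-2))"
      by (rule integral_bound[OF _ c]) (use C(2)[OF sK] in \<open>auto simp: norm_mult norm_power norm_uc[OF s0]\<close>)
    then show ?thesis by simp
  qed
  then show ?case using C(1) by (intro exI[of _ "4 * C"] conjI exI[of _ m]) auto
next
  case (Suc M)
  have S: "open S" unfolding S_def by (intro open_Collect_less continuous_intros)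
  have w: "1 \<le> w k" for k by (rule Cinf_w[OF Suc.prems(1)])
  have f: "Cinf w S (\<lambda>k p. fst p)" "Cinf w S (\<lambda>k p. snd p)"
    by (rule Cinf_family[OF smooth1_linear[OF bounded_linear_fst] w],
        rule Cinf_family[OF smooth1_linear[OF bounded_linear_snd] w])
  have i: "Cinf w S (\<lambda>k p. inverse ((fst p)\<^sup>2))"
  proof (rule Cinf_inverse[OF Cinf_power[OF f(1)] _ S, of 16 0])
    fix k p assume "p \<in> S"
    then have "(1/4)\<^sup>2 \<le> \<bar>fst p\<bar>\<^sup>2" unfolding S_def by (intro power_mono) auto
    then show "1 \<le> 16 * w k ^ 0 * (fst p)\<^sup>2" by (simp add: power2_eq_square)
  qed
  \<comment> \<open>\<open>A\<close> is \<open>u\<close> divided by the derivative s/(s^2 + t^2) of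
    the polar angle. The reciprocal of s is written as s * inverse (s^2), because
    \<open>Cinf_inverse\<close> needs a positive denominator.\<close>
  define A where "A = (\<lambda>k p. u k p * (((fst p)\<^sup>2 + (snd p)\<^sup>2) * (fst p * inverse ((fst p)\<^sup>2))))"
  have A: "Cinf w S A" unfolding A_def
    by (intro Cinf_mult Cinf_add Cinf_power f i Suc.prems(1))
  have "(0::real, 1::real) \<in> Basis" by (simp add: Basis_prod_def)
  then obtain v where v: "pder S (0, 1) A v" "Cinf w S v" using Cinf_deriv[OF S A] by blast
  have vd: "((\<lambda>t. A k (s, t)) has_real_derivative v k (s, t)) (at t)" if "1/4 < \<bar>s\<bar>" for k s t
    using pder_at[OF v(1), of "(s, 0)" t k] that by (simp add: S_def)
  have vsupp: "v k (s, t) = 0" if "1/4 < \<bar>s\<bar>" "1 < \<bar>t\<bar>" for k s t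
  proof -
    have "((\<lambda>t. 0) has_real_derivative v k (s, t)) (at t)"
      by (rule has_field_derivative_transform_within_open[OF vd[OF that(1)], of "{t. 1 < \<bar>t\<bar>}"])
        (use that Suc.prems(2) in \<open>auto simp: A_def intro!: open_Collect_less continuous_intros\<close>)
    then show ?thesis using DERIV_unique DERIV_const by blast
  qed
  obtain C m where C: "C \<ge> 0" "\<forall>k N s. 1 \<le> N \<longrightarrow> 1/2 \<le> \<bar>s\<bar> \<longrightarrow> \<bar>s\<bar> \<le> 1 \<longrightarrow>
    cmod (integral {-2..2} (\<lambda>t. of_real (v k (s, t)) * uc s t ^ N)) * real N ^ M \<le> C * w k ^ m"
    using Suc.IH[OF v(2) vsupp] by blast
  have "cmod (integral {-2..2} (\<lambda>t. of_real (u k (s, t)) * uc s t ^ N)) * real N ^ Suc M \<le> C * w k ^ m"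
    if N: "1 \<le> N" and s: "1/2 \<le> \<bar>s\<bar>" "\<bar>s\<bar> \<le> 1" for k N s
  proof -
    have s0: "s \<noteq> 0" and s4: "1/4 < \<bar>s\<bar>" using s by auto
    have co: "continuous_on {-2..2} (\<lambda>t. complex_of_real (z k (s, t)) * uc s t ^ N)" if "Cinf w S z" for z
      by (intro continuous_intros continuous_on_uc[OF s0] continuous_on_compose2[OF Cinf_cont[OF that, of k]])
        (use s4 in \<open>auto simp: S_def\<close>)
    define Iu where "Iu = integral {-2..2} (\<lambda>t. of_real (u k (s, t)) * uc s t ^ N)"
    define Iv where "Iv = integral {-2..2} (\<lambda>t. of_real (v k (s, t)) * uc s t ^ N)"
    have ft: "((\<lambda>t. of_real (v k (s, t)) * uc s t ^ N + \<i> * of_nat N * (of_real (u k (s, t)) * uc s t ^ N))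
        has_integral (of_real (A k (s, 2)) * uc s 2 ^ N - of_real (A k (s, -2)) * uc s (-2) ^ N)) {-2..2}"
    proof (rule fundamental_theorem_of_calculus)
      fix t :: real
      have p: "0 < s\<^sup>2 + t\<^sup>2" using s0 by (simp add: sum_power2_gt_zero_iff)
      have Au: "A k (s, t) * (s / (s\<^sup>2 + t\<^sup>2)) = u k (s, t)"
        using s0 p by (simp add: A_def power2_eq_square)
      have "((\<lambda>z. z ^ N) has_field_derivative of_nat N * uc s t ^ (N - 1)) (at (uc s t))"
        by (auto intro!: derivative_eq_intros)
      from field_vector_diff_chain_at[OF uc_deriv[OF s0] this]
      have "((\<lambda>t. uc s t ^ N) has_vector_derivative
          uc s t * (\<i> * of_real (s / (s\<^sup>2 + t\<^sup>2))) * (of_nat N * uc s t ^ (N - 1))) (at t)"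
        by (simp add: o_def)
      moreover have "uc s t * (\<i> * of_real (s / (s\<^sup>2 + t\<^sup>2))) * (of_nat N * uc s t ^ (N - 1))
         = \<i> * of_nat N * of_real (s / (s\<^sup>2 + t\<^sup>2)) * uc s t ^ N"
        using N by (cases N) auto
      ultimately have d: "((\<lambda>t. uc s t ^ N) has_vector_derivative
          \<i> * of_nat N * of_real (s / (s\<^sup>2 + t\<^sup>2)) * uc s t ^ N) (at t)" by (simp only:)
      have "((\<lambda>t. of_real (A k (s, t)) * uc s t ^ N) has_vector_derivative
         of_real (A k (s, t)) * (\<i> * of_nat N * of_real (s / (s\<^sup>2 + t\<^sup>2)) * uc s t ^ N)
           + of_real (v k (s, t)) * uc s t ^ N) (at t)"
        by (rule has_vector_derivative_mult[OF has_vector_derivative_of_real[OF vd[OF s4]] d])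
      moreover have "of_real (A k (s, t)) * (\<i> * of_nat N * of_real (s / (s\<^sup>2 + t\<^sup>2)) * uc s t ^ N)
        = \<i> * of_nat N * (of_real (A k (s, t) * (s / (s\<^sup>2 + t\<^sup>2))) * uc s t ^ N)"
        by (simp only: of_real_mult mult_ac)
      ultimately show "((\<lambda>t. of_real (A k (s, t)) * uc s t ^ N) has_vector_derivative
         of_real (v k (s, t)) * uc s t ^ N + \<i> * of_nat N * (of_real (u k (s, t)) * uc s t ^ N))
           (at t within {-2..2})"
        unfolding Au by (simp add: add.commute has_vector_derivative_at_within)
    qed simp
    have A0: "A k (s, 2) = 0" "A k (s, -2) = 0" using Suc.prems(2)[OF s4] by (simp_all add: A_def)
    have hi: "((\<lambda>t. of_real (v k (s, t)) * uc s t ^ N + \<i> * of_nat N * (of_real (u k (s, t)) * uc s t ^ N))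
        has_integral (Iv + \<i> * of_nat N * Iu)) {-2..2}"
      unfolding Iv_def Iu_def
      by (intro has_integral_add has_integral_mult_right integrable_integral integrable_continuous_interval
          co Suc.prems(1) v(2))
    \<comment> \<open>The boundary terms vanish, so passing from \<open>u\<close> to
      \<open>v\<close> gains exactly one factor \<open>N\<close>.\<close>
    have "Iv + \<i> * of_nat N * Iu = 0"
      using has_integral_unique[OF hi ft] unfolding A0 by simp
    then have "Iv = - (\<i> * of_nat N * Iu)" by (simp add: add_eq_0_iff2)
    then have "cmod Iv = real N * cmod Iu" by (simp add: norm_mult)
    then have "cmod Iu * real N ^ Suc M = cmod Iv * real N ^ M" by simp
    also have "\<dots> \<le> C * w k ^ m" using C(2) N s unfolding Iv_def by blast
    finally show ?thesis unfolding Iu_def .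
  qed
  then show ?case using C(1) by blast
qed

text \<open>\<open>lpt n1 n2 s\<close> parametrizes the line \<open>{z. z \<bullet> n = s}\<close> by arc length. The functions integrated along
  it vanish outside the unit disc, so the parameter interval \<open>{-2..2}\<close> is sufficient.\<close>

definition lpt :: "real \<Rightarrow> real \<Rightarrow> real \<Rightarrow> real \<Rightarrow> real \<times> real" where
  "lpt n1 n2 s t = (s * n1 - t * n2, s * n2 + t * n1)"

definition lint :: "(real \<times> real \<Rightarrow> real) \<Rightarrow> real \<Rightarrow> real \<Rightarrow> real \<Rightarrow> real" where
  "lint F n1 n2 s = integral {-2..2} (\<lambda>t. F (lpt n1 n2 s t))"

lemma rsq_lpt: "n1\<^sup>2 + n2\<^sup>2 = 1 \<Longrightarrow> rsq (lpt n1 n2 s t) = s\<^sup>2 + t\<^sup>2"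
proof -
  assume n: "n1\<^sup>2 + n2\<^sup>2 = 1"
  have "rsq (lpt n1 n2 s t) = (s\<^sup>2 + t\<^sup>2) * (n1\<^sup>2 + n2\<^sup>2)"
    by (simp add: rsq_def lpt_def power2_eq_square algebra_simps)
  then show ?thesis using n by simp
qed

text \<open>As a complex number, \<open>lpt n1 n2 s t\<close> is the product of
  \<open>Complex n1 n2\<close> and \<open>Complex s t\<close>, and the first factor has modulus
  1.\<close>

lemma E_lpt:
  assumes n: "n1\<^sup>2 + n2\<^sup>2 = 1" and r: "1/4 \<le> s\<^sup>2 + t\<^sup>2"
  shows "Complex (E1 (lpt n1 n2 s t)) (E2 (lpt n1 n2 s t)) = Complex n1 n2 * uc s t"
proof -
  define \<rho> where "\<rho> = inverse (sqrt (s\<^sup>2 + t\<^sup>2))"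
  show ?thesis
    unfolding E1_def E2_def rsq_lpt[OF n] smax_eq[OF r] uc_def \<rho>_def[symmetric]
    by (simp add: lpt_def complex_eq_iff algebra_simps)
qed

lemma Phi_nonzero_ge: "1 \<le> k \<Longrightarrow> Phi k y \<noteq> 0 \<Longrightarrow> 1/4 \<le> y"
proof (rule ccontr)
  assume k: "1 \<le> k" and P: "Phi k y \<noteq> 0" and y: "\<not> 1/4 \<le> y"
  have "(4::real) ^ 1 \<le> 4 ^ k" using k by (intro power_increasing) auto
  then have "3/4 * 4 \<le> (1 - y) * 4 ^ k" using y by (intro mult_mono) auto
  then show False using P Phi_0[of y k] by simp
qed

lemma Phi_ge_1: "1 \<le> y \<Longrightarrow> Phi k y = 0"
  by (rule Phi_0) (auto intro!: disjI1 order_trans[OF mult_nonpos_nonneg])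

text \<open>From 2 k m \<le> k^2 + m^2. A power of \<open>4 ^ k\<close> of any degree thus costs a
  single factor \<open>wt k\<close>.\<close>

lemma pow4_le_wt: "(4 ^ k) ^ m \<le> 2 ^ (m\<^sup>2) * wt k"
proof -
  have "real (2 * k * m) \<le> real (m\<^sup>2 + k\<^sup>2)"
    using sum_squares_bound[of "real k" "real m"] by (simp add: mult_ac add.commute)
  then have "2 * k * m \<le> m\<^sup>2 + k\<^sup>2" by (simp only: of_nat_le_iff)
  then have "(2::real) ^ (2 * k * m) \<le> 2 ^ (m\<^sup>2 + k\<^sup>2)" by (intro power_increasing) auto
  then show ?thesis by (simp add: wt_def power_add power_mult)
qed

text \<open>\<open>q = 1\<close> serves the integral of \<open>ang k\<close>, \<open>q = 2\<close>
  that of its square. The unknown power of \<open>4 ^ k\<close> from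
  \<open>oscillatory_decay\<close> has been replaced by one factor \<open>wt k\<close>, whatever
  \<open>M\<close> is.\<close>

lemma decay_Phi:
  assumes "q = 1 \<or> q = (2::nat)"
  shows "\<exists>C\<ge>0. \<forall>k N s. 1 \<le> N \<longrightarrow> 1/2 \<le> \<bar>s\<bar> \<longrightarrow> \<bar>s\<bar> \<le> 1 \<longrightarrow>
    cmod (integral {-2..2} (\<lambda>t. of_real (Phi k (s\<^sup>2 + t\<^sup>2) ^ q) * uc s t ^ N)) * real N ^ M \<le> C * wt k"
proof -
  define u where "u = (\<lambda>k p. Phi k (rsq p) ^ q)"
  have u: "Cinf (\<lambda>k. 4 ^ k) {p. 1/4 < \<bar>fst p\<bar>} u" unfolding u_def
    by (rule Cinf_subset[OF Cinf_power[OF Cinf_Phi[OF smooth1_rsq open_UNIV]]]) simp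
  have supp: "u k (s, t) = 0" if "1 < \<bar>t\<bar>" for k s t
  proof -
    have "1 \<le> t\<^sup>2" using that by (simp add: abs_square_le_1 flip: not_less) (simp add: abs_square_less_1)
    then have "1 \<le> rsq (s, t)" unfolding rsq_def by (simp add: add_increasing)
    then show ?thesis using assms by (auto simp: u_def Phi_ge_1)
  qed
  have "\<exists>C\<ge>0. \<exists>m. \<forall>k N s. 1 \<le> N \<longrightarrow> 1/2 \<le> \<bar>s\<bar> \<longrightarrow> \<bar>s\<bar> \<le> 1 \<longrightarrow>
    cmod (integral {-2..2} (\<lambda>t. of_real (u k (s, t)) * uc s t ^ N)) * real N ^ M \<le> C * (4 ^ k) ^ m"
    by (rule oscillatory_decay[OF u]) (rule supp)
  then obtain C m where C: "C \<ge> 0"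
    "\<forall>k N s. 1 \<le> N \<longrightarrow> 1/2 \<le> \<bar>s\<bar> \<longrightarrow> \<bar>s\<bar> \<le> 1 \<longrightarrow>
    cmod (integral {-2..2} (\<lambda>t. of_real (u k (s, t)) * uc s t ^ N)) * real N ^ M \<le> C * (4 ^ k) ^ m"
    by blast
  have le: "C * (4 ^ k) ^ m \<le> C * 2 ^ (m\<^sup>2) * wt k" for k
    using mult_left_mono[OF pow4_le_wt C(1)] by (simp only: mult.assoc)
  have eq: "u k (s, t) = Phi k (s\<^sup>2 + t\<^sup>2) ^ q" for k s t by (simp add: u_def rsq_def)
  show ?thesis
  proof (intro exI[of _ "C * 2 ^ (m\<^sup>2)"] conjI allI impI)
    fix k N s assume "1 \<le> (N::nat)" "1/2 \<le> \<bar>s\<bar>" "\<bar>s\<bar> \<le> (1::real)"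
    from C(2)[unfolded eq, rule_format, OF this, of k] le[of k]
    show "cmod (integral {-2..2} (\<lambda>t. of_real (Phi k (s\<^sup>2 + t\<^sup>2) ^ q) * uc s t ^ N)) * real N ^ M
        \<le> C * 2 ^ (m\<^sup>2) * wt k" by (rule order_trans)
  qed (use C(1) in simp)
qed

lemma ang_lpt:
  assumes k: "1 \<le> k" and n: "n1\<^sup>2 + n2\<^sup>2 = 1"
  shows "ang k (lpt n1 n2 s t) = Phi k (s\<^sup>2 + t\<^sup>2) * Re ((Complex n1 n2 * uc s t) ^ freq k)"
proof (cases "Phi k (s\<^sup>2 + t\<^sup>2) = 0")
  case True
  then show ?thesis by (simp add: ang_def rsq_lpt[OF n])
next
  case False
  then show ?thesis
    using E_lpt[OF n Phi_nonzero_ge[OF k False]] by (simp add: ang_def rsq_lpt[OF n])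
qed

lemma continuous_on_Phi: "continuous_on S y \<Longrightarrow> continuous_on S (\<lambda>x. Phi k (y x))"
proof -
  have "smooth1 UNIV (\<lambda>x::real. x)" by (rule smooth1_linear[OF bounded_linear_ident])
  from Cinf_cont[OF Cinf_Phi[OF this open_UNIV], of k]
  have "continuous_on UNIV (Phi k)" by simp
  then show "continuous_on S y \<Longrightarrow> continuous_on S (\<lambda>x. Phi k (y x))"
    using continuous_on_compose2 by blast
qed

text \<open>The direction enters only through a constant factor of modulus 1, which makes the
  estimates uniform in the direction.\<close>

lemma integral_Re_bound:
  assumes n: "n1\<^sup>2 + n2\<^sup>2 = 1" and s: "s \<noteq> 0"
  shows "\<bar>integral {-2..2} (\<lambda>t. Phi k (s\<^sup>2 + t\<^sup>2) ^ q * Re ((Complex n1 n2 * uc s t) ^ N))\<bar> \<le>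
    cmod (integral {-2..2} (\<lambda>t. of_real (Phi k (s\<^sup>2 + t\<^sup>2) ^ q) * uc s t ^ N))"
proof -
  define I where "I = integral {-2..2} (\<lambda>t. of_real (Phi k (s\<^sup>2 + t\<^sup>2) ^ q) * uc s t ^ N)"
  have "((\<lambda>t. of_real (Phi k (s\<^sup>2 + t\<^sup>2) ^ q) * uc s t ^ N) has_integral I) {-2..2}"
    unfolding I_def
    by (intro integrable_integral integrable_continuous_interval continuous_intros
        continuous_on_Phi continuous_on_uc s)
  from has_integral_linear[OF has_integral_mult_right[OF this, of "Complex n1 n2 ^ N"] bounded_linear_Re]
  have "((\<lambda>t. Phi k (s\<^sup>2 + t\<^sup>2) ^ q * Re ((Complex n1 n2 * uc s t) ^ N)) has_integral
      Re (Complex n1 n2 ^ N * I)) {-2..2}"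
    by (rule has_integral_eq[rotated]) (simp add: o_def power_mult_distrib algebra_simps
        flip: of_real_power)
  then have "integral {-2..2} (\<lambda>t. Phi k (s\<^sup>2 + t\<^sup>2) ^ q * Re ((Complex n1 n2 * uc s t) ^ N)) =
      Re (Complex n1 n2 ^ N * I)" by (rule integral_unique)
  moreover have "cmod (Complex n1 n2 ^ N * I) = cmod I"
    using n by (simp add: norm_mult norm_power complex_norm)
  ultimately show ?thesis using abs_Re_le_cmod[of "Complex n1 n2 ^ N * I"] unfolding I_def by simp
qed

lemma lint_ang_negl:
  "\<exists>C\<ge>0. \<forall>k n1 n2 s. 1 \<le> k \<longrightarrow> n1\<^sup>2 + n2\<^sup>2 = 1 \<longrightarrow> 1/2 \<le> \<bar>s\<bar> \<longrightarrow> \<bar>lint (ang k) n1 n2 s\<bar> * wt k ^ M \<le> C"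
proof -
  \<comment> \<open>One power more than claimed, to cancel the factor \<open>wt k\<close> on the
    right-hand side.\<close>
  obtain C where C: "C \<ge> 0" "\<forall>k N s. 1 \<le> N \<longrightarrow> 1/2 \<le> \<bar>s\<bar> \<longrightarrow> \<bar>s\<bar> \<le> 1 \<longrightarrow>
    cmod (integral {-2..2} (\<lambda>t. of_real (Phi k (s\<^sup>2 + t\<^sup>2) ^ 1) * uc s t ^ N)) * real N ^ Suc M \<le> C * wt k"
    using decay_Phi[of 1 "Suc M", OF disjI1[OF refl]] by blast
  have "\<bar>lint (ang k) n1 n2 s\<bar> * wt k ^ M \<le> C"
    if k: "1 \<le> k" and n: "n1\<^sup>2 + n2\<^sup>2 = 1" and s: "1/2 \<le> \<bar>s\<bar>" for k n1 n2 s
  proof (cases "\<bar>s\<bar> \<le> 1")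
    case True
    define J where "J = cmod (integral {-2..2} (\<lambda>t. of_real (Phi k (s\<^sup>2 + t\<^sup>2) ^ 1) * uc s t ^ freq k))"
    have f: "real (freq k) = wt k" "1 \<le> freq k" by (simp_all add: freq_def wt_def)
    have w: "0 < wt k" using wt_ge1[of k] by linarith
    have "\<bar>lint (ang k) n1 n2 s\<bar> \<le> J"
      unfolding lint_def ang_lpt[OF k n] J_def using integral_Re_bound[OF n, of s k 1 "freq k"] s by auto
    then have "\<bar>lint (ang k) n1 n2 s\<bar> * wt k ^ M \<le> J * wt k ^ M"
      using w by (intro mult_right_mono) auto
    moreover
    have "J * wt k ^ Suc M \<le> C * wt k"
      using C(2)[rule_format, OF f(2) s True, of k] unfolding J_def f(1) .
    then have "J * wt k ^ M * wt k \<le> C * wt k" by (simp only: power_Suc mult_ac)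
    then have "J * wt k ^ M \<le> C" using w by (simp only: mult_le_cancel_right_pos)
    ultimately show ?thesis by (rule order_trans)
  next
    case False
    have "1 \<le> s\<^sup>2 + t\<^sup>2" for t
    proof -
      have "1\<^sup>2 \<le> \<bar>s\<bar>\<^sup>2" using False by (intro power_mono) auto
      then show ?thesis by (simp add: add_increasing2)
    qed
    then have "lint (ang k) n1 n2 s = 0" unfolding lint_def ang_lpt[OF k n] by (simp add: Phi_ge_1)
    then show ?thesis using C(1) by simp
  qed
  then show ?thesis using C(1) by blast
qed

text \<open>With q = 4^(-k), the cutoff equals 1 when 1 - s^2 - t^2 is between 5/4 q and 7/4 q; the
  hypothesis 5/2 makes this a range of positive t^2. It has length q/2 inside [0, 1], so
  \<open>t\<close> itself runs through an interval of length at least q/4.\<close>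

lemma integral_Phi_sq:
  assumes s: "5/2 \<le> (1 - s\<^sup>2) * 4 ^ k"
  shows "1 / (4 * 4 ^ k) \<le> integral {-2..2} (\<lambda>t. Phi k (s\<^sup>2 + t\<^sup>2) ^ 2)"
proof -
  define q :: real where "q = 1 / 4 ^ k"
  have q: "0 < q" "q \<le> 1" "q * 4 ^ k = 1" by (simp_all add: q_def)
  define A where "A = 1 - s\<^sup>2 - 7/4 * q"
  have "5/2 * q \<le> (1 - s\<^sup>2) * 4 ^ k * q" using s q by (intro mult_right_mono) auto
  also have "\<dots> = 1 - s\<^sup>2" using q(3) by (simp add: mult.assoc mult.commute[of q])
  finally have A: "3/4 * q \<le> A" unfolding A_def by simp
  have A1: "A + q/2 \<le> 1" unfolding A_def using q(1) zero_le_power2[of s] by linarith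
  define t1 where "t1 = sqrt A"
  define t2 where "t2 = sqrt (A + q/2)"
  have sq: "t1\<^sup>2 = A" "t2\<^sup>2 = A + q/2" using A q(1) by (simp_all add: t1_def t2_def)
  have t: "0 \<le> t1" "t1 \<le> t2" "t2 \<le> 1" using A q(1) A1 by (simp_all add: t1_def t2_def)
  have "q/2 = (t2 - t1) * (t2 + t1)" using sq by (simp add: power2_eq_square algebra_simps)
  also have "\<dots> \<le> (t2 - t1) * 2" using t by (intro mult_left_mono) auto
  finally have len: "q/4 \<le> t2 - t1" by simp
  have co: "continuous_on B (\<lambda>t. Phi k (s\<^sup>2 + t\<^sup>2) ^ 2)" for B
    by (intro continuous_intros continuous_on_Phi)
  have one: "Phi k (s\<^sup>2 + r\<^sup>2) ^ 2 = 1" if "r \<in> {t1..t2}" for r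
  proof -
    have "t1\<^sup>2 \<le> r\<^sup>2" "r\<^sup>2 \<le> t2\<^sup>2" using that t by (auto intro!: power_mono)
    then have "5/4 * q \<le> 1 - (s\<^sup>2 + r\<^sup>2)" "1 - (s\<^sup>2 + r\<^sup>2) \<le> 7/4 * q" using sq by (auto simp: A_def)
    then have "5/4 * q * 4 ^ k \<le> (1 - (s\<^sup>2 + r\<^sup>2)) * 4 ^ k" "(1 - (s\<^sup>2 + r\<^sup>2)) * 4 ^ k \<le> 7/4 * q * 4 ^ k"
      by (intro mult_right_mono; simp)+
    then have "Phi k (s\<^sup>2 + r\<^sup>2) = 1" unfolding Phi_def using q(3) by (intro bump_1) (simp_all only: mult.assoc)
    then show ?thesis by simp
  qed
  have "t2 - t1 = integral {t1..t2} (\<lambda>r. Phi k (s\<^sup>2 + r\<^sup>2) ^ 2)"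
    using integral_cong[of "{t1..t2}" "\<lambda>r. Phi k (s\<^sup>2 + r\<^sup>2) ^ 2" "\<lambda>_. 1"] one t by simp
  also have "\<dots> \<le> integral {-2..2} (\<lambda>r. Phi k (s\<^sup>2 + r\<^sup>2) ^ 2)"
    by (rule integral_subset_le) (use t in \<open>auto intro!: integrable_continuous_interval co\<close>)
  finally show ?thesis using len by (simp add: q_def)
qed

lemma Re_square_unit: "cmod z = 1 \<Longrightarrow> (Re z)\<^sup>2 = (1 + Re (z\<^sup>2)) / 2"
proof -
  assume "cmod z = 1"
  then have "(Re z)\<^sup>2 + (Im z)\<^sup>2 = 1" using cmod_power2[of z] by simp
  then show ?thesis by (simp add: power2_eq_square)
qed

text \<open>The squared cosine is 1/2 plus half a cosine of doubled frequency. The first part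
  contributes at least 1/8 of \<open>4 ^ (- k)\<close> by \<open>integral_Phi_sq\<close>; the second
  is oscillatory and, for large \<open>k\<close>, at most 1/64 of it.\<close>

lemma lint_ang_sq:
  "\<exists>K. \<forall>k n1 n2 s. K \<le> k \<longrightarrow> n1\<^sup>2 + n2\<^sup>2 = 1 \<longrightarrow> 1/2 \<le> \<bar>s\<bar> \<longrightarrow> 5/2 \<le> (1 - s\<^sup>2) * 4 ^ k \<longrightarrow>
     1 / (16 * 4 ^ k) \<le> lint (\<lambda>z. (ang k z)\<^sup>2) n1 n2 s"
proof -
  obtain C where C: "C \<ge> 0" "\<forall>k N s. 1 \<le> N \<longrightarrow> 1/2 \<le> \<bar>s\<bar> \<longrightarrow> \<bar>s\<bar> \<le> 1 \<longrightarrow>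
    cmod (integral {-2..2} (\<lambda>t. of_real (Phi k (s\<^sup>2 + t\<^sup>2) ^ 2) * uc s t ^ N)) * real N ^ 2 \<le> C * wt k"
    using decay_Phi[of 2 2, OF disjI2[OF refl]] by blast
  \<comment> \<open>Yields \<open>8 * C * 4 ^ k \<le> wt k\<close> for \<open>k \<ge> K0\<close>,
    because 16^k is at most \<open>2 ^ 4 * wt k\<close> by \<open>pow4_le_wt\<close>.\<close>
  obtain K0 :: nat where K0: "8 * C * 2 ^ (2\<^sup>2) < 4 ^ K0"
    using real_arch_pow[of 4 "8 * C * 2 ^ (2\<^sup>2)"] by auto
  have "1 / (16 * 4 ^ k) \<le> lint (\<lambda>z. (ang k z)\<^sup>2) n1 n2 s"
    if k: "max 1 K0 \<le> k" and n: "n1\<^sup>2 + n2\<^sup>2 = 1" and s: "1/2 \<le> \<bar>s\<bar>" "5/2 \<le> (1 - s\<^sup>2) * 4 ^ k" for k n1 n2 s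
  proof -
    have k1: "1 \<le> k" and s0: "s \<noteq> 0" using k s by auto
    have "0 < (1 - s\<^sup>2) * 4 ^ k" using s(2) by linarith
    then have "s\<^sup>2 < 1" by (simp add: zero_less_mult_iff)
    then have s1: "\<bar>s\<bar> \<le> 1" by (simp add: abs_square_less_1)
    define I1 where "I1 = integral {-2..2} (\<lambda>t. Phi k (s\<^sup>2 + t\<^sup>2) ^ 2)"
    define I2 where "I2 = integral {-2..2} (\<lambda>t. Phi k (s\<^sup>2 + t\<^sup>2) ^ 2 * Re ((Complex n1 n2 * uc s t) ^ (2 * freq k)))"
    have pt: "(ang k (lpt n1 n2 s t))\<^sup>2 = Phi k (s\<^sup>2 + t\<^sup>2) ^ 2 * (1/2) +
        Phi k (s\<^sup>2 + t\<^sup>2) ^ 2 * Re ((Complex n1 n2 * uc s t) ^ (2 * freq k)) * (1/2)" for t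
    proof -
      have "cmod ((Complex n1 n2 * uc s t) ^ freq k) = 1"
        using n norm_uc[OF s0] by (simp add: norm_power norm_mult complex_norm)
      from Re_square_unit[OF this]
      have "(Re ((Complex n1 n2 * uc s t) ^ freq k))\<^sup>2 = (1 + Re ((Complex n1 n2 * uc s t) ^ (2 * freq k))) / 2"
        by (simp only: power_mult[symmetric] mult.commute[of 2])
      moreover have "p * ((1 + r) / 2) = p * (1/2) + p * r * (1/2)" for p r :: real by (simp add: field_simps)
      ultimately show ?thesis
        unfolding ang_lpt[OF k1 n] power_mult_distrib[of "Phi k (s\<^sup>2 + t\<^sup>2)"] by (simp only:)
    qed
    have "((\<lambda>t. (ang k (lpt n1 n2 s t))\<^sup>2) has_integral I1 * (1/2) + I2 * (1/2)) {-2..2}"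
      unfolding pt I1_def I2_def
      by (intro has_integral_add has_integral_mult_left integrable_integral integrable_continuous_interval
          continuous_intros continuous_on_Phi continuous_on_uc s0)
    then have L: "lint (\<lambda>z. (ang k z)\<^sup>2) n1 n2 s = I1 / 2 + I2 / 2"
      unfolding lint_def by (simp add: integral_unique)
    define J where "J = cmod (integral {-2..2} (\<lambda>t. of_real (Phi k (s\<^sup>2 + t\<^sup>2) ^ 2) * uc s t ^ (2 * freq k)))"
    have I2: "\<bar>I2\<bar> \<le> J" unfolding I2_def J_def by (rule integral_Re_bound[OF n s0])
    have f: "real (2 * freq k) = 2 * wt k" "1 \<le> 2 * freq k" by (simp_all add: freq_def wt_def)
    have w: "0 < wt k" using wt_ge1[of k] by linarith
    have "J * (2 * wt k) ^ 2 \<le> C * wt k"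
      using C(2)[rule_format, OF f(2) s(1) s1, of k] unfolding J_def f(1) .
    then have "(J * (4 * wt k)) * wt k \<le> C * wt k" by (simp add: power2_eq_square mult_ac)
    then have J1: "J * (4 * wt k) \<le> C" using w by (simp only: mult_le_cancel_right_pos)
    have J0: "0 \<le> J" by (simp add: J_def)
    have "8 * C * 2 ^ (2\<^sup>2) * 4 ^ k \<le> 4 ^ k * 4 ^ k"
    proof (rule mult_right_mono)
      have "(4::real) ^ K0 \<le> 4 ^ k" using k by (intro power_increasing) auto
      then show "8 * C * 2 ^ (2\<^sup>2) \<le> 4 ^ k" using K0 by linarith
    qed simp
    also have "\<dots> \<le> 2 ^ (2\<^sup>2) * wt k" using pow4_le_wt[of k 2] by (simp add: power2_eq_square)
    finally have "8 * C * 4 ^ k \<le> wt k" by simp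
    moreover have "8 * (J * (4 * wt k)) * 4 ^ k \<le> 8 * C * 4 ^ k" using J1 by simp
    ultimately have "8 * (J * (4 * wt k)) * 4 ^ k \<le> wt k" by (rule order_trans[rotated])
    moreover have "8 * (J * (4 * wt k)) * 4 ^ k = (32 * J * 4 ^ k) * wt k" by simp
    ultimately have "(32 * J * 4 ^ k) * wt k \<le> 1 * wt k" by (simp only: mult_1_left)
    then have "32 * J * 4 ^ k \<le> 1" using w by (simp only: mult_le_cancel_right_pos)
    then have "J \<le> 1 / (32 * 4 ^ k)" by (simp add: field_simps)
    moreover have "1 / (4 * 4 ^ k) \<le> I1" unfolding I1_def by (rule integral_Phi_sq[OF s(2)])
    moreover have "1 / (32 * 4 ^ k) = (1 / 32) * (1 / (4::real) ^ k)" "1 / (4 * 4 ^ k) = (1/4) * (1 / (4::real) ^ k)"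
      "1 / (16 * 4 ^ k) = (1/16) * (1 / (4::real) ^ k)" "0 < 1 / (4::real) ^ k" by simp_all
    ultimately show ?thesis using I2 unfolding L by linarith
  qed
  then show ?thesis by blast
qed

section \<open>Radial oscillations integrated along lines\<close>

lemma radial_decay_half:
  fixes U :: "real \<Rightarrow> real"
  assumes U: "\<And>y. (U has_real_derivative U' y) (at y)" and U': "continuous_on UNIV U'"
    and L: "\<And>y. 0 \<le> y \<Longrightarrow> y \<le> 5 \<Longrightarrow> \<bar>U y\<bar> \<le> L" "\<And>y. 0 \<le> y \<Longrightarrow> y \<le> 5 \<Longrightarrow> \<bar>U' y\<bar> \<le> L"
    and \<delta>: "0 < \<delta>" "\<delta> \<le> 1" and N: "0 < N" and s: "\<bar>s\<bar> \<le> 1"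
  shows "\<bar>integral {\<delta>..2} (\<lambda>t. U (s\<^sup>2 + t\<^sup>2) * cos (N * (s\<^sup>2 + t\<^sup>2)))\<bar> \<le> 4 * L / (N * \<delta>\<^sup>2)"
proof -
  \<comment> \<open>A primitive of \<open>f\<close> up to the error \<open>g\<close> of order 1/N;
    the denominator \<open>2 * N * t\<close> is the derivative of the phase, which is why
    \<open>t\<close> has to stay above \<open>\<delta>\<close>.\<close>
  define F where "F t = U (s\<^sup>2 + t\<^sup>2) * sin (N * (s\<^sup>2 + t\<^sup>2)) / (2 * N * t)" for t
  define f where "f t = U (s\<^sup>2 + t\<^sup>2) * cos (N * (s\<^sup>2 + t\<^sup>2))" for t
  define g where "g t = sin (N * (s\<^sup>2 + t\<^sup>2)) * (U' (s\<^sup>2 + t\<^sup>2) / N - U (s\<^sup>2 + t\<^sup>2) / (2 * N * t\<^sup>2))" for t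
  have L0: "0 \<le> L" using L(1)[of 0] by linarith
  have s2: "s\<^sup>2 \<le> 1" using s by (simp add: abs_square_le_1)
  have cU: "continuous_on UNIV U" using U by (auto intro!: continuous_at_imp_continuous_on DERIV_isCont)
  have cont: "continuous_on {\<delta>..2} f" "continuous_on {\<delta>..2} g"
    unfolding f_def g_def using \<delta> N
    by (auto intro!: continuous_intros continuous_on_compose2[OF cU] continuous_on_compose2[OF U'])
  have dF: "(F has_real_derivative f t + g t) (at t)" if "0 < t" for t
  proof -
    have "((\<lambda>t. s\<^sup>2 + t\<^sup>2) has_real_derivative 2 * t) (at t)" by (auto intro!: derivative_eq_intros)
    from DERIV_chain2[OF U this]
    have dU: "((\<lambda>t. U (s\<^sup>2 + t\<^sup>2)) has_real_derivative U' (s\<^sup>2 + t\<^sup>2) * (2 * t)) (at t)" .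
    have ds: "((\<lambda>t. sin (N * (s\<^sup>2 + t\<^sup>2)) / (2 * N * t)) has_real_derivative
       cos (N * (s\<^sup>2 + t\<^sup>2)) - sin (N * (s\<^sup>2 + t\<^sup>2)) / (2 * N * t\<^sup>2)) (at t)"
      using that N by (auto intro!: derivative_eq_intros simp: field_simps power2_eq_square)
    have "F = (\<lambda>t. U (s\<^sup>2 + t\<^sup>2) * (sin (N * (s\<^sup>2 + t\<^sup>2)) / (2 * N * t)))" by (simp add: F_def fun_eq_iff)
    moreover have "f t + g t = U' (s\<^sup>2 + t\<^sup>2) * (2 * t) * (sin (N * (s\<^sup>2 + t\<^sup>2)) / (2 * N * t)) +
       (cos (N * (s\<^sup>2 + t\<^sup>2)) - sin (N * (s\<^sup>2 + t\<^sup>2)) / (2 * N * t\<^sup>2)) * U (s\<^sup>2 + t\<^sup>2)"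
    proof -
      have "U' (s\<^sup>2 + t\<^sup>2) * (2 * t) * (sin (N * (s\<^sup>2 + t\<^sup>2)) / (2 * N * t)) =
          sin (N * (s\<^sup>2 + t\<^sup>2)) * (U' (s\<^sup>2 + t\<^sup>2) / N)" using that N by simp
      then show ?thesis by (simp add: f_def g_def algebra_simps)
    qed
    ultimately show ?thesis using DERIV_mult[OF dU ds] by (simp only:)
  qed
  have ft: "((\<lambda>t. f t + g t) has_integral (F 2 - F \<delta>)) {\<delta>..2}"
  proof (rule fundamental_theorem_of_calculus)
    fix t assume "t \<in> {\<delta>..2}"
    then have "0 < t" using \<delta> by auto
    from dF[OF this] show "(F has_vector_derivative f t + g t) (at t within {\<delta>..2})"
      unfolding has_real_derivative_iff_has_vector_derivative by (rule has_vector_derivative_at_within)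
  qed (use \<delta> in auto)
  moreover have "((\<lambda>t. f t + g t) has_integral (integral {\<delta>..2} f + integral {\<delta>..2} g)) {\<delta>..2}"
    by (intro has_integral_add integrable_integral integrable_continuous_interval cont)
  ultimately have e: "integral {\<delta>..2} f = F 2 - F \<delta> - integral {\<delta>..2} g"
    using has_integral_unique[of "\<lambda>t. f t + g t"] by (metis add_diff_cancel_right')
  have in5: "0 \<le> s\<^sup>2 + t\<^sup>2" "s\<^sup>2 + t\<^sup>2 \<le> 5" if "\<delta> \<le> t" "t \<le> 2" for t
  proof -
    have "t\<^sup>2 \<le> 2\<^sup>2" using that \<delta> by (intro power_mono) auto
    then show "0 \<le> s\<^sup>2 + t\<^sup>2" "s\<^sup>2 + t\<^sup>2 \<le> 5" using s2 by auto
  qed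
  have bF: "\<bar>F t\<bar> \<le> L / (2 * N * t)" if "\<delta> \<le> t" "t \<le> 2" for t
  proof -
    have "\<bar>U (s\<^sup>2 + t\<^sup>2)\<bar> * \<bar>sin (N * (s\<^sup>2 + t\<^sup>2))\<bar> \<le> L * 1"
      using L0 by (intro mult_mono L(1) in5 that) auto
    then show ?thesis unfolding F_def abs_divide abs_mult using that \<delta> N
      by (simp add: divide_right_mono)
  qed
  have bg: "norm (g t) \<le> L / N + L / (2 * N * \<delta>\<^sup>2)" if "t \<in> {\<delta>..2}" for t
  proof -
    have t: "\<delta> \<le> t" "t \<le> 2" using that by auto
    have "\<delta>\<^sup>2 \<le> t\<^sup>2" using t \<delta> by (intro power_mono) auto
    then have d: "2 * N * \<delta>\<^sup>2 \<le> 2 * N * t\<^sup>2" "0 < 2 * N * \<delta>\<^sup>2" using N \<delta> by auto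
    have "\<bar>U' (s\<^sup>2 + t\<^sup>2) / N\<bar> \<le> L / N"
      using L(2)[OF in5[OF t]] N by (simp add: divide_right_mono)
    moreover have "\<bar>U (s\<^sup>2 + t\<^sup>2) / (2 * N * t\<^sup>2)\<bar> \<le> L / (2 * N * \<delta>\<^sup>2)"
    proof -
      have "\<bar>U (s\<^sup>2 + t\<^sup>2) / (2 * N * t\<^sup>2)\<bar> = \<bar>U (s\<^sup>2 + t\<^sup>2)\<bar> / (2 * N * t\<^sup>2)" using N by simp
      also have "\<dots> \<le> L / (2 * N * \<delta>\<^sup>2)"
        by (rule frac_le[OF L0 L(1)[OF in5[OF t]] d(2) d(1)])
      finally show ?thesis .
    qed
    ultimately have "\<bar>U' (s\<^sup>2 + t\<^sup>2) / N - U (s\<^sup>2 + t\<^sup>2) / (2 * N * t\<^sup>2)\<bar> \<le> L / N + L / (2 * N * \<delta>\<^sup>2)"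
      by linarith
    then have "\<bar>sin (N * (s\<^sup>2 + t\<^sup>2))\<bar> * \<bar>U' (s\<^sup>2 + t\<^sup>2) / N - U (s\<^sup>2 + t\<^sup>2) / (2 * N * t\<^sup>2)\<bar>
        \<le> 1 * (L / N + L / (2 * N * \<delta>\<^sup>2))" by (intro mult_mono) auto
    then show ?thesis unfolding g_def real_norm_def abs_mult by simp
  qed
  have ig: "norm (integral {\<delta>..2} g) \<le> (L / N + L / (2 * N * \<delta>\<^sup>2)) * (2 - \<delta>)"
    by (rule integral_bound[OF _ cont(2) bg]) (use \<delta> in auto)
  define c where "c = L / N"
  have c0: "0 \<le> c" using L0 N by (simp add: c_def)
  have "(c + c / (2 * \<delta>\<^sup>2)) * (2 - \<delta>) \<le> (c + c / (2 * \<delta>\<^sup>2)) * 2"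
    using c0 \<delta> by (intro mult_left_mono add_nonneg_nonneg divide_nonneg_pos) auto
  moreover have "L / N + L / (2 * N * \<delta>\<^sup>2) = c + c / (2 * \<delta>\<^sup>2)" by (simp add: c_def)
  ultimately have ig': "\<bar>integral {\<delta>..2} g\<bar> \<le> 2 * c + c / \<delta>\<^sup>2" using ig by simp
  have "\<delta>\<^sup>2 \<le> 1" using \<delta> by (simp add: power_le_one)
  then have d2: "1 \<le> 1 / \<delta>\<^sup>2" "1 / \<delta> \<le> 1 / \<delta>\<^sup>2"
    using \<delta> by (simp_all add: field_simps power2_eq_square)
  have F2: "\<bar>F 2\<bar> \<le> c / 4" using bF[of 2] \<delta> by (simp add: c_def)
  have Fd: "\<bar>F \<delta>\<bar> \<le> c * (1 / \<delta>) / 2" using bF[of \<delta>] \<delta> by (simp add: c_def)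
  have "c * 1 \<le> c * (1 / \<delta>\<^sup>2)" "c * (1 / \<delta>) \<le> c * (1 / \<delta>\<^sup>2)"
    using c0 d2 by (intro mult_left_mono; simp)+
  moreover define P Q where "P = c * (1 / \<delta>\<^sup>2)" and "Q = c * (1 / \<delta>)"
  ultimately have "c \<le> P" "Q \<le> P" by simp_all
  moreover have "\<bar>integral {\<delta>..2} g\<bar> \<le> 2 * c + P" "\<bar>F \<delta>\<bar> \<le> Q / 2" using ig' Fd by (simp_all add: P_def Q_def)
  ultimately have "\<bar>integral {\<delta>..2} f\<bar> \<le> 4 * P" using e F2 by linarith
  also have "4 * P = 4 * L / (N * \<delta>\<^sup>2)" by (simp add: P_def c_def)
  finally have "\<bar>integral {\<delta>..2} f\<bar> \<le> 4 * L / (N * \<delta>\<^sup>2)" .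
  then show ?thesis unfolding f_def .
qed

text \<open>The phase is stationary at t = 0. The interval of half-length \<open>\<delta>\<close>
  around it contributes at most \<eta>/2 by the trivial bound; after that choice a large
  \<open>N\<close> makes each of the two outer intervals contribute at most \<eta>/4.\<close>

lemma radial_decay:
  fixes U :: "real \<Rightarrow> real"
  assumes U: "\<And>y. (U has_real_derivative U' y) (at y)" and U': "continuous_on UNIV U'" and \<eta>: "0 < \<eta>"
  shows "\<exists>N0. \<forall>N s. N0 \<le> N \<longrightarrow> \<bar>s\<bar> \<le> 1 \<longrightarrow>
    \<bar>integral {-2..2} (\<lambda>t. U (s\<^sup>2 + t\<^sup>2) * cos (N * (s\<^sup>2 + t\<^sup>2)))\<bar> \<le> \<eta>"
proof -
  have cU: "continuous_on UNIV U" using U by (auto intro!: continuous_at_imp_continuous_on DERIV_isCont)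
  have "bounded (U ` {0..5})" "bounded (U' ` {0..5})"
    by (intro compact_imp_bounded compact_continuous_image continuous_on_subset[OF cU] continuous_on_subset[OF U']; simp)+
  then obtain L1 L2 where L12: "\<forall>y\<in>{0..5}. \<bar>U y\<bar> \<le> L1" "\<forall>y\<in>{0..5}. \<bar>U' y\<bar> \<le> L2"
    unfolding bounded_iff by auto
  define L where "L = max 1 (max L1 L2)"
  have L: "\<bar>U y\<bar> \<le> L" "\<bar>U' y\<bar> \<le> L" if "0 \<le> y" "y \<le> 5" for y
    using L12 that unfolding L_def by (auto simp: le_max_iff_disj)
  have L1: "1 \<le> L" by (simp add: L_def)
  define \<delta> where "\<delta> = min 1 (\<eta> / (4 * L))"
  have \<delta>: "0 < \<delta>" "\<delta> \<le> 1" "\<delta> \<le> \<eta> / (4 * L)" using \<eta> L1 by (auto simp: \<delta>_def)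
  define N0 where "N0 = 16 * L / (\<delta>\<^sup>2 * \<eta>)"
  have N0: "0 < N0" using L1 \<delta> \<eta> by (simp add: N0_def)
  have "\<bar>integral {-2..2} (\<lambda>t. U (s\<^sup>2 + t\<^sup>2) * cos (N * (s\<^sup>2 + t\<^sup>2)))\<bar> \<le> \<eta>"
    if N: "N0 \<le> N" and s: "\<bar>s\<bar> \<le> 1" for N s
  proof -
    define f where "f t = U (s\<^sup>2 + t\<^sup>2) * cos (N * (s\<^sup>2 + t\<^sup>2))" for t
    have Np: "0 < N" using N N0 by linarith
    have s2: "s\<^sup>2 \<le> 1" using s by (simp add: abs_square_le_1)
    have cf: "continuous_on A f" for A
      unfolding f_def by (intro continuous_intros continuous_on_compose2[OF cU]) auto
    have a: "\<bar>integral {\<delta>..2} f\<bar> \<le> 4 * L / (N * \<delta>\<^sup>2)"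
      unfolding f_def by (rule radial_decay_half[OF U U' L \<delta>(1,2) Np s])
    have b: "integral {-2..-\<delta>} f = integral {\<delta>..2} f"
    proof -
      have "(\<lambda>t. f (- t)) = f" by (simp add: f_def fun_eq_iff)
      then show ?thesis using Henstock_Kurzweil_Integration.integral_reflect_real[of 2 \<delta> f] by (simp only:)
    qed
    have c: "norm (integral {-\<delta>..\<delta>} f) \<le> L * (\<delta> - (-\<delta>))"
    proof (rule integral_bound[OF _ cf])
      fix t assume "t \<in> {-\<delta>..\<delta>}"
      then have "\<bar>t\<bar>\<^sup>2 \<le> 1\<^sup>2" using \<delta> by (intro power_mono) auto
      then have "\<bar>U (s\<^sup>2 + t\<^sup>2)\<bar> \<le> L" using s2 by (intro L) auto
      then show "norm (f t) \<le> L" unfolding f_def real_norm_def abs_mult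
        using mult_mono[of "\<bar>U (s\<^sup>2 + t\<^sup>2)\<bar>" L "\<bar>cos (N * (s\<^sup>2 + t\<^sup>2))\<bar>" 1] by simp
    qed (use \<delta> in auto)
    have "integral {-2..2} f = integral {-2..-\<delta>} f + integral {-\<delta>..2} f"
      using \<delta> by (intro Henstock_Kurzweil_Integration.integral_combine[symmetric] integrable_continuous_interval cf) auto
    also have "integral {-\<delta>..2} f = integral {-\<delta>..\<delta>} f + integral {\<delta>..2} f"
      using \<delta> by (intro Henstock_Kurzweil_Integration.integral_combine[symmetric] integrable_continuous_interval cf) auto
    finally have e: "integral {-2..2} f = 2 * integral {\<delta>..2} f + integral {-\<delta>..\<delta>} f" using b by simp
    have "16 * L \<le> N * (\<delta>\<^sup>2 * \<eta>)" using N \<delta> \<eta> unfolding N0_def by (simp add: field_simps)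
    then have "4 * L / (N * \<delta>\<^sup>2) \<le> \<eta> / 4" using Np \<delta> by (simp add: field_simps)
    moreover have "L * (\<delta> - (-\<delta>)) \<le> \<eta> / 2" using \<delta>(3) L1 by (simp add: field_simps)
    ultimately have "\<bar>integral {-2..2} f\<bar> \<le> \<eta>" using a c e unfolding real_norm_def by linarith
    then show ?thesis unfolding f_def .
  qed
  then show ?thesis by blast
qed

lemma smooth1_real_C1:
  fixes U :: "real \<Rightarrow> real"
  assumes "smooth1 UNIV U"
  shows "\<exists>U'. (\<forall>y. (U has_real_derivative U' y) (at y)) \<and> continuous_on UNIV U'"
proof -
  obtain v where v: "pder UNIV 1 (\<lambda>_::unit. U) v" "Cinf (\<lambda>_. 1) UNIV v"
    using Cinf_deriv[OF open_UNIV assms, of 1] by auto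
  have "(U has_real_derivative v () y) (at y)" for y
    using pder_at[OF v(1), of 0 y "()"] by simp
  then show ?thesis using Cinf_cont[OF v(2), of "()"] by blast
qed

lemma Phi_power_C1: "\<exists>U'. (\<forall>y. ((\<lambda>y. Phi k y ^ q) has_real_derivative U' y) (at y)) \<and> continuous_on UNIV U'"
proof -
  have "smooth1 UNIV (\<lambda>x::real. x)" by (rule smooth1_linear[OF bounded_linear_ident])
  from Cinf_power[OF Cinf_single[OF Cinf_Phi[OF this open_UNIV], of k], of q]
  have "smooth1 UNIV (\<lambda>y. Phi k y ^ q)" by simp
  then show ?thesis by (rule smooth1_real_C1)
qed

lemma lint_star_small:
  assumes "0 < \<eta>"
  shows "\<exists>N0. \<forall>N n1 n2 s. N0 \<le> N \<longrightarrow> n1\<^sup>2 + n2\<^sup>2 = 1 \<longrightarrow> \<bar>s\<bar> \<le> 1 \<longrightarrow> \<bar>lint (star k N) n1 n2 s\<bar> \<le> \<eta>"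
proof -
  obtain U' where U': "\<forall>y. ((\<lambda>y. Phi k y ^ 1) has_real_derivative U' y) (at y)" "continuous_on UNIV U'"
    using Phi_power_C1[of k 1] by (elim exE conjE)
  from radial_decay[OF U'(1)[rule_format] U'(2) assms]
  obtain N0 where "\<forall>N s. N0 \<le> N \<longrightarrow> \<bar>s\<bar> \<le> 1 \<longrightarrow>
    \<bar>integral {-2..2} (\<lambda>t. Phi k (s\<^sup>2 + t\<^sup>2) ^ 1 * cos (N * (s\<^sup>2 + t\<^sup>2)))\<bar> \<le> \<eta>" by (elim exE)
  then show ?thesis
    by (intro exI[of _ N0]) (simp add: lint_def star_def rsq_lpt)
qed

lemma lint_star_sq:
  "\<exists>N0. \<forall>N n1 n2 s. N0 \<le> N \<longrightarrow> n1\<^sup>2 + n2\<^sup>2 = 1 \<longrightarrow> 5/2 \<le> (1 - s\<^sup>2) * 4 ^ k \<longrightarrow>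
     1 / (16 * 4 ^ k) \<le> lint (\<lambda>z. (star k N z)\<^sup>2) n1 n2 s"
proof -
  obtain U' where U': "\<forall>y. ((\<lambda>y. Phi k y ^ 2) has_real_derivative U' y) (at y)" "continuous_on UNIV U'"
    using Phi_power_C1[of k 2] by (elim exE conjE)
  have "0 < 1 / (16 * (4::real) ^ k)" by simp
  from radial_decay[OF U'(1)[rule_format] U'(2) this]
  obtain N0 where N0: "\<forall>N s. N0 \<le> N \<longrightarrow> \<bar>s\<bar> \<le> 1 \<longrightarrow>
    \<bar>integral {-2..2} (\<lambda>t. Phi k (s\<^sup>2 + t\<^sup>2) ^ 2 * cos (N * (s\<^sup>2 + t\<^sup>2)))\<bar> \<le> 1 / (16 * 4 ^ k)" by (elim exE)
  have "1 / (16 * 4 ^ k) \<le> lint (\<lambda>z. (star k N z)\<^sup>2) n1 n2 s"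
    if N: "max 0 N0 \<le> N" and n: "n1\<^sup>2 + n2\<^sup>2 = 1" and s: "5/2 \<le> (1 - s\<^sup>2) * 4 ^ k" for N n1 n2 s
  proof -
    have "0 < (1 - s\<^sup>2) * 4 ^ k" using s by linarith
    then have "s\<^sup>2 < 1" by (simp add: zero_less_mult_iff)
    then have s1: "\<bar>s\<bar> \<le> 1" by (simp add: abs_square_less_1)
    define I1 where "I1 = integral {-2..2} (\<lambda>t. Phi k (s\<^sup>2 + t\<^sup>2) ^ 2)"
    define I2 where "I2 = integral {-2..2} (\<lambda>t. Phi k (s\<^sup>2 + t\<^sup>2) ^ 2 * cos ((2 * N) * (s\<^sup>2 + t\<^sup>2)))"
    have pt: "(star k N (lpt n1 n2 s t))\<^sup>2 = Phi k (s\<^sup>2 + t\<^sup>2) ^ 2 * (1/2) +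
        Phi k (s\<^sup>2 + t\<^sup>2) ^ 2 * cos ((2 * N) * (s\<^sup>2 + t\<^sup>2)) * (1/2)" for t
    proof -
      have "(cos x)\<^sup>2 = 1/2 + cos (2 * x) * (1/2)" for x :: real unfolding cos_double_cos by (simp add: field_simps)
      moreover have "2 * (N * r) = (2 * N) * r" for r by simp
      ultimately have "(cos (N * r))\<^sup>2 = 1/2 + cos ((2 * N) * r) * (1/2)" for r by (simp only:)
      moreover have "p * (1/2 + q * (1/2)) = p * (1/2) + p * q * (1/2)" for p q :: real
        by (simp add: field_simps)
      ultimately show ?thesis unfolding star_def rsq_lpt[OF n] power_mult_distrib by (simp only:)
    qed
    have "((\<lambda>t. (star k N (lpt n1 n2 s t))\<^sup>2) has_integral I1 * (1/2) + I2 * (1/2)) {-2..2}"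
      unfolding pt I1_def I2_def
      by (intro has_integral_add has_integral_mult_left integrable_integral integrable_continuous_interval
          continuous_intros continuous_on_Phi)
    then have L: "lint (\<lambda>z. (star k N z)\<^sup>2) n1 n2 s = I1 / 2 + I2 / 2"
      unfolding lint_def by (simp add: integral_unique)
    \<comment> \<open>The frequency here is \<open>2 * N\<close>, which exceeds \<open>N0\<close>
      because \<open>N\<close> is also nonnegative.\<close>
    have "\<bar>I2\<bar> \<le> 1 / (16 * 4 ^ k)" unfolding I2_def
      by (rule N0[rule_format]) (use N s1 in auto)
    moreover have "1 / (4 * 4 ^ k) \<le> I1" unfolding I1_def by (rule integral_Phi_sq[OF s])
    moreover have "1 / (4 * 4 ^ k) = (1/4) * (1 / (4::real) ^ k)"
      "1 / (16 * 4 ^ k) = (1/16) * (1 / (4::real) ^ k)" "0 < 1 / (4::real) ^ k" by simp_all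
    ultimately show ?thesis unfolding L by linarith
  qed
  then show ?thesis by blast
qed

section \<open>The planar weight\<close>

text \<open>With \<open>r = (1 - s\<^sup>2) * 4 ^ k\<close> measuring how deep the line at distance \<open>s\<close> enters the disc on the scale of
  the \<open>k\<close>-th annulus: \<open>chi k (s\<^sup>2)\<close> rises from 0 to 1 for \<open>r\<close> in \<open>[3, 4]\<close>, \<open>chi_out\<close> for \<open>r\<close> in \<open>[5/2, 3]\<close>
  and \<open>chi_in\<close> for \<open>r\<close> in \<open>[16, 32]\<close>. The line crosses the annulus completely when \<open>r > 2\<close>.\<close>

definition chi :: "nat \<Rightarrow> real \<Rightarrow> real" where "chi k y = step ((1 - y) * 4 ^ k - 3)"
definition chi_out :: "nat \<Rightarrow> real \<Rightarrow> real" where "chi_out k y = step (2 * ((1 - y) * 4 ^ k - 5/2))"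
definition chi_in :: "nat \<Rightarrow> real \<Rightarrow> real" where "chi_in k y = step ((1 - y) * 4 ^ k / 16 - 1)"

lemma pow2_le_wt: "2 ^ k \<le> wt k"
  unfolding wt_def by (intro power_increasing) (auto simp: power2_eq_square)

lemma pow4_le_wt_sq: "4 ^ k \<le> wt k ^ 2"
proof -
  have "(4::real) ^ k = (2\<^sup>2) ^ k" by simp
  also have "\<dots> = (2 ^ k) ^ 2" by (simp only: power_mult[symmetric] mult.commute)
  also have "\<dots> \<le> wt k ^ 2" by (intro power_mono pow2_le_wt) simp
  finally show ?thesis .
qed

text \<open>The annulus \<open>\<kappa>\<close> carries radial oscillations of frequency \<open>N\<close>, which handle the lines near the
  centre, where the angular oscillations of the outer annuli are not felt. The constants are chosen
  in the order \<open>B\<close>, \<open>\<kappa>\<close>, \<open>\<epsilon>\<close>, \<open>N\<close>.\<close>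

locale boman =
  fixes \<kappa> :: nat and \<epsilon> N B :: real
  assumes kappa: "3 \<le> \<kappa>" and eps: "0 < \<epsilon>" "1024 * 4 ^ \<kappa> * \<epsilon> \<le> 1"
    and star_lower: "\<And>n1 n2 s. n1\<^sup>2 + n2\<^sup>2 = 1 \<Longrightarrow> 5/2 \<le> (1 - s\<^sup>2) * 4 ^ \<kappa> \<Longrightarrow>
      1 / (16 * 4 ^ \<kappa>) \<le> lint (\<lambda>z. (star \<kappa> N z)\<^sup>2) n1 n2 s"
    and star_small: "\<And>n1 n2 s. n1\<^sup>2 + n2\<^sup>2 = 1 \<Longrightarrow> \<bar>s\<bar> \<le> 1 \<Longrightarrow>
      \<bar>lint (star \<kappa> N) n1 n2 s\<bar> * (16 * 4 ^ \<kappa> + 64 * 4 ^ \<kappa> * (2 ^ ((\<kappa> + 1) ^ 3) / \<epsilon>)) \<le> 1/8"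
    and ang_lower: "\<And>k n1 n2 s. \<kappa> < k \<Longrightarrow> n1\<^sup>2 + n2\<^sup>2 = 1 \<Longrightarrow> 1/2 \<le> \<bar>s\<bar> \<Longrightarrow> 5/2 \<le> (1 - s\<^sup>2) * 4 ^ k \<Longrightarrow>
      1 / (16 * 4 ^ k) \<le> lint (\<lambda>z. (ang k z)\<^sup>2) n1 n2 s"
    and ang_decay: "\<And>k n1 n2 s. 1 \<le> k \<Longrightarrow> n1\<^sup>2 + n2\<^sup>2 = 1 \<Longrightarrow> 1/2 \<le> \<bar>s\<bar> \<Longrightarrow>
      \<bar>lint (ang k) n1 n2 s\<bar> * wt k ^ 12 \<le> B"
    and B_small: "1024 * B \<le> wt \<kappa>"
begin

definition F :: "nat \<Rightarrow> real \<times> real \<Rightarrow> real" where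
  "F J = (if J = 0 then star \<kappa> N else ang (J + \<kappa>))"

definition c :: "nat \<Rightarrow> real" where
  "c J = (if J = 0 then 1 else \<epsilon> / 2 ^ ((J + \<kappa>) ^ 3))"

definition psi :: "nat \<Rightarrow> real \<Rightarrow> real" where
  "psi J y = (if J = 0 then chi \<kappa> y else chi (J + \<kappa>) y - chi (J + \<kappa> - 1) y)"

text \<open>The functions \<open>psi J\<close> form a partition of unity in the distance. On the support of \<open>psi J\<close> the
  cutoff terms of \<open>Dn J\<close> vanish; elsewhere they keep \<open>Dn J\<close> away from zero.\<close>

definition Dn :: "nat \<Rightarrow> real \<Rightarrow> real \<Rightarrow> real \<Rightarrow> real" where
  "Dn J n1 n2 s = lint (\<lambda>z. (F J z)\<^sup>2) n1 n2 s + (1 - chi_out (J + \<kappa>) (s\<^sup>2)) +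
     (if J = 0 then 0 else chi_in (J + \<kappa>) (s\<^sup>2))"

text \<open>The full correction is \<open>(\<integral> f0) * (\<Sum>K. psi K * F K / (c K * Dn K))\<close>, whose integral against \<open>f0\<close> is
  \<open>\<integral> f0\<close> because the supports of the \<open>F K\<close> are disjoint. Sorting by the summands \<open>c J * F J\<close> of \<open>f0\<close>
  leaves finite inner sums: for \<open>K > J + 1\<close> the lines in the support of \<open>psi K\<close> miss the annulus of \<open>F J\<close>.\<close>

definition V :: "nat \<Rightarrow> real \<times> real \<Rightarrow> real \<Rightarrow> real \<Rightarrow> real \<Rightarrow> real" where
  "V J z n1 n2 s = lint (F J) n1 n2 s *
     (\<Sum>K\<le>J + 1. c J / c K * (psi K (s\<^sup>2) * F K z * inverse (Dn K n1 n2 s)))"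

definition T :: "real \<times> real \<Rightarrow> real \<Rightarrow> real \<Rightarrow> real" where
  "T z n1 n2 = (\<Sum>J. V J z n1 n2 (fst z * n1 + snd z * n2))"

definition f0 :: "real \<times> real \<Rightarrow> real" where "f0 z = (\<Sum>J. c J * F J z)"

section \<open>Supports, and lower bounds for the denominators\<close>

lemma c_pos: "0 < c J" using eps by (simp add: c_def)

lemma F_bound: "\<bar>F J z\<bar> \<le> 1" unfolding F_def using star_bound ang_bound by auto

lemma F_support:
  assumes "F J z \<noteq> 0"
  shows "1 < (1 - rsq z) * 4 ^ (J + \<kappa>)" "(1 - rsq z) * 4 ^ (J + \<kappa>) < 2"
proof -
  have "Phi (J + \<kappa>) (rsq z) \<noteq> 0" using assms by (auto simp: F_def star_def ang_def split: if_splits)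
  then have "\<not> ((1 - rsq z) * 4 ^ (J + \<kappa>) \<le> 1 \<or> 2 \<le> (1 - rsq z) * 4 ^ (J + \<kappa>))"
    using Phi_0 by blast
  then show "1 < (1 - rsq z) * 4 ^ (J + \<kappa>)" "(1 - rsq z) * 4 ^ (J + \<kappa>) < 2" by auto
qed

lemma F_outside: "1 \<le> rsq z \<Longrightarrow> F J z = 0"
  using F_support(1)[of J z] mult_nonpos_nonneg[of "1 - rsq z" "4 ^ (J + \<kappa>)"] by fastforce

lemma F_disjoint_less:
  assumes "J < K" "F J z \<noteq> 0"
  shows "F K z = 0"
proof (rule ccontr)
  assume "F K z \<noteq> 0"
  then have 1: "(1 - rsq z) * 4 ^ (K + \<kappa>) < 2" by (rule F_support)
  have 2: "1 < (1 - rsq z) * 4 ^ (J + \<kappa>)" using assms(2) by (rule F_support)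
  have "0 < 1 - rsq z" using 2 by (smt (verit) mult_nonpos_nonneg zero_le_power)
  moreover have "(4::real) ^ (J + \<kappa> + 1) \<le> 4 ^ (K + \<kappa>)" using assms(1) by (intro power_increasing) auto
  ultimately have "(1 - rsq z) * 4 ^ (J + \<kappa> + 1) \<le> (1 - rsq z) * 4 ^ (K + \<kappa>)"
    by (intro mult_left_mono) auto
  then show False using 1 2 by simp
qed

lemma F_disjoint: "J \<noteq> K \<Longrightarrow> F J z * F K z = 0"
  using F_disjoint_less[of J K z] F_disjoint_less[of K J z] by (cases "J < K") auto

lemma lpt_outside:
  assumes "n1\<^sup>2 + n2\<^sup>2 = 1" "1 \<le> \<bar>s\<bar>"
  shows "1 \<le> rsq (lpt n1 n2 s t)"
proof -
  have "1\<^sup>2 \<le> \<bar>s\<bar>\<^sup>2" using assms(2) by (intro power_mono) auto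
  then show ?thesis unfolding rsq_lpt[OF assms(1)] by (simp add: add_increasing2)
qed

lemma lint_outside: "n1\<^sup>2 + n2\<^sup>2 = 1 \<Longrightarrow> 1 \<le> \<bar>s\<bar> \<Longrightarrow> lint (F J) n1 n2 s = 0"
  unfolding lint_def by (simp add: F_outside lpt_outside)

lemma continuous_F: "continuous_on A (F J)"
proof (cases "J = 0")
  case True
  then show ?thesis using continuous_on_subset[OF Cinf_cont[OF smooth1_star]] by (simp add: F_def)
next
  case False
  then show ?thesis using continuous_on_subset[OF Cinf_cont[OF Cinf_ang]] by (simp add: F_def)
qed

lemma continuous_lpt: "continuous_on A (lpt n1 n2 s)"
  unfolding lpt_def[abs_def] by (intro continuous_intros)

lemma continuous_F_lpt: "continuous_on A (\<lambda>t. F J (lpt n1 n2 s t))"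
  by (rule continuous_on_compose2[OF continuous_F[of UNIV] continuous_lpt]) auto

lemma lint_F_bound: "\<bar>lint (F J) n1 n2 s\<bar> \<le> 4"
proof -
  have "norm (integral {-2..2} (\<lambda>t. F J (lpt n1 n2 s t))) \<le> 1 * (2 - (-2))"
    by (rule integral_bound[OF _ continuous_F_lpt]) (use F_bound in auto)
  then show ?thesis by (simp add: lint_def)
qed

lemma chi_bounds: "0 \<le> chi k y" "chi k y \<le> 1"
  unfolding chi_def using step_bounds by auto

lemma psi_abs: "\<bar>psi J y\<bar> \<le> 1"
  unfolding psi_def using chi_bounds[of "J + \<kappa>" y] chi_bounds[of "J + \<kappa> - 1" y] chi_bounds[of \<kappa> y] by auto

lemma four_pow_shift: "1 \<le> J \<Longrightarrow> (4::real) ^ (J + \<kappa>) = 4 * 4 ^ (J + \<kappa> - 1)"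
  by (cases J) auto

text \<open>The bound 16 is 4 times the depth 4 at which the preceding \<open>chi\<close> reaches 1.
  Between 3 and 16 \<open>chi_out\<close> is already 1 and \<open>chi_in\<close> still 0, as
  \<open>Dn_eq\<close> needs.\<close>

lemma psi_support:
  assumes "psi J y \<noteq> 0"
  shows "3 < (1 - y) * 4 ^ (J + \<kappa>)" and "1 \<le> J \<Longrightarrow> (1 - y) * 4 ^ (J + \<kappa>) < 16"
proof -
  define r where "r = (1 - y) * 4 ^ (J + \<kappa> - 1)"
  have 4: "(1 - y) * 4 ^ (J + \<kappa>) = 4 * r" if "1 \<le> J"
    using four_pow_shift[OF that] by (simp add: r_def)
  show "3 < (1 - y) * 4 ^ (J + \<kappa>)"
  proof (rule ccontr)
    assume *: "\<not> 3 < (1 - y) * 4 ^ (J + \<kappa>)"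
    then have "chi (J + \<kappa>) y = 0" unfolding chi_def by (intro step_0) simp
    moreover have "chi (J + \<kappa> - 1) y = 0" if "1 \<le> J"
      using 4[OF that] * unfolding chi_def r_def[symmetric] by (intro step_0) simp
    ultimately show False using assms by (auto simp: psi_def split: if_splits)
  qed
  show "(1 - y) * 4 ^ (J + \<kappa>) < 16" if J: "1 \<le> J"
  proof (rule ccontr)
    assume *: "\<not> (1 - y) * 4 ^ (J + \<kappa>) < 16"
    then have "chi (J + \<kappa>) y = 1" unfolding chi_def by (intro step_1) simp
    moreover have "chi (J + \<kappa> - 1) y = 1"
      using 4[OF J] * unfolding chi_def r_def[symmetric] by (intro step_1) simp
    ultimately show False using assms J by (auto simp: psi_def)
  qed
qed

lemma four_pow_ge: "1 \<le> J \<Longrightarrow> 256 \<le> (4::real) ^ (J + \<kappa>)"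
proof -
  assume "1 \<le> J"
  then have "(4::real) ^ 4 \<le> 4 ^ (J + \<kappa>)" using kappa by (intro power_increasing) auto
  then show ?thesis by simp
qed

text \<open>This uses \<open>3 \<le> \<kappa>\<close>: for \<bar>s\<bar> < 1/2 the depth is at least
  3/4 * 256, beyond the value 32 where \<open>chi_in\<close> has become 1. The estimates for angular
  oscillations are therefore called only for \<bar>s\<bar> \<ge> 1/2.\<close>

lemma near_boundary:
  assumes "1 \<le> J" "(1 - s\<^sup>2) * 4 ^ (J + \<kappa>) < (32::real)"
  shows "1/2 \<le> \<bar>s\<bar>"
proof (rule ccontr)
  assume "\<not> 1/2 \<le> \<bar>s\<bar>"
  then have "\<bar>s\<bar>\<^sup>2 \<le> (1/2)\<^sup>2" by (intro power_mono) auto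
  then have "3/4 \<le> 1 - s\<^sup>2" by (simp add: power2_eq_square)
  then have "3/4 * 256 \<le> (1 - s\<^sup>2) * 4 ^ (J + \<kappa>)" using four_pow_ge[OF assms(1)] by (intro mult_mono) auto
  then show False using assms(2) by simp
qed

lemma lint_sq_nonneg: "0 \<le> lint (\<lambda>z. (F J z)\<^sup>2) n1 n2 s"
  unfolding lint_def by (intro integral_nonneg integrable_continuous_interval continuous_intros continuous_F_lpt) simp

lemma Dn_lower:
  assumes n: "n1\<^sup>2 + n2\<^sup>2 = 1"
  shows "1 / (16 * 4 ^ (J + \<kappa>)) \<le> Dn J n1 n2 s"
proof -
  define y where "y = (1 - s\<^sup>2) * 4 ^ (J + \<kappa>)"
  have "(1::real) \<le> 4 ^ (J + \<kappa>)" by simp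
  then have "(1::real) \<le> 16 * 4 ^ (J + \<kappa>)" by linarith
  then have one: "1 / (16 * (4::real) ^ (J + \<kappa>)) \<le> 1" by simp
  have nn: "0 \<le> 1 - chi_out (J + \<kappa>) (s\<^sup>2)" "0 \<le> (if J = 0 then 0 else chi_in (J + \<kappa>) (s\<^sup>2))"
    using step_bounds by (auto simp: chi_out_def chi_in_def)
  \<comment> \<open>Below 5/2 the term with \<open>chi_out\<close> is 1, from 32 on
    \<open>chi_in\<close> is 1. In between the line crosses the annulus completely and the integral
    of the square is large enough.\<close>
  consider "y < 5/2" | "5/2 \<le> y" "J = 0" | "5/2 \<le> y" "1 \<le> J" "y < 32" | "1 \<le> J" "32 \<le> y" by linarith
  then show ?thesis
  proof cases
    case 1
    then have "chi_out (J + \<kappa>) (s\<^sup>2) = 0" unfolding chi_out_def y_def by (intro step_0) simp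
    then show ?thesis using one nn(2) lint_sq_nonneg[of J n1 n2 s] unfolding Dn_def by linarith
  next
    case 2
    then have "1 / (16 * 4 ^ (J + \<kappa>)) \<le> lint (\<lambda>z. (F J z)\<^sup>2) n1 n2 s"
      using star_lower[OF n] by (simp add: F_def y_def)
    then show ?thesis using nn unfolding Dn_def by linarith
  next
    case 3
    then have "1 / (16 * 4 ^ (J + \<kappa>)) \<le> lint (\<lambda>z. (F J z)\<^sup>2) n1 n2 s"
      using ang_lower[of "J + \<kappa>", OF _ n near_boundary[of J s]] by (simp add: F_def y_def)
    then show ?thesis using nn unfolding Dn_def by linarith
  next
    case 4
    then have "chi_in (J + \<kappa>) (s\<^sup>2) = 1" unfolding chi_in_def y_def by (intro step_1) simp
    then have "Dn J n1 n2 s = lint (\<lambda>z. (F J z)\<^sup>2) n1 n2 s + (1 - chi_out (J + \<kappa>) (s\<^sup>2)) + 1"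
      using 4 by (simp add: Dn_def)
    then show ?thesis using one nn(1) lint_sq_nonneg[of J n1 n2 s] by linarith
  qed
qed

lemma Dn_pos: "n1\<^sup>2 + n2\<^sup>2 = 1 \<Longrightarrow> 0 < Dn J n1 n2 s"
  using Dn_lower[of n1 n2 J s] by (smt (verit) zero_less_divide_1_iff zero_less_mult_iff zero_less_power)

lemma Dn_eq:
  assumes "psi J (s\<^sup>2) \<noteq> 0"
  shows "Dn J n1 n2 s = lint (\<lambda>z. (F J z)\<^sup>2) n1 n2 s"
proof -
  have "chi_out (J + \<kappa>) (s\<^sup>2) = 1"
    unfolding chi_out_def using psi_support(1)[OF assms] by (intro step_1) simp
  moreover have "chi_in (J + \<kappa>) (s\<^sup>2) = 0" if "1 \<le> J"
    unfolding chi_in_def using psi_support(2)[OF assms that] by (intro step_0) simp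
  ultimately show ?thesis by (simp add: Dn_def)
qed

lemma inverse_Dn: "n1\<^sup>2 + n2\<^sup>2 = 1 \<Longrightarrow> \<bar>inverse (Dn J n1 n2 s)\<bar> \<le> 16 * 4 ^ (J + \<kappa>)"
proof -
  assume n: "n1\<^sup>2 + n2\<^sup>2 = 1"
  have p: "0 < 1 / (16 * (4::real) ^ (J + \<kappa>))" by simp
  have "inverse (Dn J n1 n2 s) \<le> inverse (1 / (16 * 4 ^ (J + \<kappa>)))"
    by (rule le_imp_inverse_le[OF Dn_lower[OF n] p])
  then show ?thesis using Dn_pos[OF n, of J s] by simp
qed

section \<open>Size of the correction\<close>

definition piece :: "nat \<Rightarrow> nat \<Rightarrow> real \<times> real \<Rightarrow> real \<Rightarrow> real \<Rightarrow> real \<Rightarrow> real" where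
  "piece J K z n1 n2 s = c J / c K * (psi K (s\<^sup>2) * F K z * inverse (Dn K n1 n2 s)) * lint (F J) n1 n2 s"

lemma V_pieces: "V J z n1 n2 s = (\<Sum>K\<le>J + 1. piece J K z n1 n2 s)"
  unfolding V_def piece_def sum_distrib_left by (intro sum.cong refl) (simp only: mult_ac)

lemma piece_bound:
  assumes n: "n1\<^sup>2 + n2\<^sup>2 = 1"
  shows "\<bar>piece J K z n1 n2 s\<bar> \<le> c J / c K * (16 * 4 ^ (K + \<kappa>)) * \<bar>lint (F J) n1 n2 s\<bar>"
proof -
  have "\<bar>psi K (s\<^sup>2)\<bar> * \<bar>F K z\<bar> * \<bar>inverse (Dn K n1 n2 s)\<bar> \<le> 1 * 1 * (16 * 4 ^ (K + \<kappa>))"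
    by (intro mult_mono psi_abs F_bound inverse_Dn n) auto
  then have "c J / c K * (\<bar>psi K (s\<^sup>2)\<bar> * \<bar>F K z\<bar> * \<bar>inverse (Dn K n1 n2 s)\<bar>) * \<bar>lint (F J) n1 n2 s\<bar>
      \<le> c J / c K * (16 * 4 ^ (K + \<kappa>)) * \<bar>lint (F J) n1 n2 s\<bar>"
    using c_pos[of J] c_pos[of K] by (intro mult_right_mono mult_left_mono) auto
  then show ?thesis using c_pos[of J] c_pos[of K] by (simp add: piece_def abs_mult)
qed

text \<open>The two summands are \<open>K = 0\<close> and \<open>K = 1\<close>, and the second
  divides by the small number \<open>c 1\<close>. This is the origin of the bracket in
  \<open>star_small\<close>, and the reason why \<open>N\<close> is chosen after
  \<open>\<epsilon>\<close>.\<close>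

lemma V0_bound:
  assumes n: "n1\<^sup>2 + n2\<^sup>2 = 1"
  shows "\<bar>V 0 z n1 n2 s\<bar> \<le> 1/8"
proof (cases "\<bar>s\<bar> \<le> 1")
  case True
  have "V 0 z n1 n2 s = piece 0 0 z n1 n2 s + piece 0 1 z n1 n2 s" by (simp add: V_pieces)
  then have "\<bar>V 0 z n1 n2 s\<bar> \<le> \<bar>piece 0 0 z n1 n2 s\<bar> + \<bar>piece 0 1 z n1 n2 s\<bar>" by simp
  also have "\<dots> \<le> 16 * 4 ^ \<kappa> * \<bar>lint (F 0) n1 n2 s\<bar> + c 0 / c 1 * (16 * 4 ^ (1 + \<kappa>)) * \<bar>lint (F 0) n1 n2 s\<bar>"
    using piece_bound[OF n, of 0 0 z s] piece_bound[OF n, of 0 1 z s] c_pos[of 0] by (intro add_mono) auto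
  also have "c 0 / c 1 * (16 * 4 ^ (1 + \<kappa>)) = 64 * 4 ^ \<kappa> * (2 ^ ((\<kappa> + 1) ^ 3) / \<epsilon>)"
    by (simp add: c_def)
  also have "16 * 4 ^ \<kappa> * \<bar>lint (F 0) n1 n2 s\<bar> + 64 * 4 ^ \<kappa> * (2 ^ ((\<kappa> + 1) ^ 3) / \<epsilon>) * \<bar>lint (F 0) n1 n2 s\<bar>
    = \<bar>lint (F 0) n1 n2 s\<bar> * (16 * 4 ^ \<kappa> + 64 * 4 ^ \<kappa> * (2 ^ ((\<kappa> + 1) ^ 3) / \<epsilon>))" by (simp add: distrib_left)
  also have "\<dots> \<le> 1/8" using star_small[OF n True] by (simp add: F_def)
  finally show ?thesis .
next
  case False
  then show ?thesis using lint_outside[OF n, of s 0] by (simp add: V_def)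
qed

lemma wt_Suc: "1 \<le> j \<Longrightarrow> wt (j + 1) \<le> wt j ^ 4"
proof -
  assume "1 \<le> j"
  then have "(j + 1)\<^sup>2 \<le> j\<^sup>2 * 4" using power_mono[of "j + 1" "2 * j" 2] by (simp add: power_mult_distrib mult.commute)
  then show ?thesis unfolding wt_def power_mult[symmetric] by (intro power_increasing) auto
qed


text \<open>The increment of the cube is quadratic: (j + 1)^3 \<le> j^3 + 7 j^2, and j^2 is the
  exponent of \<open>wt j\<close>.\<close>

lemma c_ratio:
  assumes J: "1 \<le> J" and K: "1 \<le> K" "K \<le> J + 1"
  shows "c J / c K \<le> wt (J + \<kappa>) ^ 7"
proof -
  define j where "j = J + \<kappa>"
  have j: "1 \<le> j" using J by (simp add: j_def)
  have "(K + \<kappa>) ^ 3 \<le> (j + 1) ^ 3" using K by (intro power_mono) (auto simp: j_def)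
  also have "(j + 1) ^ 3 = j ^ 3 + 3 * j\<^sup>2 + 3 * j + 1" by (simp add: power2_eq_square power3_eq_cube algebra_simps)
  also have "\<dots> \<le> j ^ 3 + j\<^sup>2 * 7" using j self_le_power[of j 2] one_le_power[of j 2] by simp
  finally have "(2::real) ^ ((K + \<kappa>) ^ 3) \<le> 2 ^ (j ^ 3 + j\<^sup>2 * 7)" by (intro power_increasing) auto
  also have "\<dots> = 2 ^ (j ^ 3) * wt j ^ 7" by (simp add: wt_def power_add power_mult)
  finally have "(2::real) ^ ((K + \<kappa>) ^ 3) / 2 ^ (j ^ 3) \<le> wt j ^ 7" by (simp add: field_simps)
  moreover have "c J / c K = 2 ^ ((K + \<kappa>) ^ 3) / 2 ^ (j ^ 3)" using J K eps by (simp add: c_def j_def)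
  ultimately show ?thesis by (simp add: j_def)
qed

text \<open>For \<bar>s\<bar> < 1/2 all \<open>psi K\<close> with \<open>K \<ge> 1\<close> vanish.
  Otherwise the ten powers are seven from \<open>c_ratio\<close>, two from the reciprocal of
  \<open>Dn\<close> and one for the number of summands.\<close>

lemma pieces_bound:
  assumes n: "n1\<^sup>2 + n2\<^sup>2 = 1" and J: "1 \<le> J"
  shows "\<bar>\<Sum>K\<in>{1..J + 1}. piece J K z n1 n2 s\<bar> \<le>
    (if 1/2 \<le> \<bar>s\<bar> then 64 * wt (J + \<kappa>) ^ 10 * \<bar>lint (F J) n1 n2 s\<bar> else 0)"
proof (cases "1/2 \<le> \<bar>s\<bar>")
  case False
  have "piece J K z n1 n2 s = 0" if "K \<in> {1..J + 1}" for K
  proof -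
    have "psi K (s\<^sup>2) = 0"
      using psi_support(2)[of K "s\<^sup>2"] near_boundary[of K s] that False by force
    then show ?thesis by (simp add: piece_def)
  qed
  then show ?thesis using False by simp
next
  case True
  define w where "w = wt (J + \<kappa>)"
  have w: "1 \<le> w" by (simp add: w_def wt_ge1)
  have w4: "4 ^ (J + \<kappa>) \<le> w ^ 2" unfolding w_def by (rule pow4_le_wt_sq)
  have wJ: "real (J + 1) \<le> w"
  proof -
    have "J + 1 \<le> 2 ^ J" by (induction J) auto
    then have "real (J + 1) \<le> 2 ^ J" by (metis of_nat_le_iff of_nat_numeral of_nat_power)
    also have "\<dots> \<le> 2 ^ (J + \<kappa>)" by (intro power_increasing) auto
    also have "\<dots> \<le> w" unfolding w_def by (rule pow2_le_wt)
    finally show ?thesis .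
  qed
  define L where "L = \<bar>lint (F J) n1 n2 s\<bar>"
  have L: "0 \<le> L" by (simp add: L_def)
  have "\<bar>piece J K z n1 n2 s\<bar> \<le> 64 * w ^ 9 * L" if K: "K \<in> {1..J + 1}" for K
  proof -
    have "(4::real) ^ (K + \<kappa>) \<le> 4 ^ (J + \<kappa> + 1)" using K by (intro power_increasing) auto
    also have "\<dots> \<le> 4 * w ^ 2" using w4 by simp
    finally have k4: "16 * 4 ^ (K + \<kappa>) \<le> 64 * w ^ 2" by simp
    have "c J / c K * (16 * 4 ^ (K + \<kappa>)) \<le> w ^ 7 * (64 * w ^ 2)"
    proof (rule mult_mono[OF _ k4])
      show "c J / c K \<le> w ^ 7" using c_ratio[OF J] K unfolding w_def by simp
    qed (use w in auto)
    then have "c J / c K * (16 * 4 ^ (K + \<kappa>)) * L \<le> w ^ 7 * (64 * w ^ 2) * L"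
      using L by (rule mult_right_mono)
    also have "w ^ 7 * (64 * w ^ 2) = 64 * w ^ 9" by simp
    finally show ?thesis using piece_bound[OF n, of J K z s] unfolding L_def by linarith
  qed
  then have "\<bar>\<Sum>K\<in>{1..J + 1}. piece J K z n1 n2 s\<bar> \<le> (\<Sum>K\<in>{1..J + 1}. 64 * w ^ 9 * L)"
    by (intro order_trans[OF sum_abs sum_mono]) auto
  also have "\<dots> = real (J + 1) * (64 * w ^ 9 * L)" by simp
  also have "\<dots> \<le> w * (64 * w ^ 9 * L)" using wJ w L by (intro mult_right_mono) auto
  also have "\<dots> = 64 * w ^ 10 * L" by (simp add: power_Suc[symmetric] del: power_Suc flip: mult.assoc)
  finally show ?thesis using True by (simp add: L_def w_def)
qed

text \<open>The summand \<open>K = 0\<close> can be present for lines near the centre, where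
  \<open>lint (F J)\<close> has only the trivial bound 4; it is small because of the factor
  \<open>c J\<close>, which \<open>c 0 = 1\<close> leaves intact.\<close>

lemma V_split:
  assumes n: "n1\<^sup>2 + n2\<^sup>2 = 1" and J: "1 \<le> J"
  shows "\<bar>V J z n1 n2 s\<bar> \<le> 64 * 4 ^ \<kappa> * c J +
    (if 1/2 \<le> \<bar>s\<bar> then 64 * wt (J + \<kappa>) ^ 10 * \<bar>lint (F J) n1 n2 s\<bar> else 0)"
proof -
  have "{..J + 1} = insert 0 {1..J + 1}" by auto
  then have "V J z n1 n2 s = piece J 0 z n1 n2 s + (\<Sum>K\<in>{1..J + 1}. piece J K z n1 n2 s)"
    unfolding V_pieces by simp
  moreover have "\<bar>piece J 0 z n1 n2 s\<bar> \<le> 64 * 4 ^ \<kappa> * c J"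
  proof -
    have "\<bar>piece J 0 z n1 n2 s\<bar> \<le> c J * (16 * 4 ^ \<kappa>) * \<bar>lint (F J) n1 n2 s\<bar>"
      using piece_bound[OF n, of J 0 z s] by (simp add: c_def[of 0])
    also have "\<dots> \<le> c J * (16 * 4 ^ \<kappa>) * 4"
      using c_pos[of J] by (intro mult_left_mono lint_F_bound) auto
    also have "\<dots> = 64 * 4 ^ \<kappa> * c J" by simp
    finally show ?thesis .
  qed
  ultimately show ?thesis using pieces_bound[OF n J, of z s] by linarith
qed

lemma wt_ge_pow: "2 ^ J \<le> wt (J + \<kappa>)" "wt \<kappa> \<le> wt (J + \<kappa>)"
proof -
  have "(2::real) ^ J \<le> 2 ^ (J + \<kappa>)" by (intro power_increasing) auto
  then show "2 ^ J \<le> wt (J + \<kappa>)" using pow2_le_wt by (rule order_trans)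
  show "wt \<kappa> \<le> wt (J + \<kappa>)" unfolding wt_def by (intro power_increasing power_mono) auto
qed

text \<open>Each half of \<open>V_split\<close> gets 1/16 * 2^(-J). For the second, ten of the
  twelve powers in \<open>ang_decay\<close> cover the loss in \<open>pieces_bound\<close>, one
  absorbs \<open>1024 * B\<close>, and one supplies 2^(-J).\<close>

lemma V_bound:
  assumes n: "n1\<^sup>2 + n2\<^sup>2 = 1"
  shows "\<bar>V J z n1 n2 s\<bar> \<le> 1/8 * (1/2) ^ J"
proof (cases "J = 0")
  case True
  then show ?thesis using V0_bound[OF n] by simp
next
  case False
  then have J: "1 \<le> J" by simp
  have p2: "(0::real) < 2 ^ J" by simp
  have h: "(1/2 :: real) ^ J = 1 / 2 ^ J" by (simp add: power_one_over)
  have "c J \<le> \<epsilon> / 2 ^ J"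
  proof -
    have "J * 1 \<le> (J + \<kappa>) * (J + \<kappa>) ^ 2" using J by (intro mult_le_mono) auto
    then have "(2::real) ^ J \<le> 2 ^ ((J + \<kappa>) ^ 3)"
      by (intro power_increasing) (auto simp: power3_eq_cube power2_eq_square)
    then show ?thesis using J eps by (simp add: c_def frac_le)
  qed
  then have "64 * 4 ^ \<kappa> * c J \<le> 64 * 4 ^ \<kappa> * (\<epsilon> / 2 ^ J)" by (intro mult_left_mono) auto
  also have "\<dots> = (1024 * 4 ^ \<kappa> * \<epsilon>) * (1/16 / 2 ^ J)" by simp
  also have "\<dots> \<le> 1 * (1/16 / 2 ^ J)" using eps by (intro mult_right_mono) auto
  finally have 1: "64 * 4 ^ \<kappa> * c J \<le> 1/16 / 2 ^ J" by simp
  define w where "w = wt (J + \<kappa>)"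
  have w: "1 \<le> w" "2 ^ J \<le> w" "wt \<kappa> \<le> w" using wt_ge_pow[of J] by (simp_all add: w_def wt_ge1)
  have 2: "(if 1/2 \<le> \<bar>s\<bar> then 64 * w ^ 10 * \<bar>lint (F J) n1 n2 s\<bar> else 0) \<le> 1/16 / 2 ^ J"
  proof (cases "1/2 \<le> \<bar>s\<bar>")
    case True
    define L where "L = \<bar>lint (F J) n1 n2 s\<bar>"
    have "L * w ^ 12 \<le> B" using ang_decay[of "J + \<kappa>", OF _ n True] J by (simp add: L_def F_def w_def)
    then have "1024 * (L * w ^ 12) \<le> w" using B_small w(3) by linarith
    moreover have "L * w ^ 12 = (L * w ^ 10 * w) * w" by (simp add: power_Suc[symmetric] del: power_Suc flip: mult.assoc) (simp add: eval_nat_numeral)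
    ultimately have "(1024 * (L * w ^ 10 * w)) * w \<le> 1 * w" by simp
    then have "1024 * (L * w ^ 10 * w) \<le> 1" using w(1) by (simp only: mult_le_cancel_right_pos)
    moreover have "L * w ^ 10 * 2 ^ J \<le> L * w ^ 10 * w" using w by (intro mult_left_mono) (auto simp: L_def)
    ultimately have "64 * w ^ 10 * L * 2 ^ J \<le> 1/16" by (simp add: mult_ac)
    then have "64 * w ^ 10 * L \<le> 1/16 / 2 ^ J" by (simp only: pos_le_divide_eq[OF p2])
    then show ?thesis using True by (simp add: L_def)
  qed simp
  show ?thesis using V_split[OF n J, of z s] 1 2 unfolding h w_def by simp
qed

lemma T_bound:
  assumes n: "n1\<^sup>2 + n2\<^sup>2 = 1"
  shows "\<bar>T z n1 n2\<bar> \<le> 1/4"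
proof -
  define s where "s = fst z * n1 + snd z * n2"
  have g: "(\<lambda>J. 1/8 * (1/2::real) ^ J) sums (1/8 * (1 / (1 - 1/2)))"
    by (intro sums_mult geometric_sums) simp
  have "norm (\<Sum>J. V J z n1 n2 s) \<le> (\<Sum>J. 1/8 * (1/2) ^ J)"
    by (rule norm_suminf_le[OF _ sums_summable[OF g]]) (unfold real_norm_def, rule V_bound[OF n])
  also have "\<dots> = 1/4" using sums_unique[OF g] by simp
  finally show ?thesis by (simp add: T_def s_def)
qed

text \<open>The cube in the exponent of \<open>c\<close> beats every multiple of the square in that
  of \<open>wt\<close>; the finitely many j < 4 M are absorbed by the constant.\<close>

lemma c_negl: "\<exists>C. \<forall>J. c J * wt (J + \<kappa> + 1) ^ M \<le> C"
proof -
  have "c J * wt (J + \<kappa> + 1) ^ M \<le> wt (\<kappa> + 1) ^ M + \<epsilon> * 2 ^ (64 * M ^ 3)" for J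
  proof (cases "J = 0")
    case True
    then show ?thesis using eps by (simp add: c_def)
  next
    case False
    define j where "j = J + \<kappa>"
    have j: "1 \<le> j" using False by (simp add: j_def)
    have "4 * j\<^sup>2 * M \<le> j ^ 3 + 64 * M ^ 3"
    proof (cases "4 * M \<le> j")
      case True
      have "4 * j\<^sup>2 * M = j\<^sup>2 * (4 * M)" by simp
      also have "\<dots> \<le> j\<^sup>2 * j" using True by (intro mult_le_mono) auto
      also have "\<dots> = j ^ 3" by (simp add: power2_eq_square power3_eq_cube)
      finally show ?thesis by simp
    next
      case False
      then have "j\<^sup>2 \<le> (4 * M)\<^sup>2" by (intro power_mono) auto
      then have "4 * j\<^sup>2 * M \<le> 4 * (4 * M)\<^sup>2 * M" by (intro mult_le_mono) auto
      also have "\<dots> = 64 * M ^ 3" by (simp add: power2_eq_square power3_eq_cube)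
      finally show ?thesis by (rule trans_le_add2)
    qed
    then have "(2::real) ^ (j\<^sup>2 * (4 * M)) \<le> 2 ^ (j ^ 3 + 64 * M ^ 3)" by (intro power_increasing) (auto simp: mult_ac)
    then have *: "wt j ^ (4 * M) \<le> 2 ^ (j ^ 3) * 2 ^ (64 * M ^ 3)" by (simp add: wt_def power_add power_mult)
    have "wt (j + 1) ^ M \<le> (wt j ^ 4) ^ M" using wt_Suc[OF j] wt_ge1[of "j + 1"] by (intro power_mono) auto
    then have "wt (j + 1) ^ M \<le> 2 ^ (j ^ 3) * 2 ^ (64 * M ^ 3)" using * by (simp add: power_mult)
    then have "\<epsilon> / 2 ^ (j ^ 3) * wt (j + 1) ^ M \<le> \<epsilon> / 2 ^ (j ^ 3) * (2 ^ (j ^ 3) * 2 ^ (64 * M ^ 3))"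
      using eps by (intro mult_left_mono) auto
    then have "c J * wt (J + \<kappa> + 1) ^ M \<le> \<epsilon> * 2 ^ (64 * M ^ 3)" using False by (simp add: c_def j_def)
    moreover have "0 \<le> wt (\<kappa> + 1) ^ M" using wt_ge1[of "\<kappa> + 1"] by simp
    ultimately show ?thesis by linarith
  qed
  then show ?thesis by blast
qed

text \<open>The weight belongs to the largest inner index \<open>K = J + 1\<close>, for which all
  summands of \<open>V J\<close> are moderate.\<close>

lemma V_negl: "\<exists>C. \<forall>J z n1 n2 s. n1\<^sup>2 + n2\<^sup>2 = 1 \<longrightarrow> \<bar>V J z n1 n2 s\<bar> * wt (J + \<kappa> + 1) ^ M \<le> C"
proof -
  obtain C1 where C1: "\<forall>J. c J * wt (J + \<kappa> + 1) ^ M \<le> C1" using c_negl by blast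
  \<comment> \<open>Ten powers are lost in \<open>pieces_bound\<close>, and \<open>4 * M\<close> in
    passing from \<open>j + 1\<close> to \<open>j\<close> by \<open>wt_Suc\<close>.\<close>
  obtain C2 where C2: "0 \<le> C2" "\<forall>k n1 n2 s. 1 \<le> k \<longrightarrow> n1\<^sup>2 + n2\<^sup>2 = 1 \<longrightarrow> 1/2 \<le> \<bar>s\<bar> \<longrightarrow>
    \<bar>lint (ang k) n1 n2 s\<bar> * wt k ^ (10 + 4 * M) \<le> C2" using lint_ang_negl by blast
  define C where "C = max (1/8 * wt (\<kappa> + 1) ^ M) (64 * 4 ^ \<kappa> * C1 + 64 * C2)"
  have "\<bar>V J z n1 n2 s\<bar> * wt (J + \<kappa> + 1) ^ M \<le> C" if n: "n1\<^sup>2 + n2\<^sup>2 = 1" for J z n1 n2 s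
  proof (cases "J = 0")
    case True
    have "\<bar>V 0 z n1 n2 s\<bar> * wt (\<kappa> + 1) ^ M \<le> 1/8 * wt (\<kappa> + 1) ^ M"
      using V0_bound[OF n] wt_ge1[of "\<kappa> + 1"] by (intro mult_right_mono) auto
    then show ?thesis using True unfolding C_def by simp
  next
    case False
    then have J: "1 \<le> J" by simp
    define j where "j = J + \<kappa>"
    have j: "1 \<le> j" using J by (simp add: j_def)
    define R where "R = (if 1/2 \<le> \<bar>s\<bar> then 64 * wt j ^ 10 * \<bar>lint (F J) n1 n2 s\<bar> else 0)"
    have w: "0 \<le> wt (j + 1) ^ M" using wt_ge1[of "j + 1"] by simp
    have "\<bar>V J z n1 n2 s\<bar> * wt (j + 1) ^ M \<le> (64 * 4 ^ \<kappa> * c J + R) * wt (j + 1) ^ M"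
      using V_split[OF n J, of z s] w unfolding R_def j_def by (intro mult_right_mono) auto
    also have "\<dots> = 64 * 4 ^ \<kappa> * (c J * wt (j + 1) ^ M) + R * wt (j + 1) ^ M" by (simp add: distrib_right)
    also have "64 * 4 ^ \<kappa> * (c J * wt (j + 1) ^ M) \<le> 64 * 4 ^ \<kappa> * C1"
      using C1 by (intro mult_left_mono) (auto simp: j_def)
    also have "R * wt (j + 1) ^ M \<le> 64 * C2"
    proof (cases "1/2 \<le> \<bar>s\<bar>")
      case True
      have "wt (j + 1) ^ M \<le> (wt j ^ 4) ^ M" using wt_Suc[OF j] wt_ge1[of "j + 1"] by (intro power_mono) auto
      then have "R * wt (j + 1) ^ M \<le> R * (wt j ^ 4) ^ M" using wt_ge1[of j]
        by (intro mult_left_mono) (auto simp: R_def)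
      also have "\<dots> = 64 * (\<bar>lint (ang j) n1 n2 s\<bar> * wt j ^ (10 + 4 * M))"
        using True J by (simp add: R_def F_def j_def power_add power_mult)
      also have "\<dots> \<le> 64 * C2" using C2(2)[rule_format, OF j n True] by simp
      finally show ?thesis .
    next
      case False
      then show ?thesis using C2(1) by (simp add: R_def)
    qed
    finally show ?thesis unfolding C_def j_def by simp
  qed
  then show ?thesis by blast
qed

end

section \<open>Smoothness of the planar function and of its correction\<close>

lemma Cm_fst:
  fixes u :: "'i \<Rightarrow> 'a::euclidean_space \<Rightarrow> real"
  shows "Cm w S n u \<Longrightarrow> Cm w (S \<times> (UNIV :: real set)) n (\<lambda>i q. u i (fst q))"
proof (induction n arbitrary: u)
  have l: "lmod w (S \<times> (UNIV :: real set)) (\<lambda>i q. u i (fst q))" if u: "lmod w S u" for u :: "'i \<Rightarrow> 'a \<Rightarrow> real"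
    unfolding lmod_def
  proof (intro conjI allI impI)
    show "1 \<le> w i" for i by (rule lmod_w[OF u])
    show "continuous_on (S \<times> (UNIV :: real set)) (\<lambda>q. u i (fst q))" for i
      by (rule continuous_on_compose2[OF lmod_cont[OF u] continuous_on_fst[OF continuous_on_id]]) auto
    fix K :: "('a \<times> real) set" assume K: "compact K" "K \<subseteq> S \<times> UNIV"
    have "compact (fst ` K)" by (intro compact_continuous_image K continuous_intros)
    moreover have "fst ` K \<subseteq> S" using K(2) by auto
    ultimately have "modb w (fst ` K) u" by (rule lmod_modb[OF u])
    then show "modb w K (\<lambda>i q. u i (fst q))" unfolding modb_def by simp
  qed
  {
    case 0
    then show ?case using l by simp
  next
    case (Suc n)
    have w: "1 \<le> w i" for i by (rule lmod_w[OF Cm_lmod[OF Suc.prems]])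
    have 2: "\<exists>v. pder (S \<times> UNIV) b (\<lambda>i q. u i (fst q)) v \<and> Cm w (S \<times> UNIV) n v"
      if b: "b \<in> Basis" for b :: "'a \<times> real"
    proof -
      consider b1 where "b = (b1, 0)" "b1 \<in> Basis" | "b = (0, 1)"
      proof -
        have "(\<exists>b1\<in>Basis. b = (b1, 0)) \<or> b = (0, 1)"
          using b by (auto simp: Basis_prod_def)
        then show thesis using that by blast
      qed
      then show ?thesis
      proof cases
        case 1
        have "\<exists>v. pder S b1 u v \<and> Cm w S n v" using Suc.prems 1(2) by simp
        then obtain v where v: "pder S b1 u v" "Cm w S n v" by blast
        have "pder (S \<times> UNIV) b (\<lambda>i q. u i (fst q)) (\<lambda>i q. v i (fst q))"
          using v(1) unfolding pder_def 1(1) by auto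
        with Suc.IH[OF v(2)] show ?thesis by blast
      next
        case 2
        have "pder (S \<times> UNIV) b (\<lambda>i q. u i (fst q)) (\<lambda>i q. 0)"
          unfolding pder_def 2 by auto
        moreover have "Cm w (S \<times> (UNIV :: real set)) n (\<lambda>i q. 0)"
          using w by (intro Cinf_Cm[OF Cinf_const'])
        ultimately show ?thesis by blast
      qed
    qed
    show ?case unfolding Cm.simps by (intro conjI ballI 2 l Cm_lmod[OF Suc.prems])
  }
qed

lemma Cinf_fst: "Cinf w S u \<Longrightarrow> Cinf w (S \<times> (UNIV :: real set)) (\<lambda>i q. u i (fst q))"
  unfolding Cinf_def by (intro allI Cm_fst) (erule spec)

lemma smooth1_snd: "smooth1 S (\<lambda>q :: 'a::euclidean_space \<times> real. snd q)"
  by (rule smooth1_linear[OF bounded_linear_snd])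

text \<open>The point on the line is a smooth function of the parameter and the arc length together,
  so the claim reduces to composition followed by integration.\<close>

lemma Cinf_lint:
  fixes G :: "'i \<Rightarrow> real \<times> real \<Rightarrow> real" and S :: "'a::euclidean_space set"
  assumes S: "open S" and G: "Cinf w UNIV G" and N: "smooth1 S N1" "smooth1 S N2" and s: "smooth1 S s"
  shows "Cinf w S (\<lambda>i p. lint (G i) (N1 p) (N2 p) (s p))"
proof -
  note f = Cinf_fst[OF N(1)] Cinf_fst[OF N(2)] Cinf_fst[OF s]
  have o: "open (S \<times> (UNIV :: real set))" using S by (simp add: open_Times)
  have "Cinf w (S \<times> (UNIV :: real set)) (\<lambda>i q. G i (s (fst q) * N1 (fst q) - snd q * N2 (fst q),
      s (fst q) * N2 (fst q) + snd q * N1 (fst q)))"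
    by (rule Cinf_compose2[OF G open_UNIV o]) (intro Cinf_diff Cinf_add Cinf_mult f smooth1_snd, intro Cinf_diff Cinf_add Cinf_mult f smooth1_snd, simp)
  from Cinf_integral[OF S this, of "-2" 2] show ?thesis
    by (simp add: lint_def lpt_def)
qed

context boman
begin

lemma wt_mono: "i \<le> j \<Longrightarrow> wt i \<le> wt j"
  unfolding wt_def by (intro power_increasing power_mono) auto

lemma Cinf_F: "Cinf (\<lambda>J. wt (J + \<kappa>)) UNIV F"
proof -
  have "Cinf (\<lambda>J. wt (J + \<kappa>)) UNIV (\<lambda>J. ang (J + \<kappa>))"
    by (rule Cinf_reindex[OF Cinf_ang, of "\<lambda>J. J + \<kappa>" 1 _ 1]) (simp_all add: wt_ge1)
  moreover have "Cinf (\<lambda>J. wt (J + \<kappa>)) UNIV (\<lambda>J. star \<kappa> N)"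
    by (rule Cinf_family[OF smooth1_star wt_ge1])
  ultimately have "Cinf (\<lambda>J. wt (J + \<kappa>)) UNIV (\<lambda>J x. if J = 0 then star \<kappa> N x else ang (J + \<kappa>) x)"
    by (intro Cinf_if)
  moreover have "(\<lambda>J x. if J = 0 then star \<kappa> N x else ang (J + \<kappa>) x) = F"
    by (simp add: F_def fun_eq_iff)
  ultimately show ?thesis by simp
qed

lemma summable_inverse_wt: "summable (\<lambda>J. inverse (wt (J + \<kappa> + n)))"
proof (rule summable_comparison_test')
  show "summable (\<lambda>J. (1/2::real) ^ J)" by (intro summable_geometric) simp
  show "norm (inverse (wt (J + \<kappa> + n))) \<le> (1/2) ^ J" if "0 \<le> J" for J
  proof -
    have "2 ^ J \<le> wt (J + \<kappa> + n)" using wt_ge_pow(1)[of J] wt_mono[of "J + \<kappa>" "J + \<kappa> + n"] by simp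
    then have "inverse (wt (J + \<kappa> + n)) \<le> inverse (2 ^ J)" by (intro le_imp_inverse_le) auto
    moreover have "0 \<le> inverse (wt (J + \<kappa> + n))" using wt_ge1[of "J + \<kappa> + n"] by simp
    ultimately show ?thesis by (simp add: power_one_over inverse_eq_divide)
  qed
qed

lemma smooth1_f0: "smooth1 UNIV f0"
proof -
  obtain C0 where C0: "\<And>J. c J * wt (J + \<kappa> + 1) ^ 0 \<le> C0" using c_negl[of 0] by blast
  have "Cinf (\<lambda>J. wt (J + \<kappa>)) UNIV (\<lambda>J z. c J * F J z)"
  proof (rule Cinf_cmult[OF Cinf_F, of _ C0 0])
    show "\<bar>c J\<bar> \<le> C0 * wt (J + \<kappa>) ^ 0" for J using C0[of J] c_pos[of J] by simp
  qed
  moreover have "lneg (\<lambda>J. wt (J + \<kappa>)) UNIV (\<lambda>J z. c J * F J z)"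
    unfolding lneg_def
  proof (intro allI impI)
    fix K :: "(real \<times> real) set" and M
    obtain C where C: "\<And>J. c J * wt (J + \<kappa> + 1) ^ M \<le> C" using c_negl[of M] by blast
    have "\<bar>c J * F J z\<bar> * wt (J + \<kappa>) ^ M \<le> C" for J z
    proof -
      have "\<bar>c J * F J z\<bar> \<le> c J * 1" unfolding abs_mult using c_pos[of J] F_bound by (intro mult_mono) auto
      moreover have "wt (J + \<kappa>) ^ M \<le> wt (J + \<kappa> + 1) ^ M"
        using wt_mono[of "J + \<kappa>" "J + \<kappa> + 1"] wt_ge1[of "J + \<kappa>"] by (intro power_mono) auto
      ultimately have "\<bar>c J * F J z\<bar> * wt (J + \<kappa>) ^ M \<le> c J * 1 * wt (J + \<kappa> + 1) ^ M"
        using c_pos[of J] wt_ge1[of "J + \<kappa>"] by (intro mult_mono) auto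
      then show ?thesis using C[of J] by simp
    qed
    then show "\<exists>C. \<forall>J. \<forall>z\<in>K. \<bar>c J * F J z\<bar> * wt (J + \<kappa>) ^ M \<le> C" by blast
  qed
  ultimately have "smooth1 UNIV (\<lambda>z. \<Sum>J. c J * F J z)"
    using smooth1_suminf[OF open_UNIV, of "\<lambda>J. wt (J + \<kappa>)"] summable_inverse_wt[of 0] wt_ge1 by simp
  then show ?thesis by (simp add: f0_def[abs_def])
qed

text \<open>The coefficient bound for \<open>Cinf_cumulative_sum\<close>: seven powers for each
  quotient and one for the number of summands.\<close>

lemma c_ratio_sum: "\<exists>C. \<forall>J. (\<Sum>K\<in>{..J + 1}. \<bar>c J / c K\<bar>) \<le> C * wt (J + \<kappa> + 1) ^ 8"
proof -
  obtain C0 where C0: "\<And>J. c J * wt (J + \<kappa> + 1) ^ 0 \<le> C0" using c_negl[of 0] by blast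
  define D where "D = C0 + 1 + c 0 / c 1"
  have D: "0 \<le> C0" "0 \<le> D" "C0 \<le> D" "1 \<le> D" "c 0 / c 1 \<le> D"
    using C0[of 0] c_pos[of 0] c_pos[of 1] by (auto simp: D_def)
  have "(\<Sum>K\<in>{..J + 1}. \<bar>c J / c K\<bar>) \<le> D * wt (J + \<kappa> + 1) ^ 8" for J
  proof -
    define w where "w = wt (J + \<kappa> + 1)"
    have w: "1 \<le> w" "1 \<le> w ^ 7" using wt_ge1[of "J + \<kappa> + 1"] by (simp_all add: w_def)
    have "\<bar>c J / c K\<bar> \<le> D * w ^ 7" if "K \<le> J + 1" for K
    proof -
      consider "K = 0" | "J = 0" "K = 1" | "1 \<le> J" "1 \<le> K" using \<open>K \<le> J + 1\<close> by linarith
      then have "c J / c K \<le> D * w ^ 7"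
      proof cases
        case 1
        then have "c J / c K \<le> D" using C0[of J] D(3) by (simp add: c_def[of 0])
        also have "D * 1 \<le> D * w ^ 7" using w D by (intro mult_left_mono) auto
        finally show ?thesis by simp
      next
        case 2
        then have "c J / c K \<le> D * 1" using D(5) by simp
        also have "\<dots> \<le> D * w ^ 7" using w D by (intro mult_left_mono) auto
        finally show ?thesis .
      next
        case 3
        have "c J / c K \<le> wt (J + \<kappa>) ^ 7" by (rule c_ratio[OF 3 \<open>K \<le> J + 1\<close>])
        also have "\<dots> \<le> 1 * w ^ 7" unfolding w_def
          using wt_mono[of "J + \<kappa>" "J + \<kappa> + 1"] wt_ge1[of "J + \<kappa>"] by (auto intro!: power_mono)
        also have "\<dots> \<le> D * w ^ 7" using w D by (intro mult_right_mono) auto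
        finally show ?thesis .
      qed
      moreover have "0 \<le> c J / c K" using c_pos[of J] c_pos[of K] by simp
      ultimately show ?thesis by simp
    qed
    then have "(\<Sum>K\<in>{..J + 1}. \<bar>c J / c K\<bar>) \<le> (\<Sum>K\<in>{..J + 1}. D * w ^ 7)" by (intro sum_mono) auto
    also have "\<dots> = real (J + 2) * (D * w ^ 7)" by simp
    also have "\<dots> \<le> w * (D * w ^ 7)"
    proof (rule mult_right_mono)
      have "J + 2 \<le> 2 ^ (J + 1)" by (induction J) auto
      then have "real (J + 2) \<le> real (2 ^ (J + 1))" by (simp only: of_nat_le_iff)
      also have "\<dots> = 2 ^ (J + 1)" by simp
      also have "(2::real) ^ (J + 1) \<le> 2 ^ (J + \<kappa> + 1)" by (intro power_increasing) auto
      also have "\<dots> \<le> w" unfolding w_def by (rule pow2_le_wt)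
      finally show "real (J + 2) \<le> w" .
    qed (use D w in auto)
    also have "\<dots> = D * w ^ 8" by (simp add: eval_nat_numeral)
    finally show ?thesis by (simp add: w_def)
  qed
  then show ?thesis by blast
qed

text \<open>The point and the unit direction are arbitrary smooth functions of a parameter. This
  covers both the joint smoothness off \<open>Theta a b\<close> and the case of a fixed
  direction.\<close>

lemma smooth1_T:
  fixes S :: "'a::euclidean_space set"
  assumes S: "open S" and X: "smooth1 S X1" "smooth1 S X2" and N: "smooth1 S N1" "smooth1 S N2"
    and unit: "\<And>p. p \<in> S \<Longrightarrow> (N1 p)\<^sup>2 + (N2 p)\<^sup>2 = 1"
  shows "smooth1 S (\<lambda>p. T (X1 p, X2 p) (N1 p) (N2 p))"
proof -
  define s where "s p = X1 p * N1 p + X2 p * N2 p" for p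
  have s: "smooth1 S s" unfolding s_def[abs_def] by (intro Cinf_add Cinf_mult X N)
  let ?w = "\<lambda>J. wt (J + \<kappa>)"
  let ?w' = "\<lambda>J. wt (J + \<kappa> + 1)"
  have w: "1 \<le> ?w J" "1 \<le> ?w' J" for J by (simp_all add: wt_ge1)
  have s2: "Cinf ?w S (\<lambda>J p. 1 - (s p)\<^sup>2)"
    by (rule Cinf_diff[OF Cinf_const'[OF w(1)] Cinf_power[OF Cinf_family[OF s w(1)]]])
  have sc: "Cinf ?w S (\<lambda>J p. (1 - (s p)\<^sup>2) * 4 ^ (J + \<kappa>))"
    "Cinf ?w S (\<lambda>J p. (1 - (s p)\<^sup>2) * 4 ^ (J + \<kappa> - 1))"
    "Cinf ?w S (\<lambda>J p. (1 - (s p)\<^sup>2) * 4 ^ \<kappa>)"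
  proof -
    have a: "\<bar>4 ^ (J + \<kappa>)\<bar> \<le> 1 * ?w J ^ 2" "\<bar>4 ^ (J + \<kappa> - 1)\<bar> \<le> 1 * ?w J ^ 2" "\<bar>4 ^ \<kappa>\<bar> \<le> 1 * ?w J ^ 2" for J
    proof -
      have "(4::real) ^ (J + \<kappa> - 1) \<le> 4 ^ (J + \<kappa>)" "(4::real) ^ \<kappa> \<le> 4 ^ (J + \<kappa>)"
        by (intro power_increasing; simp)+
      from this[THEN order_trans, OF pow4_le_wt_sq] pow4_le_wt_sq[of "J + \<kappa>"]
      show "\<bar>4 ^ (J + \<kappa>)\<bar> \<le> 1 * ?w J ^ 2" "\<bar>4 ^ (J + \<kappa> - 1)\<bar> \<le> 1 * ?w J ^ 2" "\<bar>4 ^ \<kappa>\<bar> \<le> 1 * ?w J ^ 2"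
        by simp_all
    qed
    show "Cinf ?w S (\<lambda>J p. (1 - (s p)\<^sup>2) * 4 ^ (J + \<kappa>))"
      using Cinf_cmult[OF s2 a(1)] by (simp only: mult.commute)
    show "Cinf ?w S (\<lambda>J p. (1 - (s p)\<^sup>2) * 4 ^ (J + \<kappa> - 1))"
      using Cinf_cmult[OF s2 a(2)] by (simp only: mult.commute)
    show "Cinf ?w S (\<lambda>J p. (1 - (s p)\<^sup>2) * 4 ^ \<kappa>)"
      using Cinf_cmult[OF s2 a(3)] by (simp only: mult.commute)
  qed
  have chis: "Cinf ?w S (\<lambda>J p. chi (J + \<kappa>) ((s p)\<^sup>2))" "Cinf ?w S (\<lambda>J p. chi (J + \<kappa> - 1) ((s p)\<^sup>2))"
    "Cinf ?w S (\<lambda>J p. chi \<kappa> ((s p)\<^sup>2))" "Cinf ?w S (\<lambda>J p. chi_out (J + \<kappa>) ((s p)\<^sup>2))"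
    unfolding chi_def chi_out_def
    by (intro Cinf_step Cinf_diff Cinf_scale sc Cinf_const' w S)+
  have chin: "Cinf ?w S (\<lambda>J p. chi_in (J + \<kappa>) ((s p)\<^sup>2))"
  proof -
    have "Cinf ?w S (\<lambda>J p. step ((1/16) * ((1 - (s p)\<^sup>2) * 4 ^ (J + \<kappa>)) - 1))"
      by (intro Cinf_step Cinf_diff Cinf_scale sc Cinf_const' w S)
    then show ?thesis by (simp add: chi_in_def)
  qed
  have psi: "Cinf ?w S (\<lambda>J p. psi J ((s p)\<^sup>2))"
    unfolding psi_def by (intro Cinf_if Cinf_diff chis)
  have FX: "Cinf ?w S (\<lambda>J p. F J (X1 p, X2 p))"
    by (rule Cinf_compose2[OF Cinf_F open_UNIV S X]) simp
  have Dn: "Cinf ?w S (\<lambda>J p. Dn J (N1 p) (N2 p) (s p))"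
    unfolding Dn_def
    by (intro Cinf_add Cinf_diff Cinf_if Cinf_const' w chis chin Cinf_lint[OF S _ N s] Cinf_power Cinf_F)
  have inv: "Cinf ?w S (\<lambda>J p. inverse (Dn J (N1 p) (N2 p) (s p)))"
  proof (rule Cinf_inverse[OF Dn _ S, of 16 2])
    fix J p assume p: "p \<in> S"
    have "1 / (16 * ?w J ^ 2) \<le> 1 / (16 * 4 ^ (J + \<kappa>))"
      using pow4_le_wt_sq[of "J + \<kappa>"] w(1)[of J] by (intro divide_left_mono) auto
    also have "\<dots> \<le> Dn J (N1 p) (N2 p) (s p)" by (rule Dn_lower[OF unit[OF p]])
    finally show "1 \<le> 16 * ?w J ^ 2 * Dn J (N1 p) (N2 p) (s p)"
      using w(1)[of J] by (simp add: divide_le_eq mult.commute)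
  qed
  have g: "Cinf ?w' S (\<lambda>J p. lint (F J) (N1 p) (N2 p) (s p))"
    by (rule Cinf_reindex[OF Cinf_lint[OF S Cinf_F N s], of "\<lambda>J. J" 1 _ 1]) (simp_all add: wt_mono wt_ge1)
  obtain C where C: "\<And>J. (\<Sum>K\<in>{..J + 1}. \<bar>c J / c K\<bar>) \<le> C * wt (J + \<kappa> + 1) ^ 8"
    using c_ratio_sum by blast
  have "Cinf ?w' S (\<lambda>J p. \<Sum>K\<in>{..J + 1}. c J / c K *
      (psi K ((s p)\<^sup>2) * F K (X1 p, X2 p) * inverse (Dn K (N1 p) (N2 p) (s p))))"
    by (rule Cinf_cumulative_sum[OF Cinf_mult[OF Cinf_mult[OF psi FX] inv] _ w(2) C])
      (simp add: wt_mono)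
  from Cinf_mult[OF g this]
  have V: "Cinf ?w' S (\<lambda>J p. V J (X1 p, X2 p) (N1 p) (N2 p) (s p))" by (simp only: V_def)
  have neg: "lneg ?w' S (\<lambda>J p. V J (X1 p, X2 p) (N1 p) (N2 p) (s p))"
    unfolding lneg_def
  proof (intro allI impI)
    fix K M assume K: "compact K" "K \<subseteq> S"
    obtain C where C: "\<forall>J z n1 n2 s. n1\<^sup>2 + n2\<^sup>2 = 1 \<longrightarrow> \<bar>V J z n1 n2 s\<bar> * wt (J + \<kappa> + 1) ^ M \<le> C"
      using V_negl by blast
    show "\<exists>C. \<forall>J. \<forall>p\<in>K. \<bar>V J (X1 p, X2 p) (N1 p) (N2 p) (s p)\<bar> * wt (J + \<kappa> + 1) ^ M \<le> C"
    proof (intro exI[of _ C] allI ballI)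
      fix J p assume "p \<in> K"
      then have "p \<in> S" using K(2) by (rule rev_subsetD)
      then show "\<bar>V J (X1 p, X2 p) (N1 p) (N2 p) (s p)\<bar> * wt (J + \<kappa> + 1) ^ M \<le> C"
        using C unit by simp
    qed
  qed
  have "smooth1 S (\<lambda>p. \<Sum>J. V J (X1 p, X2 p) (N1 p) (N2 p) (s p))"
    by (rule smooth1_suminf[OF S summable_inverse_wt[of 1] w(2) V neg])
  then show ?thesis by (simp add: T_def s_def)
qed

end

section \<open>Vanishing of the weighted line integrals\<close>

context boman
begin

lemma f0_outside: "1 \<le> rsq z \<Longrightarrow> f0 z = 0"
  by (simp add: f0_def F_outside)

lemma f0_eq: "F K z \<noteq> 0 \<Longrightarrow> f0 z = c K * F K z"
proof -
  assume "F K z \<noteq> 0"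
  then have "F J z = 0" if "J \<noteq> K" for J using F_disjoint[OF that, of z] by simp
  then have "(\<Sum>J. c J * F J z) = (\<Sum>J\<in>{K}. c J * F J z)"
    by (intro suminf_finite) auto
  then show ?thesis by (simp add: f0_def)
qed

lemma f0_times_F: "f0 z * F K z = c K * (F K z)\<^sup>2"
  using f0_eq[of K z] by (cases "F K z = 0") (simp_all add: power2_eq_square)

lemma summable_c: "summable c"
proof -
  obtain C where C: "\<And>J. c J * wt (J + \<kappa> + 1) ^ 1 \<le> C" using c_negl[of 1] by blast
  show ?thesis
  proof (rule summable_comparison_test')
    show "summable (\<lambda>J. C * inverse (wt (J + \<kappa> + 1)))" by (intro summable_mult summable_inverse_wt)
    show "norm (c J) \<le> C * inverse (wt (J + \<kappa> + 1))" if "0 \<le> J" for J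
    proof -
      have "0 < wt (J + \<kappa> + 1)" using wt_ge1[of "J + \<kappa> + 1"] by linarith
      then show ?thesis using C[of J] c_pos[of J] by (simp add: field_simps)
    qed
  qed
qed

lemma lint_f0: "(\<lambda>J. c J * lint (F J) n1 n2 s) sums lint f0 n1 n2 s"
proof -
  have u: "uniform_limit {-2..2} (\<lambda>m t. \<Sum>J<m. c J * F J (lpt n1 n2 s t))
      (\<lambda>t. \<Sum>J. c J * F J (lpt n1 n2 s t)) sequentially"
  proof (rule Weierstrass_m_test[OF _ summable_c])
    show "norm (c J * F J (lpt n1 n2 s t)) \<le> c J" for J t
      using c_pos[of J] mult_left_mono[OF F_bound[of J "lpt n1 n2 s t"], of "c J"] by (simp add: abs_mult)
  qed
  have co: "continuous_on {-2..2} (\<lambda>t. \<Sum>J<m. c J * F J (lpt n1 n2 s t))" for m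
    by (intro continuous_intros continuous_F_lpt)
  obtain I L where I: "\<And>m. ((\<lambda>t. \<Sum>J<m. c J * F J (lpt n1 n2 s t)) has_integral I m) {-2..2}"
    and L: "((\<lambda>t. \<Sum>J. c J * F J (lpt n1 n2 s t)) has_integral L) {-2..2}" and IL: "I \<longlonglongrightarrow> L"
    by (rule uniform_limit_integral[OF u co]) auto
  have "((\<lambda>t. \<Sum>J<m. c J * F J (lpt n1 n2 s t)) has_integral (\<Sum>J<m. c J * lint (F J) n1 n2 s)) {-2..2}" for m
    unfolding lint_def
    by (intro has_integral_sum has_integral_mult_right integrable_integral integrable_continuous_interval
        continuous_F_lpt) simp
  then have "I = (\<lambda>m. \<Sum>J<m. c J * lint (F J) n1 n2 s)" using has_integral_unique[OF I] by blast
  moreover have "L = lint f0 n1 n2 s" using integral_unique[OF L] by (simp add: lint_def f0_def)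
  ultimately show ?thesis using IL by (simp add: sums_def)
qed

lemma sum_psi: "(\<Sum>K\<le>m. psi K y) = chi (m + \<kappa>) y"
  by (induction m) (simp_all add: psi_def)

text \<open>Measured two scales coarser, a depth below 16 is a depth below 1, so the line does not
  reach the annulus of \<open>F J\<close>. This justifies ending the inner sum of \<open>V\<close>
  at \<open>J + 1\<close>.\<close>

lemma psi_lint_zero:
  assumes n: "n1\<^sup>2 + n2\<^sup>2 = 1" and "J + 2 \<le> K" "psi K (s\<^sup>2) \<noteq> 0"
  shows "lint (F J) n1 n2 s = 0"
proof -
  have 1: "(1 - s\<^sup>2) * 4 ^ (K + \<kappa>) < 16" using psi_support(2)[OF assms(3)] assms(2) by simp
  have "0 < (1 - s\<^sup>2) * 4 ^ (K + \<kappa>)" using psi_support(1)[OF assms(3)] by linarith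
  then have s: "0 < 1 - s\<^sup>2" by (simp add: zero_less_mult_iff)
  have "(4::real) ^ (J + \<kappa> + 2) \<le> 4 ^ (K + \<kappa>)" using assms(2) by (intro power_increasing) auto
  then have "(1 - s\<^sup>2) * 4 ^ (J + \<kappa> + 2) \<le> (1 - s\<^sup>2) * 4 ^ (K + \<kappa>)" using s by (intro mult_left_mono) auto
  then have 2: "(1 - s\<^sup>2) * 4 ^ (J + \<kappa>) < 1" using 1 by (simp add: power_add)
  have "F J (lpt n1 n2 s t) = 0" for t
  proof (rule ccontr)
    assume "F J (lpt n1 n2 s t) \<noteq> 0"
    then have "1 < (1 - (s\<^sup>2 + t\<^sup>2)) * 4 ^ (J + \<kappa>)" using F_support(1) rsq_lpt[OF n] by metis
    also have "\<dots> \<le> (1 - s\<^sup>2) * 4 ^ (J + \<kappa>)" by (intro mult_right_mono) auto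
    finally show False using 2 by simp
  qed
  then show ?thesis by (simp add: lint_def)
qed

text \<open>On a fixed line only finitely many \<open>psi K\<close> are nonzero. Hence every
  \<open>V J\<close> is its coefficient times one and the same finite sum \<open>Q\<close>, so
  \<open>T\<close> equals \<open>\<Gamma> * Q\<close> there, and the integral of
  \<open>f0 * Q\<close> is 1.\<close>

lemma lint_weighted_zero:
  assumes n: "n1\<^sup>2 + n2\<^sup>2 = 1"
  shows "lint (\<lambda>z. f0 z * (1 - T z n1 n2)) n1 n2 s = 0"
proof (cases "1 \<le> \<bar>s\<bar>")
  case True
  then show ?thesis unfolding lint_def by (simp add: f0_outside lpt_outside[OF n])
next
  case False
  then have "s\<^sup>2 < 1" by (simp add: abs_square_less_1)
  then have s1: "0 < 1 - s\<^sup>2" by simp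
  \<comment> \<open>At this scale the depth of the line exceeds 4, so \<open>chi\<close> has reached
    1 and later \<open>psi K\<close> vanish.\<close>
  obtain K0 :: nat where K0: "4 / (1 - s\<^sup>2) < 4 ^ K0" using real_arch_pow[of 4 "4 / (1 - s\<^sup>2)"] by auto
  have "4 < (1 - s\<^sup>2) * 4 ^ K0" using K0 s1 by (simp add: field_simps)
  also have "\<dots> \<le> (1 - s\<^sup>2) * 4 ^ (K0 + \<kappa>)" using s1 by (intro mult_left_mono power_increasing) auto
  finally have big: "4 < (1 - s\<^sup>2) * 4 ^ (K0 + \<kappa>)" .
  have psi0: "psi K (s\<^sup>2) = 0" if "K0 < K" for K
  proof (rule ccontr)
    assume "psi K (s\<^sup>2) \<noteq> 0"
    then have "(1 - s\<^sup>2) * 4 ^ (K + \<kappa>) < 16" using psi_support(2) that by simp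
    moreover have "(1 - s\<^sup>2) * 4 ^ (K0 + \<kappa> + 1) \<le> (1 - s\<^sup>2) * 4 ^ (K + \<kappa>)"
      using s1 that by (intro mult_left_mono power_increasing) auto
    ultimately show False using big by simp
  qed
  have psi1: "(\<Sum>K\<le>K0. psi K (s\<^sup>2)) = 1"
    unfolding sum_psi chi_def using big by (intro step_1) simp
  define iD where "iD K = inverse (Dn K n1 n2 s)" for K
  define H where "H K = lint (\<lambda>z. (F K z)\<^sup>2) n1 n2 s" for K
  define \<Gamma> where "\<Gamma> = lint f0 n1 n2 s"
  define Q where "Q z = (\<Sum>K\<le>K0. psi K (s\<^sup>2) * F K z * iD K / c K)" for z
  have V: "V J z n1 n2 s = (c J * lint (F J) n1 n2 s) * Q z" for J z
  proof -
    have z: "piece J K z n1 n2 s = 0" if "K0 < K \<or> J + 1 < K" for K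
      using psi0[of K] psi_lint_zero[OF n, of J K s] that unfolding piece_def
      by (cases "psi K (s\<^sup>2) = 0") auto
    \<comment> \<open>Going through the larger of the two ranges makes the range independent of
      \<open>J\<close>: the extra summands vanish by \<open>psi_lint_zero\<close> or by
      \<open>psi0\<close>.\<close>
    have "(\<Sum>K\<le>J + 1. piece J K z n1 n2 s) = (\<Sum>K\<le>max (J + 1) K0. piece J K z n1 n2 s)"
      by (rule sum.mono_neutral_left) (use z in auto)
    also have "\<dots> = (\<Sum>K\<le>K0. piece J K z n1 n2 s)"
      by (rule sum.mono_neutral_right) (use z in auto)
    also have "\<dots> = (c J * lint (F J) n1 n2 s) * Q z"
      unfolding Q_def sum_distrib_left piece_def iD_def by (intro sum.cong refl) simp
    finally show ?thesis by (simp add: V_pieces)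
  qed
  have T: "T (lpt n1 n2 s t) n1 n2 = \<Gamma> * Q (lpt n1 n2 s t)" for t
  proof -
    have "fst (lpt n1 n2 s t) * n1 + snd (lpt n1 n2 s t) * n2 = s * (n1\<^sup>2 + n2\<^sup>2)"
      by (simp add: lpt_def power2_eq_square algebra_simps)
    then have "T (lpt n1 n2 s t) n1 n2 = (\<Sum>J. (c J * lint (F J) n1 n2 s) * Q (lpt n1 n2 s t))"
      unfolding T_def n by (simp only: V mult_1_right)
    also have "\<dots> = \<Gamma> * Q (lpt n1 n2 s t)"
      using sums_unique[OF sums_mult2[OF lint_f0]] unfolding \<Gamma>_def by simp
    finally show ?thesis .
  qed
  have fQ: "f0 z * Q z = (\<Sum>K\<le>K0. psi K (s\<^sup>2) * iD K * (F K z)\<^sup>2)" for z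
  proof -
    have "f0 z * (psi K (s\<^sup>2) * F K z * iD K / c K) = psi K (s\<^sup>2) * iD K * (F K z)\<^sup>2" for K
    proof -
      have "f0 z * (psi K (s\<^sup>2) * F K z * iD K / c K) = psi K (s\<^sup>2) * iD K * (f0 z * F K z) / c K" by simp
      then show ?thesis unfolding f0_times_F using c_pos[of K] by simp
    qed
    then show ?thesis unfolding Q_def sum_distrib_left by simp
  qed
  \<comment> \<open>Where \<open>psi K\<close> is nonzero, \<open>Dn K\<close> is the integral of
    the square itself, so the quotient is 1 and the partition of unity remains.\<close>
  have one: "(\<Sum>K\<le>K0. psi K (s\<^sup>2) * iD K * H K) = 1"
  proof -
    have "psi K (s\<^sup>2) * iD K * H K = psi K (s\<^sup>2)" for K
    proof (cases "psi K (s\<^sup>2) = 0")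
      case False
      then have "H K = Dn K n1 n2 s" unfolding H_def by (simp add: Dn_eq)
      then show ?thesis unfolding iD_def using Dn_pos[OF n, of K s] by simp
    qed simp
    then show ?thesis using psi1 by (simp only:)
  qed
  have cf: "continuous_on {-2..2} (\<lambda>t. f0 (lpt n1 n2 s t))"
    by (rule continuous_on_compose2[OF Cinf_cont[OF smooth1_f0] continuous_lpt]) simp
  have "((\<lambda>t. f0 (lpt n1 n2 s t) - \<Gamma> * (\<Sum>K\<le>K0. psi K (s\<^sup>2) * iD K * (F K (lpt n1 n2 s t))\<^sup>2))
      has_integral (\<Gamma> - \<Gamma> * (\<Sum>K\<le>K0. psi K (s\<^sup>2) * iD K * H K))) {-2..2}"
    unfolding \<Gamma>_def H_def lint_def
    by (intro has_integral_diff has_integral_sum has_integral_mult_right integrable_integral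
        integrable_continuous_interval cf continuous_on_power continuous_F_lpt) simp
  moreover have "f0 (lpt n1 n2 s t) - \<Gamma> * (\<Sum>K\<le>K0. psi K (s\<^sup>2) * iD K * (F K (lpt n1 n2 s t))\<^sup>2)
      = f0 (lpt n1 n2 s t) * (1 - T (lpt n1 n2 s t) n1 n2)" for t
    unfolding T fQ[symmetric] by (simp add: algebra_simps)
  ultimately have "((\<lambda>t. f0 (lpt n1 n2 s t) * (1 - T (lpt n1 n2 s t) n1 n2)) has_integral 0) {-2..2}"
    unfolding one by simp
  then show ?thesis unfolding lint_def by (rule integral_unique)
qed

lemma f0_nonzero: "\<exists>z. f0 z \<noteq> 0"
proof -
  \<comment> \<open>The scaled depth 3/2 is the middle of the plateau [5/4, 7/4] of
    \<open>bump\<close>; on the positive first axis the oscillating factor is 1.\<close>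
  define q :: real where "q = 3/2 / 4 ^ (1 + \<kappa>)"
  have "(4::real) ^ 1 \<le> 4 ^ (1 + \<kappa>)" by (intro power_increasing) auto
  then have q: "0 \<le> q" "q \<le> 3/8" "q * 4 ^ (1 + \<kappa>) = 3/2" by (simp_all add: q_def field_simps)
  define z where "z = (sqrt (1 - q), 0 :: real)"
  have r: "rsq z = 1 - q" using q by (simp add: z_def rsq_def)
  have "Phi (1 + \<kappa>) (rsq z) = 1" unfolding Phi_def r using q(3) by (intro bump_1) simp_all
  moreover have "Complex (E1 z) (E2 z) = 1"
    using q unfolding E1_def E2_def r by (simp add: smax_eq z_def complex_eq_iff)
  ultimately have F1: "F 1 z = 1" by (simp add: F_def ang_def)
  then have "f0 z = c 1" using f0_eq[of 1 z] by simp
  then show ?thesis using c_pos[of 1] by (intro exI[of _ z]) simp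
qed

end

section \<open>Choice of the constants\<close>

lemma boman_exists: "\<exists>\<kappa> \<epsilon> N B. boman \<kappa> \<epsilon> N B"
proof -
  obtain B where B: "B \<ge> 0" "\<forall>k n1 n2 s. 1 \<le> k \<longrightarrow> n1\<^sup>2 + n2\<^sup>2 = 1 \<longrightarrow> 1/2 \<le> \<bar>s\<bar> \<longrightarrow>
      \<bar>lint (ang k) n1 n2 s\<bar> * wt k ^ 12 \<le> B" using lint_ang_negl by blast
  obtain K where K: "\<forall>k n1 n2 s. K \<le> k \<longrightarrow> n1\<^sup>2 + n2\<^sup>2 = 1 \<longrightarrow> 1/2 \<le> \<bar>s\<bar> \<longrightarrow> 5/2 \<le> (1 - s\<^sup>2) * 4 ^ k \<longrightarrow>
     1 / (16 * 4 ^ k) \<le> lint (\<lambda>z. (ang k z)\<^sup>2) n1 n2 s" using lint_ang_sq by blast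
  obtain K1 :: nat where K1: "1024 * B < 2 ^ K1" using real_arch_pow[of 2 "1024 * B"] by auto
  define \<kappa> where "\<kappa> = max 3 (max K K1)"
  have kap: "3 \<le> \<kappa>" "K \<le> \<kappa>" "K1 \<le> \<kappa>" by (simp_all add: \<kappa>_def)
  define \<epsilon> :: real where "\<epsilon> = 1 / (1024 * 4 ^ \<kappa>)"
  have eps: "0 < \<epsilon>" "1024 * 4 ^ \<kappa> * \<epsilon> \<le> 1" by (simp_all add: \<epsilon>_def)
  define D where "D = 16 * 4 ^ \<kappa> + 64 * 4 ^ \<kappa> * (2 ^ ((\<kappa> + 1) ^ 3) / \<epsilon>)"
  have D: "0 < D" unfolding D_def using eps by (intro add_pos_pos mult_pos_pos divide_pos_pos) auto
  then have "0 < 1/8 / D" by simp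
  from lint_star_small[OF this, of \<kappa>] obtain N1 where
    N1: "\<forall>N n1 n2 s. N1 \<le> N \<longrightarrow> n1\<^sup>2 + n2\<^sup>2 = 1 \<longrightarrow> \<bar>s\<bar> \<le> 1 \<longrightarrow> \<bar>lint (star \<kappa> N) n1 n2 s\<bar> \<le> 1/8 / D"
    by (elim exE)
  obtain N2 where N2: "\<forall>N n1 n2 s. N2 \<le> N \<longrightarrow> n1\<^sup>2 + n2\<^sup>2 = 1 \<longrightarrow> 5/2 \<le> (1 - s\<^sup>2) * 4 ^ \<kappa> \<longrightarrow>
     1 / (16 * 4 ^ \<kappa>) \<le> lint (\<lambda>z. (star \<kappa> N z)\<^sup>2) n1 n2 s" using lint_star_sq by blast
  have "boman \<kappa> \<epsilon> (max N1 N2) B"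
  proof (rule boman.intro)
    show "1 / (16 * 4 ^ \<kappa>) \<le> lint (\<lambda>z. (star \<kappa> (max N1 N2) z)\<^sup>2) n1 n2 s"
      if "n1\<^sup>2 + n2\<^sup>2 = 1" "5/2 \<le> (1 - s\<^sup>2) * 4 ^ \<kappa>" for n1 n2 s
      using N2 that by simp
    show "\<bar>lint (star \<kappa> (max N1 N2)) n1 n2 s\<bar> * (16 * 4 ^ \<kappa> + 64 * 4 ^ \<kappa> * (2 ^ ((\<kappa> + 1) ^ 3) / \<epsilon>)) \<le> 1/8"
      if "n1\<^sup>2 + n2\<^sup>2 = 1" "\<bar>s\<bar> \<le> 1" for n1 n2 s
    proof -
      have "\<bar>lint (star \<kappa> (max N1 N2)) n1 n2 s\<bar> \<le> 1/8 / D" using N1 that by simp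
      then show ?thesis using D unfolding D_def[symmetric] by (simp only: pos_le_divide_eq)
    qed
    show "1 / (16 * 4 ^ k) \<le> lint (\<lambda>z. (ang k z)\<^sup>2) n1 n2 s"
      if "\<kappa> < k" "n1\<^sup>2 + n2\<^sup>2 = 1" "1/2 \<le> \<bar>s\<bar>" "5/2 \<le> (1 - s\<^sup>2) * 4 ^ k" for k n1 n2 s
      using K that kap by simp
    show "\<bar>lint (ang k) n1 n2 s\<bar> * wt k ^ 12 \<le> B"
      if "1 \<le> k" "n1\<^sup>2 + n2\<^sup>2 = 1" "1/2 \<le> \<bar>s\<bar>" for k n1 n2 s
      using B(2) that by simp
    have "(2::real) ^ K1 \<le> 2 ^ \<kappa>" using kap by (intro power_increasing) auto
    also have "\<dots> \<le> wt \<kappa>" by (rule pow2_le_wt)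
    finally show "1024 * B \<le> wt \<kappa>" using K1 by linarith
  qed (use kap eps in auto)
  then show ?thesis by blast
qed

section \<open>From lines to hyperplanes\<close>

lemma integrable_pair_bounded:
  fixes F :: "'a \<times> 'b \<Rightarrow> real"
  assumes "pair_sigma_finite M1 M2" and F: "F \<in> borel_measurable (M1 \<Otimes>\<^sub>M M2)"
    and A: "A \<in> sets M1" "emeasure M1 A < \<infinity>" and B: "B \<in> sets M2" "emeasure M2 B < \<infinity>"
    and bnd: "\<And>x y. \<bar>F (x, y)\<bar> \<le> C" and supp: "\<And>x y. x \<in> space M1 \<Longrightarrow> F (x, y) \<noteq> 0 \<Longrightarrow> x \<in> A \<and> y \<in> B"
  shows "integrable (M1 \<Otimes>\<^sub>M M2) F"
proof -
  interpret pair_sigma_finite M1 M2 by fact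
  have AB: "A \<times> B \<in> sets (M1 \<Otimes>\<^sub>M M2)" using A B by simp
  have "emeasure (M1 \<Otimes>\<^sub>M M2) (A \<times> B) = emeasure M1 A * emeasure M2 B"
    by (rule M2.emeasure_pair_measure_Times[OF A(1) B(1)])
  also have "\<dots> < \<infinity>" using A B by (simp add: ennreal_mult_less_top)
  finally have "integrable (M1 \<Otimes>\<^sub>M M2) (\<lambda>p. C * indicator (A \<times> B) p)"
    using AB by (intro integrable_mult_right integrable_real_indicator) auto
  then show ?thesis
  proof (rule Bochner_Integration.integrable_bound[OF _ F])
    show "AE p in M1 \<Otimes>\<^sub>M M2. norm (F p) \<le> norm (C * indicator (A \<times> B) p)"
    proof (rule AE_I2)
      fix p assume p: "p \<in> space (M1 \<Otimes>\<^sub>M M2)"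
      obtain x y where xy: "p = (x, y)" by (cases p)
      have "x \<in> space M1" using p by (simp add: xy space_pair_measure)
      then show "norm (F p) \<le> norm (C * indicator (A \<times> B) p)"
        using bnd[of x y] supp[of x y] by (cases "F p = 0") (auto simp: xy indicator_def)
    qed
  qed
qed

text \<open>Averaging in the direction \<open>\<tau>\<close>: insert \<open>1 = (\<integral>t. indicator {0..1} (\<phi> g \<bullet> \<tau> - t))\<close>, exchange
  the integrals, and translate \<open>g\<close> by \<open>t \<tau>\<close>; the inner integral then runs along a line.\<close>

lemma integral_zero_if_line_integrals_zero:
  fixes \<phi> :: "'g \<Rightarrow> 'v::euclidean_space" and h :: "'v \<Rightarrow> real"
  assumes M: "sigma_finite_measure M" and \<phi>[measurable]: "\<phi> \<in> M \<rightarrow>\<^sub>M borel"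
    and sh: "\<And>t. sh t \<in> M \<rightarrow>\<^sub>M M" "\<And>t. distr M M (sh t) = M"
    and sh_phi: "\<And>t g. g \<in> space M \<Longrightarrow> \<phi> (sh t g) = \<phi> g + t *\<^sub>R \<tau>" and \<tau>: "\<tau> \<bullet> \<tau> = 1"
    and fin: "\<And>R. emeasure M {g \<in> space M. norm (\<phi> g) \<le> R} < \<infinity>"
    and h: "continuous_on UNIV h" and h0: "\<And>x. R0 < norm x \<Longrightarrow> h x = 0"
    and line: "\<And>x. integral\<^sup>L lborel (\<lambda>t. h (x + t *\<^sub>R \<tau>)) = 0"
  shows "integrable M (\<lambda>g. h (\<phi> g))" "integral\<^sup>L M (\<lambda>g. h (\<phi> g)) = 0"
proof -
  interpret M: sigma_finite_measure M by fact
  interpret P: pair_sigma_finite M lborel ..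
  have hm[measurable]: "h \<in> borel_measurable borel" by (rule borel_measurable_continuous_onI[OF h])
  have "bounded (h ` cball 0 R0)"
    by (intro compact_imp_bounded compact_continuous_image continuous_on_subset[OF h] compact_cball) simp
  then obtain C0 where C0: "\<forall>x\<in>cball 0 R0. \<bar>h x\<bar> \<le> C0" unfolding bounded_iff by auto
  define C where "C = max 0 C0"
  have C: "\<bar>h x\<bar> \<le> C" for x
  proof (cases "R0 < norm x")
    case True
    then show ?thesis using h0[of x] by (simp add: C_def)
  next
    case False
    then show ?thesis using bspec[OF C0, of x] by (simp add: C_def)
  qed
  have Cp: "0 \<le> C" by (simp add: C_def)
  have n\<tau>: "norm \<tau> = 1" using \<tau> by (simp add: norm_eq_sqrt_inner)
  define A where "A R = {g \<in> space M. norm (\<phi> g) \<le> R}" for R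
  have A: "A R \<in> sets M" "emeasure M (A R) < \<infinity>" for R
    unfolding A_def using fin by (auto intro: borel_measurable_le)
  have "integrable M (\<lambda>g. C * indicator (A R0) g)"
    using A by (intro integrable_mult_right integrable_real_indicator) auto
  then show i: "integrable M (\<lambda>g. h (\<phi> g))"
  proof (rule Bochner_Integration.integrable_bound)
    show "AE g in M. norm (h (\<phi> g)) \<le> norm (C * indicator (A R0) g)"
    proof (rule AE_I2)
      fix g assume g: "g \<in> space M"
      show "norm (h (\<phi> g)) \<le> norm (C * indicator (A R0) g)"
        using C[of "\<phi> g"] h0[of "\<phi> g"] g by (cases "R0 < norm (\<phi> g)") (simp_all add: A_def)
    qed
  qed measurable
  define J where "J = (\<lambda>r::real. indicator {0..1} r :: real)"
  have J[measurable]: "J \<in> borel_measurable borel" by (simp add: J_def)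
  have Jb: "0 \<le> J r" "J r \<le> 1" for r by (simp_all add: J_def indicator_def)
  have J1: "integral\<^sup>L lborel (\<lambda>t. J (r - t)) = 1" for r
  proof -
    have "(\<lambda>t. J (r - t)) = indicator {r - 1..r}" by (auto simp: J_def indicator_def fun_eq_iff)
    then show ?thesis by simp
  qed
  have ip: "\<bar>x \<bullet> \<tau>\<bar> \<le> norm x" for x using Cauchy_Schwarz_ineq2[of x \<tau>] n\<tau> by simp
  have B: "{-R..R} \<in> sets lborel" "emeasure lborel {-R..R} < \<infinity>" for R :: real
    by (simp_all add: emeasure_lborel_Icc_eq)
  have Jnz: "0 \<le> r \<and> r \<le> 1" if "J r \<noteq> 0" for r
    using that by (simp add: J_def indicator_def split: if_splits)
  have hnz: "norm x \<le> R0" if "h x \<noteq> 0" for x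
    using that h0[of x] by (cases "R0 < norm x") simp_all
  have i1: "integrable (M \<Otimes>\<^sub>M lborel) (\<lambda>p. h (\<phi> (fst p)) * J (\<phi> (fst p) \<bullet> \<tau> - snd p))"
  proof (rule integrable_pair_bounded[OF P.pair_sigma_finite_axioms _ A[of R0] B[of "R0 + 1"], of _ C])
    fix g t
    show "\<bar>h (\<phi> (fst (g, t))) * J (\<phi> (fst (g, t)) \<bullet> \<tau> - snd (g, t))\<bar> \<le> C"
      using mult_mono[OF C[of "\<phi> g"] Jb(2)[of "\<phi> g \<bullet> \<tau> - t"]] Cp Jb(1) by (simp add: abs_mult)
    assume g: "g \<in> space M" and nz: "h (\<phi> (fst (g, t))) * J (\<phi> (fst (g, t)) \<bullet> \<tau> - snd (g, t)) \<noteq> 0"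
    have "norm (\<phi> g) \<le> R0" "0 \<le> \<phi> g \<bullet> \<tau> - t" "\<phi> g \<bullet> \<tau> - t \<le> 1"
      using hnz[of "\<phi> g"] Jnz[of "\<phi> g \<bullet> \<tau> - t"] nz by simp_all
    then show "g \<in> A R0 \<and> t \<in> {-(R0 + 1)..R0 + 1}" using ip[of "\<phi> g"] g by (auto simp: A_def)
  qed measurable
  have i2: "integrable (M \<Otimes>\<^sub>M lborel) (\<lambda>p. h (\<phi> (fst p) + snd p *\<^sub>R \<tau>) * J (\<phi> (fst p) \<bullet> \<tau>))"
  proof (rule integrable_pair_bounded[OF P.pair_sigma_finite_axioms _ A[of "2 * R0 + 1"] B[of "R0 + 1"], of _ C])
    fix g t
    show "\<bar>h (\<phi> (fst (g, t)) + snd (g, t) *\<^sub>R \<tau>) * J (\<phi> (fst (g, t)) \<bullet> \<tau>)\<bar> \<le> C"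
      using mult_mono[OF C[of "\<phi> g + t *\<^sub>R \<tau>"] Jb(2)[of "\<phi> g \<bullet> \<tau>"]] Cp Jb(1) by (simp add: abs_mult)
    assume g: "g \<in> space M" and nz: "h (\<phi> (fst (g, t)) + snd (g, t) *\<^sub>R \<tau>) * J (\<phi> (fst (g, t)) \<bullet> \<tau>) \<noteq> 0"
    have 1: "norm (\<phi> g + t *\<^sub>R \<tau>) \<le> R0" "0 \<le> \<phi> g \<bullet> \<tau>" "\<phi> g \<bullet> \<tau> \<le> 1"
      using hnz[of "\<phi> g + t *\<^sub>R \<tau>"] Jnz[of "\<phi> g \<bullet> \<tau>"] nz by simp_all
    \<comment> \<open>The component along \<open>\<tau>\<close> confines \<open>t\<close>, because
      \<open>J\<close> keeps that of \<open>\<phi> g\<close> in [0, 1].\<close>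
    then have "\<bar>\<phi> g \<bullet> \<tau> + t\<bar> \<le> R0"
      using ip[of "\<phi> g + t *\<^sub>R \<tau>"] \<tau> by (simp add: inner_add_left)
    then have t: "\<bar>t\<bar> \<le> R0 + 1" using 1 by linarith
    have "norm (\<phi> g) \<le> norm (\<phi> g + t *\<^sub>R \<tau>) + norm (t *\<^sub>R \<tau>)"
      using norm_triangle_ineq4[of "\<phi> g + t *\<^sub>R \<tau>" "t *\<^sub>R \<tau>"] by simp
    then have "norm (\<phi> g) \<le> 2 * R0 + 1" using 1 t n\<tau> by simp
    then show "g \<in> A (2 * R0 + 1) \<and> t \<in> {-(R0 + 1)..R0 + 1}" using t g by (auto simp: A_def)
  qed measurable
  have "integral\<^sup>L M (\<lambda>g. h (\<phi> g)) = (\<integral>g. (\<integral>t. h (\<phi> g) * J (\<phi> g \<bullet> \<tau> - t) \<partial>lborel) \<partial>M)"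
    by (simp add: J1)
  also have "\<dots> = (\<integral>t. (\<integral>g. h (\<phi> g) * J (\<phi> g \<bullet> \<tau> - t) \<partial>M) \<partial>lborel)"
    using P.Fubini_integral[of "\<lambda>g t. h (\<phi> g) * J (\<phi> g \<bullet> \<tau> - t)"] i1 by (simp add: split_def)
  also have "\<dots> = (\<integral>t. (\<integral>g. h (\<phi> g + t *\<^sub>R \<tau>) * J (\<phi> g \<bullet> \<tau>) \<partial>M) \<partial>lborel)"
  proof (rule Bochner_Integration.integral_cong[OF refl])
    fix t :: real
    have "(\<integral>g. h (\<phi> g) * J (\<phi> g \<bullet> \<tau> - t) \<partial>M) = (\<integral>g. h (\<phi> g) * J (\<phi> g \<bullet> \<tau> - t) \<partial>distr M M (sh t))"
      by (simp only: sh(2))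
    also have "\<dots> = (\<integral>g. h (\<phi> (sh t g)) * J (\<phi> (sh t g) \<bullet> \<tau> - t) \<partial>M)"
      by (rule integral_distr[OF sh(1)]) measurable
    also have "\<dots> = (\<integral>g. h (\<phi> g + t *\<^sub>R \<tau>) * J (\<phi> g \<bullet> \<tau>) \<partial>M)"
      by (rule Bochner_Integration.integral_cong[OF refl]) (simp add: sh_phi inner_add_left \<tau>)
    finally show "(\<integral>g. h (\<phi> g) * J (\<phi> g \<bullet> \<tau> - t) \<partial>M) = (\<integral>g. h (\<phi> g + t *\<^sub>R \<tau>) * J (\<phi> g \<bullet> \<tau>) \<partial>M)" .
  qed
  also have "\<dots> = (\<integral>g. (\<integral>t. h (\<phi> g + t *\<^sub>R \<tau>) * J (\<phi> g \<bullet> \<tau>) \<partial>lborel) \<partial>M)"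
    using P.Fubini_integral[of "\<lambda>g t. h (\<phi> g + t *\<^sub>R \<tau>) * J (\<phi> g \<bullet> \<tau>)"] i2 by (simp add: split_def)
  also have "\<dots> = 0" by (simp add: line)
  finally show "integral\<^sup>L M (\<lambda>g. h (\<phi> g)) = 0" .
qed

section \<open>Lebesgue measure on hyperplanes\<close>

lemma product_sigma_finite_lborel: "product_sigma_finite (\<lambda>_::'i. lborel :: real measure)"
  by standard

lemma PiM_lborel_translation:
  fixes v :: "'i \<Rightarrow> real"
  assumes I: "finite I"
  defines "M \<equiv> PiM I (\<lambda>_. lborel :: real measure)"
  shows "(\<lambda>g. \<lambda>i\<in>I. g i + v i) \<in> M \<rightarrow>\<^sub>M M" "distr M M (\<lambda>g. \<lambda>i\<in>I. g i + v i) = M"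
proof -
  interpret product_sigma_finite "\<lambda>_::'i. lborel :: real measure" by (rule product_sigma_finite_lborel)
  show m: "(\<lambda>g. \<lambda>i\<in>I. g i + v i) \<in> M \<rightarrow>\<^sub>M M"
    unfolding M_def by measurable
  have "distr M M (\<lambda>g. \<lambda>i\<in>I. g i + v i) = PiM I (\<lambda>_. lborel)"
  proof (rule PiM_eqI[OF I])
    show "sets (distr M M (\<lambda>g. \<lambda>i\<in>I. g i + v i)) = sets (PiM I (\<lambda>_. lborel))" by (simp add: M_def)
    fix A :: "'i \<Rightarrow> real set" assume A: "\<And>i. i \<in> I \<Longrightarrow> A i \<in> sets lborel"
    have S: "Pi\<^sub>E I A \<in> sets M" unfolding M_def using A I by (intro sets_PiM_I_finite) auto
    have v: "(\<lambda>x. v i + x) -` A i \<in> sets lborel" if "i \<in> I" for i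
      using measurable_sets[of "\<lambda>x. v i + x" borel borel "A i"] A[OF that] by simp
    have "g \<in> (\<lambda>g. \<lambda>i\<in>I. g i + v i) -` Pi\<^sub>E I A \<inter> space M \<longleftrightarrow> g \<in> Pi\<^sub>E I (\<lambda>i. (\<lambda>x. v i + x) -` A i)" for g
      unfolding M_def space_PiM PiE_iff vimage_eq Int_iff add.commute[of "v _"] by simp
    then have "(\<lambda>g. \<lambda>i\<in>I. g i + v i) -` Pi\<^sub>E I A \<inter> space M = Pi\<^sub>E I (\<lambda>i. (\<lambda>x. v i + x) -` A i)"
      by (rule set_eqI)
    then have "emeasure (distr M M (\<lambda>g. \<lambda>i\<in>I. g i + v i)) (Pi\<^sub>E I A) =
        emeasure M (Pi\<^sub>E I (\<lambda>i. (\<lambda>x. v i + x) -` A i))"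
      using emeasure_distr[OF m S] by simp
    also have "\<dots> = (\<Prod>i\<in>I. emeasure lborel ((\<lambda>x. v i + x) -` A i))"
      unfolding M_def by (rule emeasure_PiM[OF I v])
    also have "\<dots> = (\<Prod>i\<in>I. emeasure lborel (A i))"
    proof (rule prod.cong[OF refl])
      fix i assume i: "i \<in> I"
      have "emeasure lborel (A i) = emeasure (distr lborel borel ((+) (v i))) (A i)" by (simp only: lborel_distr_plus)
      also have "\<dots> = emeasure lborel ((\<lambda>x. v i + x) -` A i)" using A[OF i] by (subst emeasure_distr) auto
      finally show "emeasure lborel ((\<lambda>x. v i + x) -` A i) = emeasure lborel (A i)" by simp
    qed
    finally show "emeasure (distr M M (\<lambda>g. \<lambda>i\<in>I. g i + v i)) (Pi\<^sub>E I A) = (\<Prod>i\<in>I. emeasure lborel (A i))" .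
  qed
  then show "distr M M (\<lambda>g. \<lambda>i\<in>I. g i + v i) = M" by (simp add: M_def)
qed

text \<open>Orthogonal transformations act transitively on the unit sphere, so the choice in the
  definition has a witness; nothing else about the frame is assumed later.\<close>

lemma hyp_frame:
  fixes \<theta> :: "real ^ 'n::finite"
  assumes "norm \<theta> = 1"
  obtains k U where "hyp_frame \<theta> = (k, U)" "orthogonal_transformation U" "U (axis k 1) = \<theta>"
proof -
  have "norm (axis (undefined::'n) (1::real)) = 1" by simp
  then obtain f where "orthogonal_transformation f" "f (axis (undefined::'n) (1::real)) = \<theta>"
    using orthogonal_transformation_exists_1[of "axis (undefined::'n) (1::real)" \<theta>] assms by auto
  then have "\<exists>p :: 'n \<times> (real ^ 'n \<Rightarrow> real ^ 'n). case p of (k, U) \<Rightarrow> orthogonal_transformation U \<and> U (axis k 1) = \<theta>"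
    by (intro exI[of _ "(undefined, f)"]) (simp only: prod.case simp_thms)
  from someI_ex[OF this] show thesis using that
    unfolding hyp_frame_def[symmetric] by (cases "hyp_frame \<theta>") auto
qed

lemma coord_emb_sum: "coord_emb k g = (\<Sum>i\<in>UNIV - {k}. g i *\<^sub>R axis i 1)"
  by (simp add: coord_emb_def vec_eq_iff axis_def if_distrib[of "\<lambda>x. _ * x"] sum.delta' cong: if_cong)

lemma hyperplane_integral_zero:
  fixes \<theta> \<tau> :: "real ^ 'n::finite" and h :: "real ^ 'n \<Rightarrow> real"
  assumes \<theta>: "norm \<theta> = 1" and \<tau>: "\<tau> \<bullet> \<tau> = 1" "\<tau> \<bullet> \<theta> = 0"
    and h: "continuous_on UNIV h" and h0: "\<And>x. R0 < norm x \<Longrightarrow> h x = 0"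
    and line: "\<And>x. integral\<^sup>L lborel (\<lambda>t. h (x + t *\<^sub>R \<tau>)) = 0"
  shows "integrable (hyperplane_measure s \<theta>) h" "integral\<^sup>L (hyperplane_measure s \<theta>) h = 0"
proof -
  obtain k U where kU: "hyp_frame \<theta> = (k, U)" and U: "orthogonal_transformation U" and Uk: "U (axis k 1) = \<theta>"
    using hyp_frame[OF \<theta>] .
  have linU: "linear U" using U by (rule orthogonal_transformation_linear)
  have cU: "continuous_on UNIV U" by (rule linear_continuous_on) (use linU linear_conv_bounded_linear in blast)
  define I where "I = UNIV - {k}"
  define M where "M = PiM I (\<lambda>_. lborel :: real measure)"
  define \<phi> where "\<phi> g = s *\<^sub>R \<theta> + U (coord_emb k g)" for g
  have hyp: "hyperplane_measure s \<theta> = distr M borel \<phi>"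
    by (simp add: hyperplane_measure_def kU M_def I_def \<phi>_def[abs_def])
  interpret fps: finite_product_sigma_finite "\<lambda>_::'n. lborel :: real measure" I
    by (intro finite_product_sigma_finite.intro product_sigma_finite_lborel finite_product_sigma_finite_axioms.intro) simp
  have sf: "sigma_finite_measure M" unfolding M_def by (rule fps.sigma_finite_measure_axioms)
  have [measurable]: "U \<in> borel_measurable borel" by (rule borel_measurable_continuous_onI[OF cU])
  have "(\<lambda>g. \<Sum>i\<in>I. g i *\<^sub>R axis i (1::real)) \<in> borel_measurable M"
    unfolding M_def by measurable
  then have [measurable]: "coord_emb k \<in> borel_measurable M"
    by (simp add: coord_emb_sum[abs_def] I_def)
  have \<phi>m: "\<phi> \<in> M \<rightarrow>\<^sub>M borel" unfolding \<phi>_def[abs_def] by measurable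
  obtain v where v: "U v = \<tau>" using orthogonal_transformation_surj[OF U] by (metis surjD)
  \<comment> \<open>Tangency of \<open>\<tau>\<close> to the hyperplane becomes the vanishing of the
    k-th coordinate, so moving along \<open>\<tau>\<close> is a translation of the remaining
    coordinates.\<close>
  have "v $ k = v \<bullet> axis k 1" by (simp add: inner_axis)
  also have "\<dots> = U v \<bullet> U (axis k 1)" using U by (simp add: orthogonal_transformation_def)
  finally have vk: "v $ k = 0" using v Uk \<tau>(2) by simp
  define sh where "sh t g = (\<lambda>i\<in>I. g i + t * v $ i)" for t and g :: "'n \<Rightarrow> real"
  have sh: "sh t \<in> M \<rightarrow>\<^sub>M M" "distr M M (sh t) = M" for t
    unfolding M_def sh_def[abs_def] by (intro PiM_lborel_translation; simp)+
  have shp: "\<phi> (sh t g) = \<phi> g + t *\<^sub>R \<tau>" for t g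
  proof -
    have "coord_emb k (sh t g) = coord_emb k g + t *\<^sub>R v"
      using vk by (auto simp: coord_emb_def sh_def I_def vec_eq_iff)
    then show ?thesis using linU v by (simp add: \<phi>_def linear_add linear_cmul)
  qed
  have fin: "emeasure M {g \<in> space M. norm (\<phi> g) \<le> R} < \<infinity>" for R
  proof -
    define r where "r = R + \<bar>s\<bar>"
    have sub: "{g \<in> space M. norm (\<phi> g) \<le> R} \<subseteq> Pi\<^sub>E I (\<lambda>_. {-r..r})"
    proof
      fix g assume "g \<in> {g \<in> space M. norm (\<phi> g) \<le> R}"
      then have g: "g \<in> space M" "norm (\<phi> g) \<le> R" by auto
      have "norm (U (coord_emb k g)) \<le> norm (\<phi> g) + norm (s *\<^sub>R \<theta>)"
        using norm_triangle_ineq4[of "\<phi> g" "s *\<^sub>R \<theta>"] by (simp add: \<phi>_def)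
      then have "norm (coord_emb k g) \<le> r"
        using g(2) \<theta> U by (simp add: orthogonal_transformation_norm r_def)
      then have comp: "\<bar>coord_emb k g $ i\<bar> \<le> r" for i
        using component_le_norm_cart[of "coord_emb k g" i] by linarith
      have "g i \<in> {-r..r}" if "i \<in> I" for i
        using comp[of i] that by (simp add: coord_emb_def I_def abs_le_iff)
      then show "g \<in> Pi\<^sub>E I (\<lambda>_. {-r..r})" using g(1) by (auto simp: M_def space_PiM PiE_iff)
    qed
    have "emeasure M {g \<in> space M. norm (\<phi> g) \<le> R} \<le> emeasure M (Pi\<^sub>E I (\<lambda>_. {-r..r}))"
      by (rule emeasure_mono[OF sub]) (simp add: M_def sets_PiM_I_finite)
    also have "\<dots> = (\<Prod>i\<in>I. emeasure lborel {-r..r})" unfolding M_def by (rule fps.measure_times) simp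
    also have "\<dots> < \<infinity>"
    proof -
      have "emeasure lborel {-r..r} \<noteq> \<infinity>" by (simp add: emeasure_lborel_Icc_eq)
      then have "(\<Prod>i\<in>I. emeasure lborel {-r..r}) \<noteq> \<infinity>" unfolding infinity_ennreal_def ennreal_prod_eq_top by blast
      then show ?thesis by (simp only: less_top infinity_ennreal_def)
    qed
    finally show ?thesis .
  qed
  have hm: "h \<in> borel_measurable borel" by (rule borel_measurable_continuous_onI[OF h])
  note * = integral_zero_if_line_integrals_zero[OF sf \<phi>m sh shp \<tau>(1) fin h h0 line]
  show "integrable (hyperplane_measure s \<theta>) h" "integral\<^sup>L (hyperplane_measure s \<theta>) h = 0"
    unfolding hyp using * by (simp_all add: integrable_distr_eq[OF \<phi>m hm] integral_distr[OF \<phi>m hm])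
qed

text \<open>The direction \<open>(1, 0)\<close> on \<open>Theta a b\<close> is an arbitrary choice: there the hyperplane contains the whole
  coordinate plane, hence lines of every direction.\<close>

definition dir :: "'n::finite \<Rightarrow> 'n \<Rightarrow> real ^ 'n \<Rightarrow> real \<times> real" where
  "dir a b \<theta> = (if \<theta> $ a = 0 \<and> \<theta> $ b = 0 then (1, 0)
     else (\<theta> $ a * inverse (sqrt ((\<theta> $ a)\<^sup>2 + (\<theta> $ b)\<^sup>2)), \<theta> $ b * inverse (sqrt ((\<theta> $ a)\<^sup>2 + (\<theta> $ b)\<^sup>2))))"

lemma dir_unit: "(fst (dir a b \<theta>))\<^sup>2 + (snd (dir a b \<theta>))\<^sup>2 = 1"
proof (cases "\<theta> $ a = 0 \<and> \<theta> $ b = 0")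
  case False
  then have p: "0 < (\<theta> $ a)\<^sup>2 + (\<theta> $ b)\<^sup>2" by (simp add: sum_power2_gt_zero_iff)
  define q where "q = (\<theta> $ a)\<^sup>2 + (\<theta> $ b)\<^sup>2"
  have "(fst (dir a b \<theta>))\<^sup>2 + (snd (dir a b \<theta>))\<^sup>2 = q * (inverse (sqrt q))\<^sup>2"
    unfolding dir_def if_not_P[OF False] by (simp add: q_def[symmetric] power_mult_distrib distrib_right[symmetric])
  also have "\<dots> = 1" using p unfolding q_def[symmetric] by (simp add: power_inverse)
  finally show ?thesis .
qed (simp add: dir_def)

text \<open>Smoothness on the sphere is expressed through the extension that is constant along rays;
  by this invariance \<open>Wt\<close> is already that extension.\<close>

lemma dir_scale:
  assumes "0 < c"
  shows "dir a b (c *\<^sub>R \<theta>) = dir a b \<theta>"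
proof -
  have "(c * x)\<^sup>2 + (c * y)\<^sup>2 = c\<^sup>2 * (x\<^sup>2 + y\<^sup>2)" for x y :: real by (simp add: power_mult_distrib distrib_left)
  then have "sqrt ((c * x)\<^sup>2 + (c * y)\<^sup>2) = c * sqrt (x\<^sup>2 + y\<^sup>2)" for x y
    using assms by (simp add: real_sqrt_mult)
  then show ?thesis using assms by (simp add: dir_def)
qed

text \<open>This makes the line direction (- n2, n1) of the coordinate plane orthogonal to
  \<open>\<theta>\<close>; on \<open>Theta a b\<close> both sides are 0.\<close>

lemma dir_tangent: "fst (dir a b \<theta>) * \<theta> $ b = snd (dir a b \<theta>) * \<theta> $ a"
  by (simp add: dir_def)

section \<open>Coordinates and directions off the exceptional set\<close>

lemma not_in_Theta_iff:
  "\<theta> \<noteq> 0 \<and> \<theta> /\<^sub>R norm \<theta> \<notin> Theta a b \<longleftrightarrow> \<theta> $ a \<noteq> 0 \<or> \<theta> $ b \<noteq> 0"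
  by (auto simp: Theta_def inner_axis)

lemma smooth1_component: "smooth1 S (\<lambda>x :: real ^ 'n::finite. x $ i)"
  by (rule smooth1_linear[OF bounded_linear_vec_nth])

lemma smooth1_fst_component: "smooth1 S (\<lambda>p :: (real ^ 'n::finite) \<times> (real ^ 'n). fst p $ i)"
  and smooth1_snd_component: "smooth1 S (\<lambda>p :: (real ^ 'n::finite) \<times> (real ^ 'n). snd p $ i)"
  by (rule smooth1_linear[OF bounded_linear_compose[OF bounded_linear_vec_nth bounded_linear_fst]],
      rule smooth1_linear[OF bounded_linear_compose[OF bounded_linear_vec_nth bounded_linear_snd]])

definition off_Theta :: "'n::finite \<Rightarrow> 'n \<Rightarrow> ((real ^ 'n) \<times> (real ^ 'n)) set" where
  "off_Theta a b = {p. 0 < (snd p $ a)\<^sup>2 + (snd p $ b)\<^sup>2}"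

lemma in_off_Theta: "p \<in> off_Theta a b \<longleftrightarrow> snd p $ a \<noteq> 0 \<or> snd p $ b \<noteq> 0"
  by (auto simp: off_Theta_def sum_power2_gt_zero_iff)

lemma open_off_Theta: "open (off_Theta a b)"
  unfolding off_Theta_def by (intro open_Collect_less continuous_intros)

lemma smooth1_dir:
  "smooth1 (off_Theta a b) (\<lambda>p. fst (dir a b (snd p)))" "smooth1 (off_Theta a b) (\<lambda>p. snd (dir a b (snd p)))"
proof -
  have r: "smooth1 (off_Theta a b) (\<lambda>p. inverse (sqrt ((snd p $ a)\<^sup>2 + (snd p $ b)\<^sup>2)))"
    by (rule smooth1_inverse_sqrt[OF _ _ open_off_Theta])
      (intro Cinf_add Cinf_power smooth1_snd_component, simp add: off_Theta_def)
  show "smooth1 (off_Theta a b) (\<lambda>p. fst (dir a b (snd p)))"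
    by (rule Cinf_cong[OF open_off_Theta Cinf_mult[OF smooth1_snd_component[of _ a] r]])
      (auto simp: in_off_Theta dir_def)
  show "smooth1 (off_Theta a b) (\<lambda>p. snd (dir a b (snd p)))"
    by (rule Cinf_cong[OF open_off_Theta Cinf_mult[OF smooth1_snd_component[of _ b] r]])
      (auto simp: in_off_Theta dir_def)
qed

definition rest :: "'n::finite \<Rightarrow> 'n \<Rightarrow> real ^ 'n \<Rightarrow> real" where
  "rest a b x = (\<Sum>i\<in>UNIV - {a, b}. (x $ i)\<^sup>2)"

lemma norm_square_split:
  assumes "a \<noteq> b"
  shows "(norm x)\<^sup>2 = rsq (x $ a, x $ b) + rest a b x"
proof -
  have "(norm x)\<^sup>2 = (\<Sum>i\<in>UNIV. (x $ i)\<^sup>2)"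
    unfolding norm_vec_def L2_set_def by (simp add: sum_nonneg)
  also have "\<dots> = (\<Sum>i\<in>{a, b}. (x $ i)\<^sup>2) + rest a b x"
    unfolding rest_def by (subst sum.subset_diff[of "{a, b}"]) (auto simp: add.commute)
  finally show ?thesis using assms by (simp add: rsq_def)
qed

text \<open>Connects the gauge integrals of the planar part with the Lebesgue integrals over lines
  in the hyperplane.\<close>

lemma integral_lborel_compact_support:
  fixes q :: "real \<Rightarrow> real"
  assumes "continuous_on UNIV q" "\<And>t. 1 < \<bar>t\<bar> \<Longrightarrow> q t = 0"
  shows "integral\<^sup>L lborel q = integral {-2..2} q"
proof -
  have "indicator {-2..2} t *\<^sub>R q t = q t" for t
    using assms(2)[of t] by (cases "t \<in> {-2..2}") auto
  then have "(\<lambda>t. indicator {-2..2} t *\<^sub>R q t) = q" by (rule ext)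
  moreover have "integrable lborel (\<lambda>t. indicator {-2..2} t *\<^sub>R q t)"
    by (rule borel_integrable_compact[OF compact_Icc continuous_on_subset[OF assms(1)]]) simp
  ultimately have "integrable lborel q" by simp
  then have "(q has_integral (integral\<^sup>L lborel q)) UNIV" by (rule has_integral_integral_lborel)
  moreover have "(q has_integral (integral {-2..2} q)) UNIV"
  proof (rule has_integral_on_superset)
    show "(q has_integral (integral {-2..2} q)) {-2..2}"
      by (intro integrable_integral integrable_continuous_interval continuous_on_subset[OF assms(1)]) simp
    show "q t = 0" if "t \<notin> {-2..2}" for t using that by (intro assms(2)) auto
  qed simp
  ultimately show ?thesis by (rule has_integral_unique)
qed

section \<open>The weight and the function in n-space\<close>

context boman
begin

text \<open>The factor 4/5 moves the range [3/4, 5/4] of \<open>1 - T\<close> into [3/5, 1].\<close>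

definition Wt :: "'n::finite \<Rightarrow> 'n \<Rightarrow> real ^ 'n \<Rightarrow> real ^ 'n \<Rightarrow> real" where
  "Wt a b x \<theta> = 4/5 * (1 - T (x $ a, x $ b) (fst (dir a b \<theta>)) (snd (dir a b \<theta>)))"

text \<open>The cutoff gives compact support. It depends on the other coordinates only, so it is
  constant along the lines of the foliation and keeps their integrals zero.\<close>

definition ft :: "'n::finite \<Rightarrow> 'n \<Rightarrow> real ^ 'n \<Rightarrow> real" where
  "ft a b x = f0 (x $ a, x $ b) * step (2 - rest a b x)"

lemma Wt_bounds: "1/2 \<le> Wt a b x \<theta>" "Wt a b x \<theta> \<le> 1"
proof -
  have "\<bar>T (x $ a, x $ b) (fst (dir a b \<theta>)) (snd (dir a b \<theta>))\<bar> \<le> 1/4" by (rule T_bound[OF dir_unit])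
  then show "1/2 \<le> Wt a b x \<theta>" and "Wt a b x \<theta> \<le> 1" by (simp_all add: Wt_def abs_le_iff)
qed

lemma smooth1_Wt: "smooth1 (off_Theta a b) (\<lambda>p. Wt a b (fst p) (snd p))"
  unfolding Wt_def
  by (intro Cinf_scale Cinf_diff Cinf_const' smooth1_T open_off_Theta smooth1_fst_component smooth1_dir dir_unit)
    simp

lemma smooth1_T_fixed:
  fixes S :: "'a::euclidean_space set"
  assumes "open S" "smooth1 S X1" "smooth1 S X2" "n1\<^sup>2 + n2\<^sup>2 = 1"
  shows "smooth1 S (\<lambda>p. T (X1 p, X2 p) n1 n2)"
  by (rule smooth1_T[OF assms(1-3) Cinf_const' Cinf_const' assms(4)]) simp_all

lemma smooth_on_Wt:
  fixes a b :: "'n::finite"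
  shows "smooth_on {p. snd p \<noteq> 0 \<and> snd p /\<^sub>R norm (snd p) \<notin> Theta a b}
     (\<lambda>p. Wt a b (fst p) (snd p /\<^sub>R norm (snd p)))"
proof -
  have S: "{p. snd p \<noteq> 0 \<and> snd p /\<^sub>R norm (snd p) \<notin> Theta a b} = off_Theta a b"
    by (auto simp only: not_in_Theta_iff in_off_Theta mem_Collect_eq)
  have "smooth1 (off_Theta a b) (\<lambda>p. Wt a b (fst p) (snd p /\<^sub>R norm (snd p)))"
  proof (rule Cinf_cong[OF open_off_Theta smooth1_Wt])
    fix p :: "(real ^ 'n) \<times> (real ^ 'n)" assume "p \<in> off_Theta a b"
    then have "snd p \<noteq> 0" by (auto simp: in_off_Theta)
    then have "0 < inverse (norm (snd p))" by simp
    then show "Wt a b (fst p) (snd p) = Wt a b (fst p) (snd p /\<^sub>R norm (snd p))"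
      unfolding Wt_def by (simp only: dir_scale)
  qed
  then show ?thesis unfolding S by (rule smooth_on_if_smooth1[OF open_off_Theta])
qed

text \<open>The weight is continuous on the open set \<open>off_Theta a b\<close>, and on the
  complement the direction is constantly (1, 0), so it is continuous there as well.\<close>

lemma measurable_Wt:
  fixes a b :: "'n::finite"
  shows "(\<lambda>p. Wt a b (fst p) (snd p)) \<in> borel_measurable borel"
proof -
  let ?F = "\<lambda>p :: (real ^ 'n) \<times> (real ^ 'n). 4/5 * (1 - T (fst p $ a, fst p $ b) 1 0)"
  have F: "smooth1 UNIV ?F"
    by (intro Cinf_scale Cinf_diff Cinf_const' smooth1_T_fixed smooth1_fst_component open_UNIV) simp_all
  have "(\<lambda>p. if p \<in> off_Theta a b then Wt a b (fst p) (snd p) else ?F p) \<in> borel_measurable borel"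
    by (rule borel_measurable_continuous_on_if[OF borel_open[OF open_off_Theta] Cinf_cont[OF smooth1_Wt]
        continuous_on_subset[OF Cinf_cont[OF F]]]) simp
  moreover have "(\<lambda>p. if p \<in> off_Theta a b then Wt a b (fst p) (snd p) else ?F p) = (\<lambda>p. Wt a b (fst p) (snd p))"
    by (auto simp: fun_eq_iff in_off_Theta Wt_def dir_def)
  ultimately show ?thesis by (simp only:)
qed

lemma smooth1_ft: "smooth1 UNIV (ft a b)"
proof -
  have r: "smooth1 UNIV (\<lambda>x. \<Sum>i\<in>I. (x $ i)\<^sup>2)" if "finite I" for I
    using that by (induction I) (simp_all add: Cinf_const' Cinf_add Cinf_power smooth1_component)
  have "smooth1 UNIV (\<lambda>x. f0 (x $ a, x $ b))"
    by (rule Cinf_compose2[OF smooth1_f0 open_UNIV open_UNIV smooth1_component smooth1_component]) simp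
  moreover have "smooth1 UNIV (\<lambda>x. step (2 - rest a b x))"
    using r unfolding rest_def by (intro Cinf_step Cinf_diff Cinf_const' open_UNIV) simp_all
  ultimately show ?thesis unfolding ft_def[abs_def] by (rule Cinf_mult)
qed

lemma ft_support:
  assumes "a \<noteq> b" "2 < norm x"
  shows "ft a b x = 0"
proof (cases "1 \<le> rsq (x $ a, x $ b)")
  case True
  then show ?thesis by (simp add: ft_def f0_outside)
next
  case False
  have "2\<^sup>2 \<le> (norm x)\<^sup>2" using assms(2) by (intro power_mono) auto
  then have "2 - rest a b x \<le> 0" using False norm_square_split[OF assms(1), of x] by simp
  then show ?thesis by (simp add: ft_def step_0)
qed

lemma C0_infty_ft:
  assumes "a \<noteq> b"
  shows "C0_infty (ft a b)"
  unfolding C0_infty_def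
proof (intro conjI exI[of _ "cball 0 2"] allI impI)
  show "smooth_on UNIV (ft a b)" by (rule smooth_on_if_smooth1[OF open_UNIV smooth1_ft])
  show "ft a b x = 0" if "x \<notin> cball 0 2" for x
    using that by (intro ft_support[OF assms]) simp
qed simp

lemma ft_nonzero:
  fixes a b :: "'n::finite"
  assumes "a \<noteq> b"
  shows "\<exists>x. ft a b x \<noteq> 0"
proof -
  obtain z where z: "f0 z \<noteq> 0" using f0_nonzero by blast
  define x :: "real ^ 'n" where "x = (\<chi> i. if i = a then fst z else if i = b then snd z else 0)"
  have "rest a b x = 0" by (simp add: rest_def x_def)
  then have "ft a b x = f0 z" using assms by (simp add: ft_def step_1 x_def)
  then show ?thesis using z by metis
qed

lemma line_integral_zero:
  assumes n: "n1\<^sup>2 + n2\<^sup>2 = 1"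
  shows "integral\<^sup>L lborel (\<lambda>t. f0 (x1 - t * n2, x2 + t * n1) * (1 - T (x1 - t * n2, x2 + t * n1) n1 n2)) = 0"
proof -
  define s where "s = x1 * n1 + x2 * n2"
  \<comment> \<open>The arc length parameter of (x1, x2), counted from the point of the line nearest
    to the origin. Translation invariance of the integral then removes it.\<close>
  define t0 where "t0 = x2 * n1 - x1 * n2"
  define q where "q t = f0 (lpt n1 n2 s t) * (1 - T (lpt n1 n2 s t) n1 n2)" for t
  have pt: "(x1 - t * n2, x2 + t * n1) = lpt n1 n2 s (t0 + 1 * t)" for t
  proof -
    have "s * n1 - (t0 + 1 * t) * n2 = x1 * (n1\<^sup>2 + n2\<^sup>2) - t * n2"
      "s * n2 + (t0 + 1 * t) * n1 = x2 * (n1\<^sup>2 + n2\<^sup>2) + t * n1"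
      by (simp_all add: s_def t0_def power2_eq_square algebra_simps)
    then show ?thesis unfolding lpt_def n by simp
  qed
  have sm: "smooth1 UNIV (\<lambda>t. s * n1 - t * n2)" "smooth1 UNIV (\<lambda>t. s * n2 + t * n1)"
    by (intro Cinf_diff Cinf_add Cinf_mult Cinf_const' smooth1_linear bounded_linear_ident; simp)+
  have "smooth1 UNIV q" unfolding q_def[abs_def] lpt_def
    by (intro Cinf_mult Cinf_diff Cinf_const' Cinf_compose2[OF smooth1_f0] smooth1_T_fixed sm n open_UNIV) simp_all
  then have "continuous_on UNIV q" by (rule Cinf_cont)
  moreover have "q t = 0" if "1 < \<bar>t\<bar>" for t
  proof -
    have "1\<^sup>2 \<le> \<bar>t\<bar>\<^sup>2" using that by (intro power_mono) auto
    then have "1 \<le> rsq (lpt n1 n2 s t)" unfolding rsq_lpt[OF n] by (simp add: add_increasing)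
    then show ?thesis by (simp add: q_def f0_outside)
  qed
  ultimately have "integral\<^sup>L lborel q = integral {-2..2} q" by (rule integral_lborel_compact_support)
  also have "\<dots> = 0" using lint_weighted_zero[OF n, of s] unfolding q_def lint_def .
  finally have "integral\<^sup>L lborel (\<lambda>t. q (t0 + 1 * t)) = 0"
    using lborel_integral_real_affine[of 1 q t0] by simp
  then show ?thesis unfolding pt q_def .
qed

lemma hyperplane_zero:
  fixes a b :: "'n::finite"
  assumes ab: "a \<noteq> b" and \<theta>: "norm \<theta> = 1"
  shows "integrable (hyperplane_measure s \<theta>) (\<lambda>x. Wt a b x \<theta> * ft a b x)"
    "weighted_radon (Wt a b) (ft a b) s \<theta> = 0"
proof -
  define n1 n2 where "n1 = fst (dir a b \<theta>)" and "n2 = snd (dir a b \<theta>)"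
  have n: "n1\<^sup>2 + n2\<^sup>2 = 1" unfolding n1_def n2_def by (rule dir_unit)
  \<comment> \<open>The planar direction turned by a right angle; the lines parallel to it foliate
    the hyperplane.\<close>
  define \<tau> :: "real ^ 'n" where "\<tau> = (- n2) *\<^sub>R axis a 1 + n1 *\<^sub>R axis b 1"
  have \<tau>x: "\<tau> \<bullet> x = - n2 * x $ a + n1 * x $ b" for x
    by (simp add: \<tau>_def inner_add_left inner_diff_left inner_axis')
  have \<tau>c: "\<tau> $ a = - n2" "\<tau> $ b = n1" "i \<noteq> a \<Longrightarrow> i \<noteq> b \<Longrightarrow> \<tau> $ i = 0" for i
    using ab by (auto simp: \<tau>_def axis_def)
  have \<tau>1: "\<tau> \<bullet> \<tau> = 1" unfolding \<tau>x \<tau>c using n by (simp add: power2_eq_square)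
  have \<tau>0: "\<tau> \<bullet> \<theta> = 0" unfolding \<tau>x n1_def n2_def using dir_tangent[of a b \<theta>] by simp
  define h where "h x = Wt a b x \<theta> * ft a b x" for x
  \<comment> \<open>With \<open>\<theta>\<close> fixed the direction is constant, so this holds also
    for \<open>\<theta>\<close> in \<open>Theta a b\<close>, where the weight need not be continuous
    in \<open>\<theta>\<close>.\<close>
  have "smooth1 UNIV h" unfolding h_def[abs_def] Wt_def
    by (intro Cinf_mult Cinf_scale Cinf_diff Cinf_const' smooth1_T_fixed smooth1_component smooth1_ft dir_unit open_UNIV)
      simp
  then have hc: "continuous_on UNIV h" by (rule Cinf_cont)
  have h0: "h x = 0" if "2 < norm x" for x using ft_support[OF ab that] by (simp add: h_def)
  have line: "integral\<^sup>L lborel (\<lambda>t. h (x + t *\<^sub>R \<tau>)) = 0" for x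
  proof -
    have r: "rest a b (x + t *\<^sub>R \<tau>) = rest a b x" for t
      unfolding rest_def by (intro sum.cong refl) (simp add: \<tau>c)
    have eq: "h (x + t *\<^sub>R \<tau>) = (4/5 * step (2 - rest a b x)) *
        (f0 (x $ a - t * n2, x $ b + t * n1) * (1 - T (x $ a - t * n2, x $ b + t * n1) n1 n2))" for t
      unfolding h_def Wt_def ft_def r n1_def[symmetric] n2_def[symmetric] by (simp add: \<tau>c)
    show ?thesis unfolding eq integral_mult_right_zero line_integral_zero[OF n] by simp
  qed
  from hyperplane_integral_zero[OF \<theta> \<tau>1 \<tau>0 hc h0 line, where s = s]
  show "integrable (hyperplane_measure s \<theta>) (\<lambda>x. Wt a b x \<theta> * ft a b x)"
    "weighted_radon (Wt a b) (ft a b) s \<theta> = 0"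
    unfolding weighted_radon_def h_def[abs_def] by simp_all
qed

end

theorem theorem1:
  fixes a b :: "'n::finite"
  assumes "CARD('n) \<ge> 3" and "a \<noteq> b"
  shows "\<exists>(W :: real^'n \<Rightarrow> real^'n \<Rightarrow> real) (f :: real^'n \<Rightarrow> real).
           (\<lambda>p. W (fst p) (snd p)) \<in> borel_measurable (restrict_space borel (UNIV \<times> sphere 0 1)) \<and>
           (\<exists>c>0. \<forall>x. \<forall>\<theta>\<in>sphere 0 1. W x \<theta> \<ge> c) \<and>
           (\<forall>x. \<forall>\<theta>\<in>sphere 0 1. 1/2 \<le> W x \<theta> \<and> W x \<theta> \<le> 1) \<and>
           smooth_on {p :: (real^'n) \<times> (real^'n). snd p \<noteq> 0 \<and> snd p /\<^sub>R norm (snd p) \<notin> Theta a b}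
                     (\<lambda>p. W (fst p) (snd p /\<^sub>R norm (snd p))) \<and>
           C0_infty f \<and>
           (\<exists>x. f x \<noteq> 0) \<and>
           (\<forall>s. \<forall>\<theta>\<in>sphere 0 1.
              integrable (hyperplane_measure s \<theta>) (\<lambda>x. W x \<theta> * f x) \<and>
              weighted_radon W f s \<theta> = 0)"
proof -
  obtain \<kappa> \<epsilon> N B where "boman \<kappa> \<epsilon> N B" using boman_exists by blast
  then interpret boman \<kappa> \<epsilon> N B .
  show ?thesis
  proof (intro exI[of _ "Wt a b"] exI[of _ "ft a b"] conjI allI ballI)
    show "(\<lambda>p. Wt a b (fst p) (snd p)) \<in> borel_measurable (restrict_space borel (UNIV \<times> sphere 0 1))"
      by (rule measurable_restrict_space1[OF measurable_Wt])
    show "\<exists>c>0. \<forall>x. \<forall>\<theta>\<in>sphere 0 1. c \<le> Wt a b x \<theta>"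
      using Wt_bounds(1)[of a b] by (intro exI[of _ "1/2"]) auto
    show "1/2 \<le> Wt a b x \<theta>" "Wt a b x \<theta> \<le> 1" for x \<theta> by (rule Wt_bounds)+
    show "smooth_on {p. snd p \<noteq> 0 \<and> snd p /\<^sub>R norm (snd p) \<notin> Theta a b}
        (\<lambda>p. Wt a b (fst p) (snd p /\<^sub>R norm (snd p)))" by (rule smooth_on_Wt)
    show "C0_infty (ft a b)" "\<exists>x. ft a b x \<noteq> 0"
      using C0_infty_ft ft_nonzero assms(2) by blast+
    fix s and \<theta> :: "real ^ 'n" assume "\<theta> \<in> sphere 0 1"
    then have "norm \<theta> = 1" by simp
    from hyperplane_zero[OF assms(2) this]
    show "integrable (hyperplane_measure s \<theta>) (\<lambda>x. Wt a b x \<theta> * ft a b x)"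
      "weighted_radon (Wt a b) (ft a b) s \<theta> = 0" by blast+
  qed
qed

end
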